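(* Let $A$ be a nonzero separable C*-algebra and let $\mathfrak r=(\rho_n)_{n\in\mathbb N}$ be a sequence of non-degenerate $*$-endomorphisms of $A$ such that (i) $\limsup_{n\to\infty}\|\rho_n(a)\|=\|a\|$ for every $a\in A$; and (ii) there is no ideal $I$ of $A$ with $\{0\}\neq I\neq A$ and $\rho_n(I)\subset I$ for all $n\in\mathbb N$. Then the Toeplitz--Pimsner algebra $\mathcal T_{\mathcal E_{\mathfrak r}}$ of the C*-correspondence $\mathcal E_{\mathfrak r}$ associated to $\mathfrak r$ is simple.
   Context: $\mathbb N=\{0,1,2,\dots\}$. Ideals of C*-algebras are closed and two-sided. A $*$-homomorphism is non-degenerate if it maps an approximate unit to an approximate unit. The C*-correspondence $\mathcal E_{\mathfrak r}$ over $A$: as a right Hilbert $A$-module $\mathcal E_{\mathfrak r}:=\ell^2(\mathbb N)\otimes A$, with left $A$-action $\pi_{\mathfrak r}(a)(\delta_n\otimes b):=\delta_n\otimes\rho_n(a)b$ for $a,b\in A$, $n\in\mathbb N$. For a non-degenerate C*-correspondence $\mathcal E$ over $A$, put $\mathcal E^{\otimes 0}:=A$ and let $\mathcal E^{\otimes n}$ be the $n$-fold tensor power over $A$; let $\mathrm F(\mathcal E)=\bigoplus_{n\in\mathbb N}\mathcal E^{\otimes n}$ be the full Fock space. The Toeplitz--Pimsner algebra $\mathcal T_{\mathcal E}$ is the C*-algebra of adjointable operators on $\mathrm F(\mathcal E)$ generated by the left action of $A$ and the creation operators $T_\xi\colon\eta\mapsto\xi\otimes\eta$, $\xi\in\mathcal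 E$. Equivalently, it is the universal C*-algebra generated by a copy of $A$ and symbols $T_\xi$ ($\xi\in\mathcal E$), additive in $\xi$, with $T_{a\xi}=aT_\xi$, $T_{\xi a}=T_\xi a$, $T_\xi^*T_\eta=\langle\xi,\eta\rangle_A$. (For $\mathcal E_{\mathfrak r}$ satisfying (i), it coincides with the Cuntz--Pimsner algebra $\mathcal O_{\mathcal E_{\mathfrak r}}$.) *)

theory Defs
  imports "HOL-Analysis.Analysis"
begin

section \<open>C*-algebras, ideals, *-endomorphisms\<close>

(* Not necessarily unital.  Completeness comes from complete_space. *)
class cstar_algebra = real_normed_algebra + complete_space +
  fixes scaleC :: "complex \<Rightarrow> 'a \<Rightarrow> 'a"  (infixr "*\<^sub>C" 75)
    and star :: "'a \<Rightarrow> 'a"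
  assumes scaleC_add_right: "c *\<^sub>C (x + y) = c *\<^sub>C x + c *\<^sub>C y"
    and scaleC_add_left: "(c + d) *\<^sub>C x = c *\<^sub>C x + d *\<^sub>C x"
    and scaleC_scaleC: "c *\<^sub>C d *\<^sub>C x = (c * d) *\<^sub>C x"
    and scaleR_scaleC: "r *\<^sub>R x = complex_of_real r *\<^sub>C x"
    and mult_scaleC_left: "(c *\<^sub>C x) * y = c *\<^sub>C (x * y)"
    and mult_scaleC_right: "x * (c *\<^sub>C y) = c *\<^sub>C (x * y)"
    and norm_scaleC: "norm (c *\<^sub>C x) = cmod c * norm x"
    and star_add: "star (x + y) = star x + star y"
    and star_scaleC: "star (c *\<^sub>C x) = cnj c *\<^sub>C star x"
    and star_mult: "star (x * y) = star y * star x"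
    and star_star: "star (star x) = x"
    and norm_star_mult_self: "norm (star x * x) = (norm x)\<^sup>2"

definition closed_ideal :: "'a::cstar_algebra set \<Rightarrow> bool" where
  "closed_ideal I \<longleftrightarrow> closed I \<and> 0 \<in> I \<and>
     (\<forall>x\<in>I. \<forall>y\<in>I. x + y \<in> I) \<and> (\<forall>c. \<forall>x\<in>I. c *\<^sub>C x \<in> I) \<and>
     (\<forall>a. \<forall>x\<in>I. a * x \<in> I \<and> x * a \<in> I)"

definition star_endomorphism :: "('a::cstar_algebra \<Rightarrow> 'a) \<Rightarrow> bool" where
  "star_endomorphism f \<longleftrightarrow>
     (\<forall>x y. f (x + y) = f x + f y) \<and> (\<forall>c x. f (c *\<^sub>C x) = c *\<^sub>C f x) \<and>
     (\<forall>x y. f (x * y) = f x * f y) \<and> (\<forall>x. f (star x) = star (f x))"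

(* An approximate unit is a net of positive contractions; the net is represented by the filter
   on A that it generates, and its image under a map f by filtermap f. *)
definition approximate_unit :: "'a::cstar_algebra filter \<Rightarrow> bool" where
  "approximate_unit F \<longleftrightarrow> F \<noteq> bot \<and>
     (\<forall>\<^sub>F e in F. (\<exists>b. e = star b * b) \<and> norm e \<le> 1) \<and>
     (\<forall>a. ((\<lambda>e. e * a) \<longlongrightarrow> a) F \<and> ((\<lambda>e. a * e) \<longlongrightarrow> a) F)"

definition nondegenerate :: "('a::cstar_algebra \<Rightarrow> 'a) \<Rightarrow> bool" where
  "nondegenerate f \<longleftrightarrow> (\<exists>F. approximate_unit F \<and> approximate_unit (filtermap f F))"


section \<open>Hilbert modules\<close>

(* The data of a right (semi-)inner product A-module: hact x a is x a, and the inner product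
   is A-linear in the second variable. *)
record ('a, 'e) hmodule =
  hcarrier :: "'e set"
  hzero :: 'e
  hadd :: "'e \<Rightarrow> 'e \<Rightarrow> 'e"
  hscale :: "complex \<Rightarrow> 'e \<Rightarrow> 'e"
  hact :: "'e \<Rightarrow> 'a \<Rightarrow> 'e"
  hinner :: "'e \<Rightarrow> 'e \<Rightarrow> 'a"

record ('a, 'e) correspondence = "('a, 'e) hmodule" +
  lact :: "'a \<Rightarrow> 'e \<Rightarrow> 'e"

definition hnorm :: "('a::cstar_algebra, 'e, 'm) hmodule_scheme \<Rightarrow> 'e \<Rightarrow> real" where
  "hnorm M x = sqrt (norm (hinner M x x))"

definition hdiff :: "('a::cstar_algebra, 'e, 'm) hmodule_scheme \<Rightarrow> 'e \<Rightarrow> 'e \<Rightarrow> 'e" where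
  "hdiff M x y = hadd M x (hscale M (- 1) y)"

definition self_module :: "('a::cstar_algebra, 'a) hmodule" where
  "self_module = \<lparr>hcarrier = UNIV, hzero = 0, hadd = (+), hscale = (*\<^sub>C),
     hact = (*), hinner = (\<lambda>x y. star x * y)\<rparr>"

(* Orthogonal direct sum: the sequences whose squares sum in the norm of A. *)
definition direct_sum ::
  "(nat \<Rightarrow> ('a::cstar_algebra, 'e) hmodule) \<Rightarrow> ('a, nat \<Rightarrow> 'e) hmodule" where
  "direct_sum M = \<lparr>
     hcarrier = {x. (\<forall>n. x n \<in> hcarrier (M n)) \<and> summable (\<lambda>n. hinner (M n) (x n) (x n))},
     hzero = (\<lambda>n. hzero (M n)),
     hadd = (\<lambda>x y n. hadd (M n) (x n) (y n)),
     hscale = (\<lambda>c x n. hscale (M n) c (x n)),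
     hact = (\<lambda>x a n. hact (M n) (x n) a),
     hinner = (\<lambda>x y. \<Sum>n. hinner (M n) (x n) (y n))\<rparr>"


subsection \<open>Completion of a semi-inner product module\<close>

definition hcauchy :: "('a::cstar_algebra, 'e) hmodule \<Rightarrow> (nat \<Rightarrow> 'e) \<Rightarrow> bool" where
  "hcauchy M u \<longleftrightarrow> (\<forall>n. u n \<in> hcarrier M) \<and>
     (\<forall>\<epsilon>>0. \<exists>N. \<forall>m\<ge>N. \<forall>n\<ge>N. hnorm M (hdiff M (u m) (u n)) < \<epsilon>)"

definition hclass :: "('a::cstar_algebra, 'e) hmodule \<Rightarrow> (nat \<Rightarrow> 'e) \<Rightarrow> (nat \<Rightarrow> 'e) set" where
  "hclass M u = {v. hcauchy M v \<and> (\<lambda>n. hnorm M (hdiff M (u n) (v n))) \<longlonglongrightarrow> 0}"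

definition hrep :: "(nat \<Rightarrow> 'e) set \<Rightarrow> nat \<Rightarrow> 'e" where
  "hrep X = (SOME u. u \<in> X)"

(* Cauchy sequences modulo null sequences; this also divides out the vectors of length 0. *)
definition completion ::
  "('a::cstar_algebra, 'e) hmodule \<Rightarrow> ('a, (nat \<Rightarrow> 'e) set) hmodule" where
  "completion M = \<lparr>
     hcarrier = {hclass M u | u. hcauchy M u},
     hzero = hclass M (\<lambda>k. hzero M),
     hadd = (\<lambda>X Y. hclass M (\<lambda>k. hadd M (hrep X k) (hrep Y k))),
     hscale = (\<lambda>c X. hclass M (\<lambda>k. hscale M c (hrep X k))),
     hact = (\<lambda>X a. hclass M (\<lambda>k. hact M (hrep X k) a)),
     hinner = (\<lambda>X Y. lim (\<lambda>k. hinner M (hrep X k) (hrep Y k)))\<rparr>"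

(* The extension to completions of a map f into the semi-inner product module N. *)
definition completion_map ::
  "('a::cstar_algebra, 'f) hmodule \<Rightarrow> ('e \<Rightarrow> 'f) \<Rightarrow> (nat \<Rightarrow> 'e) set \<Rightarrow> (nat \<Rightarrow> 'f) set" where
  "completion_map N f X = hclass N (\<lambda>k. f (hrep X k))"


section \<open>Tensor powers and the full Fock space\<close>

(* The pair ([x1, ..., xn], a) stands for the elementary tensor x1 \<otimes> ... \<otimes> xn \<otimes> a of
   E \<otimes> (... \<otimes> (E \<otimes> A)), that is, of the n-fold tensor power of E over A, where the
   0-fold tensor power is A. *)
type_synonym ('a, 'e) tensor = "'e list \<times> 'a"

fun tensor_lact ::
  "('a::cstar_algebra, 'e) correspondence \<Rightarrow> 'a \<Rightarrow> ('a, 'e) tensor \<Rightarrow> ('a, 'e) tensor" where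
  "tensor_lact E c ([], a) = ([], c * a)"
| "tensor_lact E c (x # xs, a) = (lact E c x # xs, a)"

(* \<langle>x \<otimes> \<xi>, y \<otimes> \<eta>\<rangle> = \<langle>\<xi>, \<langle>x, y\<rangle> \<eta>\<rangle> *)
function tensor_inner ::
  "('a::cstar_algebra, 'e) correspondence \<Rightarrow> ('a, 'e) tensor \<Rightarrow> ('a, 'e) tensor \<Rightarrow> 'a" where
  "tensor_inner E ([], a) ([], b) = star a * b"
| "tensor_inner E (x # xs, a) (y # ys, b) =
     tensor_inner E (xs, a) (tensor_lact E (hinner E x y) (ys, b))"
| "tensor_inner E ([], a) (y # ys, b) = 0"
| "tensor_inner E (x # xs, a) ([], b) = 0"
  by pat_completeness auto
termination by (relation "Wellfounded.measure (\<lambda>(E, s, t). length (fst s))") auto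

(* A list of elementary tensors stands for their sum.  As the scalars and A act on the last
   factor, these are all elements of the algebraic tensor product; lists with the same sum are
   identified in the completion. *)
definition algebraic_tensor_power ::
  "('a::cstar_algebra, 'e) correspondence \<Rightarrow> nat \<Rightarrow> ('a, ('a, 'e) tensor list) hmodule" where
  "algebraic_tensor_power E n = \<lparr>
     hcarrier = {u. \<forall>(xs, a)\<in>set u. length xs = n \<and> set xs \<subseteq> hcarrier E},
     hzero = [],
     hadd = (@),
     hscale = (\<lambda>c. map (\<lambda>(xs, a). (xs, c *\<^sub>C a))),
     hact = (\<lambda>u b. map (\<lambda>(xs, a). (xs, a * b)) u),
     hinner = (\<lambda>u v. \<Sum>s\<leftarrow>u. \<Sum>t\<leftarrow>v. tensor_inner E s t)\<rparr>"

definition tensor_power ::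
  "('a::cstar_algebra, 'e) correspondence \<Rightarrow> nat \<Rightarrow>
   ('a, (nat \<Rightarrow> ('a, 'e) tensor list) set) hmodule" where
  "tensor_power E n = completion (algebraic_tensor_power E n)"

type_synonym ('a, 'e) fock_vector = "nat \<Rightarrow> (nat \<Rightarrow> ('a, 'e) tensor list) set"

definition fock_space ::
  "('a::cstar_algebra, 'e) correspondence \<Rightarrow> ('a, ('a, 'e) fock_vector) hmodule" where
  "fock_space E = direct_sum (tensor_power E)"


section \<open>C*-algebras of adjointable operators\<close>

definition is_adjoint ::
  "('a, 'f) hmodule \<Rightarrow> ('f \<Rightarrow> 'f) \<Rightarrow> ('f \<Rightarrow> 'f) \<Rightarrow> bool" where
  "is_adjoint M T S \<longleftrightarrow>
     (\<forall>x\<in>hcarrier M. \<forall>y\<in>hcarrier M. hinner M (T x) y = hinner M x (S y))"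

(* Operators are extensional functions (undefined off the carrier), so that equality of
   operators is equality in HOL. *)
definition adjointable :: "('a, 'f) hmodule \<Rightarrow> ('f \<Rightarrow> 'f) set" where
  "adjointable M = {T \<in> hcarrier M \<rightarrow>\<^sub>E hcarrier M.
     \<exists>S \<in> hcarrier M \<rightarrow>\<^sub>E hcarrier M. is_adjoint M T S}"

definition op_zero :: "('a, 'f) hmodule \<Rightarrow> 'f \<Rightarrow> 'f" where
  "op_zero M = (\<lambda>x\<in>hcarrier M. hzero M)"

definition op_add :: "('a, 'f) hmodule \<Rightarrow> ('f \<Rightarrow> 'f) \<Rightarrow> ('f \<Rightarrow> 'f) \<Rightarrow> 'f \<Rightarrow> 'f" where
  "op_add M S T = (\<lambda>x\<in>hcarrier M. hadd M (S x) (T x))"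

definition op_scale :: "('a, 'f) hmodule \<Rightarrow> complex \<Rightarrow> ('f \<Rightarrow> 'f) \<Rightarrow> 'f \<Rightarrow> 'f" where
  "op_scale M c T = (\<lambda>x\<in>hcarrier M. hscale M c (T x))"

definition op_mult :: "('a, 'f) hmodule \<Rightarrow> ('f \<Rightarrow> 'f) \<Rightarrow> ('f \<Rightarrow> 'f) \<Rightarrow> 'f \<Rightarrow> 'f" where
  "op_mult M S T = compose (hcarrier M) S T"

(* Convergence in operator norm: \<parallel>S n - T\<parallel> \<le> \<epsilon> for all large n. *)
definition op_tendsto ::
  "('a::cstar_algebra, 'f) hmodule \<Rightarrow> (nat \<Rightarrow> 'f \<Rightarrow> 'f) \<Rightarrow> ('f \<Rightarrow> 'f) \<Rightarrow> bool" where
  "op_tendsto M S T \<longleftrightarrow> (\<forall>\<epsilon>>0. \<exists>N. \<forall>n\<ge>N. \<forall>x\<in>hcarrier M.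
     hnorm M (hdiff M (S n x) (T x)) \<le> \<epsilon> * hnorm M x)"

definition op_closed_subspace ::
  "('a::cstar_algebra, 'f) hmodule \<Rightarrow> ('f \<Rightarrow> 'f) set \<Rightarrow> bool" where
  "op_closed_subspace M B \<longleftrightarrow> B \<subseteq> adjointable M \<and> op_zero M \<in> B \<and>
     (\<forall>S\<in>B. \<forall>T\<in>B. op_add M S T \<in> B) \<and> (\<forall>c. \<forall>T\<in>B. op_scale M c T \<in> B) \<and>
     (\<forall>S T. (\<forall>n. S n \<in> B) \<and> T \<in> adjointable M \<and> op_tendsto M S T \<longrightarrow> T \<in> B)"

definition op_cstar_subalgebra ::
  "('a::cstar_algebra, 'f) hmodule \<Rightarrow> ('f \<Rightarrow> 'f) set \<Rightarrow> bool" where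
  "op_cstar_subalgebra M B \<longleftrightarrow> op_closed_subspace M B \<and>
     (\<forall>S\<in>B. \<forall>T\<in>B. op_mult M S T \<in> B) \<and>
     (\<forall>T\<in>B. \<forall>S\<in>adjointable M. is_adjoint M T S \<longrightarrow> S \<in> B)"

definition op_cstar_generated ::
  "('a::cstar_algebra, 'f) hmodule \<Rightarrow> ('f \<Rightarrow> 'f) set \<Rightarrow> ('f \<Rightarrow> 'f) set" where
  "op_cstar_generated M G = \<Inter>{B. op_cstar_subalgebra M B \<and> G \<subseteq> B}"

definition op_ideal ::
  "('a::cstar_algebra, 'f) hmodule \<Rightarrow> ('f \<Rightarrow> 'f) set \<Rightarrow> ('f \<Rightarrow> 'f) set \<Rightarrow> bool" where
  "op_ideal M B J \<longleftrightarrow> J \<subseteq> B \<and> op_closed_subspace M J \<and>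
     (\<forall>T\<in>B. \<forall>S\<in>J. op_mult M T S \<in> J \<and> op_mult M S T \<in> J)"

definition op_simple :: "('a::cstar_algebra, 'f) hmodule \<Rightarrow> ('f \<Rightarrow> 'f) set \<Rightarrow> bool" where
  "op_simple M B \<longleftrightarrow> op_cstar_subalgebra M B \<and> B \<noteq> {op_zero M} \<and>
     (\<forall>J. op_ideal M B J \<longrightarrow> J = {op_zero M} \<or> J = B)"


section \<open>The Toeplitz--Pimsner algebra\<close>

definition fock_lact ::
  "('a::cstar_algebra, 'e) correspondence \<Rightarrow> 'a \<Rightarrow>
   ('a, 'e) fock_vector \<Rightarrow> ('a, 'e) fock_vector" where
  "fock_lact E a = (\<lambda>f\<in>hcarrier (fock_space E). \<lambda>n.
     completion_map (algebraic_tensor_power E n) (map (tensor_lact E a)) (f n))"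

definition creation ::
  "('a::cstar_algebra, 'e) correspondence \<Rightarrow> 'e \<Rightarrow>
   ('a, 'e) fock_vector \<Rightarrow> ('a, 'e) fock_vector" where
  "creation E \<xi> = (\<lambda>f\<in>hcarrier (fock_space E). \<lambda>n. case n of
       0 \<Rightarrow> hzero (tensor_power E 0)
     | Suc m \<Rightarrow> completion_map (algebraic_tensor_power E (Suc m))
                  (map (\<lambda>(xs, a). (\<xi> # xs, a))) (f m))"

definition toeplitz_pimsner ::
  "('a::cstar_algebra, 'e) correspondence \<Rightarrow>
   (('a, 'e) fock_vector \<Rightarrow> ('a, 'e) fock_vector) set" where
  "toeplitz_pimsner E = op_cstar_generated (fock_space E)
     (range (fock_lact E) \<union> creation E ` hcarrier E)"


section \<open>The correspondence of a sequence of endomorphisms\<close>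

(* The Hilbert module \<ell>\<^sup>2(\<nat>) \<otimes> A is the direct sum of copies of A indexed by \<nat>, with
   \<delta>\<^sub>n \<otimes> b the sequence that is b at n and 0 elsewhere. *)
definition endo_correspondence ::
  "(nat \<Rightarrow> 'a::cstar_algebra \<Rightarrow> 'a) \<Rightarrow> ('a, nat \<Rightarrow> 'a) correspondence" where
  "endo_correspondence \<rho> = hmodule.extend (direct_sum (\<lambda>n. self_module))
     (correspondence.fields (\<lambda>a x n. \<rho> n a * x n))"

end

theory Submission
  imports Defs
begin

text \<open>
  On the Fock space, which is \<open>\<ell>\<^sup>2\<close> of the words over \<open>\<nat>\<close> with values in \<open>A\<close>, the algebra
  \<open>A\<close> acts by \<open>\<pi>(a) (\<delta>\<^sub>w \<otimes> b) = \<delta>\<^sub>w \<otimes> \<rho>\<^sub>w(a) b\<close>, and \<open>T\<^sub>\<xi> = \<Sum>\<^sub>n V\<^sub>n \<pi>(\<xi>\<^sub>n)\<close>, where the isometries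
  \<open>V\<^sub>n (\<delta>\<^sub>w \<otimes> b) = \<delta>\<^bsub>nw\<^esub> \<otimes> b\<close> satisfy \<open>V\<^sub>m\<^sup>* V\<^sub>n = 0\<close> for \<open>m \<noteq> n\<close> and
  \<open>\<pi>(a) V\<^sub>n = V\<^sub>n \<pi>(\<rho>\<^sub>n(a))\<close>. Hence the Toeplitz--Pimsner algebra is the closed span of the monomials
  \<open>V\<^sub>u \<pi>(a) V\<^sub>v\<^sup>*\<close>. A nonzero ideal \<open>J\<close> contains some \<open>y\<close> with nonzero vacuum expectation. If
  \<open>z\<close> is a finite sum of monomials close to \<open>y\<close>, with diagonal part \<open>a\<close>, and \<open>n\<close> is larger
  than all letters that occur in it, then \<open>V\<^sub>n\<^sup>* z V\<^sub>n = \<pi>(\<rho>\<^sub>n(a))\<close>, and by (i) the norm of \<open>\<rho>\<^sub>n(a)\<close> is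
  about that of \<open>a\<close> for infinitely many \<open>n\<close>. So \<open>J\<close> comes close to an element of \<open>\<pi>(A)\<close> of norm one.
  This forces \<open>\<pi>(A) \<inter> J \<noteq> 0\<close>, and as \<open>{a. \<pi>(a) \<in> J}\<close> is invariant under all \<open>\<rho>\<^sub>n\<close>,
  it is all of \<open>A\<close> by (ii), whence \<open>J\<close> is the whole algebra.

  The required facts on positive elements rest on the estimate \<open>\<parallel>p(a)\<parallel> \<le> sup \<bar>p\<bar>\<close> for polynomials
  in a self-adjoint element, which follows from \<open>\<parallel>T\<^sub>n(a)\<parallel> \<le> 1\<close> for the Chebyshev polynomials \<open>T\<^sub>n\<close>.
\<close>

text \<open>The quotient by \<open>J\<close> is never formed. Its role is taken by polynomials
  without constant term: at elements that agree modulo \<open>J\<close> their values agree modulo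
  \<open>J\<close>. It is therefore enough to find such polynomials that stay away from 0 at
  \<open>star d * d\<close>, where \<open>norm d = 1\<close>, and tend to 0 at every element of norm
  at most 1/16. The Bernstein polynomials of a function that vanishes near 0 do both. The other
  obstacle is the missing unit of \<open>A\<close>. The isometries \<open>V_n\<close> act on the
  Fock space but need not lie in the algebra; only products such as \<open>V_n \<pi>(u)\<close> do.
  Compressions of elements of \<open>J\<close> are therefore made with such products and corrected
  by approximate units. Non-degeneracy enters in the same way: elements \<open>\<rho>_w(u)\<close>
  act as approximate units, so that the vectors and monomials of arbitrary words are limits of what
  creation operators produce. Positivity is defined by \<open>norm (h - t) \<le> t\<close>. This
  makes sums of positive elements positive at once and leaves the positivity of
  \<open>star x * x\<close> as the hard fact.\<close>

instance cstar_algebra \<subseteq> banach ..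

text \<open>Polynomials with a constant term need a unit. Spectral facts are proved in this class
  and carried to arbitrary algebras by the unitization.\<close>

class cstar_algebra_1 = cstar_algebra + real_normed_algebra_1

section \<open>Elementary consequences of the C*-axioms\<close>

lemma norm_star [simp]: "norm (star x) = norm x"
proof -
  have *: "norm y \<le> norm (star y)" for y :: 'a
  proof (cases "norm y = 0")
    case False
    have "norm y * norm y \<le> norm (star y) * norm y"
      using norm_star_mult_self[of y] norm_mult_ineq[of "star y" y] by (simp add: power2_eq_square)
    then show ?thesis
      using False by simp
  qed simp
  show ?thesis
    using *[of x] *[of "star x"] by (simp add: star_star)
qed

lemma scaleC_one [simp]: "1 *\<^sub>C x = x"
  using scaleR_scaleC[of 1 x] by simp

lemma star_zero [simp]: "star 0 = 0"
  using star_add[of 0 0] by simp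

lemma star_scaleR [simp]: "star (r *\<^sub>R x) = r *\<^sub>R star x"
  by (simp add: scaleR_scaleC star_scaleC)

lemma star_minus [simp]: "star (- x) = - star x"
  using star_add[of x "- x"] by (simp add: eq_neg_iff_add_eq_0 add.commute)

lemma star_diff: "star (x - y) = star x - star y"
  using star_add[of x "- y"] by simp

lemma scaleC_zero_right [simp]: "c *\<^sub>C 0 = 0"
  using scaleC_add_right[of c 0 0] by simp

lemma scaleC_zero_left [simp]: "0 *\<^sub>C x = 0"
  using scaleC_add_left[of 0 0 x] by simp

lemma scaleC_minus_right [simp]: "c *\<^sub>C (- x) = - (c *\<^sub>C x)"
  using scaleC_add_right[of c x "- x"] by (simp add: eq_neg_iff_add_eq_0 add.commute)

lemma scaleC_minus_left [simp]: "(- c) *\<^sub>C x = - (c *\<^sub>C x)"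
  using scaleC_add_left[of c "- c" x] by (simp add: eq_neg_iff_add_eq_0 add.commute)

lemma scaleC_diff_right: "c *\<^sub>C (x - y) = c *\<^sub>C x - c *\<^sub>C y"
  using scaleC_add_right[of c x "- y"] by simp

lemma scaleC_scaleR: "c *\<^sub>C (r *\<^sub>R x) = r *\<^sub>R (c *\<^sub>C x)"
  by (simp add: scaleR_scaleC scaleC_scaleC mult.commute)

lemma star_sum: "star (sum f S) = (\<Sum>i\<in>S. star (f i))"
  by (induction S rule: infinite_finite_induct) (auto simp: star_add)

lemma bounded_linear_star: "bounded_linear (star :: 'a::cstar_algebra \<Rightarrow> 'a)"
  by (rule bounded_linear_intro[where K = 1]) (auto simp: star_add)

lemma bounded_linear_scaleC: "bounded_linear (\<lambda>x :: 'a::cstar_algebra. c *\<^sub>C x)"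
  by (rule bounded_linear_intro[where K = "cmod c"])
    (auto simp: scaleC_add_right scaleC_scaleR norm_scaleC mult.commute)

lemmas tendsto_star = bounded_linear.tendsto[OF bounded_linear_star]

lemma star_one [simp]: "star (1 :: 'a::cstar_algebra_1) = 1"
  by (metis mult.right_neutral mult_1 star_mult star_star)

lemma star_power: "star (x ^ n) = star x ^ n" for x :: "'a::cstar_algebra_1"
  by (induction n) (auto simp: star_mult power_commutes)

lemma norm_selfadjoint_square:
  fixes x :: "'a::cstar_algebra"
  assumes "star x = x"
  shows "norm (x * x) = norm x * norm x"
  using norm_star_mult_self[of x] assms by (simp add: power2_eq_square)

text \<open>The C*-identity doubles exponents, which is why the later passage to high powers runs
  along powers of two.\<close>

lemma norm_selfadjoint_power:
  fixes x :: "'a::cstar_algebra_1"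
  assumes "star x = x"
  shows "norm (x ^ (2 ^ k)) = norm x ^ (2 ^ k)"
proof (induction k)
  case (Suc k)
  have "x ^ (2 ^ Suc k) = x ^ (2 ^ k) * x ^ (2 ^ k)"
    by (simp flip: power_add add: mult_2)
  moreover have "star (x ^ (2 ^ k)) = x ^ (2 ^ k)"
    using assms by (simp add: star_power)
  ultimately show ?case
    using Suc norm_selfadjoint_square[of "x ^ (2 ^ k)"] by (simp flip: power_add add: mult_2)
qed simp

section \<open>Real polynomials in a self-adjoint element\<close>

text \<open>The argument comes from a possibly noncommutative algebra. Real coefficients keep the
  values at self-adjoint elements self-adjoint.\<close>

definition peval :: "real poly \<Rightarrow> 'a::real_algebra_1 \<Rightarrow> 'a" where
  "peval p x = fold_coeffs (\<lambda>c y. of_real c + x * y) p 0"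

lemma peval_0 [simp]: "peval 0 x = 0"
  by (simp add: peval_def)

lemma peval_pCons [simp]: "peval (pCons c p) x = of_real c + x * peval p x"
  by (cases "p = 0 \<and> c = 0") (auto simp: peval_def)

lemma peval_add: "peval (p + q) x = peval p x + peval q x"
by (induction p q rule: poly_induct2) (simp_all add: algebra_simps)

lemma peval_smult: "peval (smult c p) x = c *\<^sub>R peval p x"
  by (induction p) (simp_all add: algebra_simps of_real_def)

lemma peval_minus: "peval (- p) x = - peval p x"
  using peval_smult[of "-1" p x] by simp

lemma peval_diff: "peval (p - q) x = peval p x - peval q x"
  using peval_add[of p "- q" x] by (simp add: peval_minus)

lemma peval_1 [simp]: "peval 1 x = 1"
  by (simp add: one_pCons)

lemma peval_commute: "x * y = y * x \<Longrightarrow> peval p x * y = y * peval p x"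
proof (induction p)
  case (pCons c p)
  have "x * peval p x * y = y * (x * peval p x)"
    using pCons by (metis mult.assoc)
  then show ?case
    by (simp add: distrib_left distrib_right of_real_def)
qed simp

lemma peval_mult: "peval (p * q) x = peval p x * peval q x"
proof (induction p)
  case (pCons c p)
  then show ?case
    by (simp add: peval_add peval_smult algebra_simps of_real_def)
qed simp

lemma peval_power: "peval (p ^ n) x = peval p x ^ n"
  by (induction n) (auto simp: peval_mult)

lemma peval_sum: "peval (sum p S) x = (\<Sum>i\<in>S. peval (p i) x)"
  by (induction S rule: infinite_finite_induct) (auto simp: peval_add)

lemma peval_pcompose: "peval (pcompose p q) x = peval p (peval q x)"
  by (induction p) (auto simp: pcompose_pCons peval_add peval_mult)

lemma star_peval: "star (peval p x) = peval p (star x)" for x :: "'a::cstar_algebra_1"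
proof (induction p)
  case (pCons c p)
  have "peval p (star x) * star x = star x * peval p (star x)"
    by (rule peval_commute) simp
  with pCons show ?case
    by (simp add: star_add star_mult of_real_def)
qed simp

lemma continuous_peval:
  "isCont (\<lambda>t. peval p (f t)) t" if "isCont f t" for f :: "'b::t2_space \<Rightarrow> 'a::real_normed_algebra_1"
  by (induction p) (auto intro!: continuous_intros that)

section \<open>Chebyshev polynomials of a self-adjoint element\<close>

fun chebyshev :: "nat \<Rightarrow> real poly" where
  "chebyshev 0 = 1"
| "chebyshev (Suc 0) = [:0, 1:]"
| "chebyshev (Suc (Suc n)) = [:0, 2:] * chebyshev (Suc n) - chebyshev n"

lemma poly_chebyshev: "poly (chebyshev n) (cos t) = cos (real n * t)"
proof (induction n rule: chebyshev.induct)
  case (3 n)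
  have "2 * cos t * cos (real (Suc n) * t) = cos (real (Suc (Suc n)) * t) + cos (real n * t)"
    using cos_times_cos[of t "real (Suc n) * t"]
    by (simp add: algebra_simps)
  with 3 show ?case
    by (simp add: algebra_simps)
qed auto

text \<open>Consecutive coefficients differ by the factor \<open>(1 / 2 - n) / (n + 1)\<close>, of
  modulus at most 1. A geometric series thus dominates the binomial series of the square
  root.\<close>

lemma abs_half_gbinomial_le: "\<bar>(1 / 2 :: real) gchoose n\<bar> \<le> 1"
proof (induction n)
  case (Suc n)
  have "(1 / 2 :: real) gchoose Suc n = ((1 / 2) gchoose n) * ((1 / 2 - real n) / real (Suc n))"
    by (simp add: gbinomial_prod_rev divide_simps)
  moreover have "\<bar>(1 / 2 - real n) / real (Suc n)\<bar> \<le> 1"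
    by (auto simp: divide_simps)
  ultimately show ?case
    using Suc by (simp only: abs_mult mult_le_one abs_ge_zero)
qed simp

text \<open>The binomial series converges absolutely. In its Cauchy square the Vandermonde identity
  replaces the exponent 1/2 + 1/2 by 1, so only the constant and the linear term survive. The
  commutation clause holds because \<open>s\<close> is a limit of polynomials in \<open>x\<close>;
  it will let \<open>a\<close> commute with the root of \<open>1 - a * a\<close>.\<close>

lemma exists_sqrt_one_minus:
  fixes x :: "'a::cstar_algebra_1"
  assumes x: "norm x < 1" "star x = x"
  obtains s where "star s = s" "s * s = 1 - x" "\<And>y. x * y = y * x \<Longrightarrow> s * y = y * s"
proof -
  \<comment> \<open>the coefficients of the binomial series of \<open>sqrt (1 - x)\<close>\<close>
  define d where "d n = (- 1) ^ n * ((1 / 2 :: real) gchoose n)" for n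
  define f where "f n = d n *\<^sub>R x ^ n" for n
  have "norm (f n) \<le> norm x ^ n" for n
  proof -
    have "norm (f n) = \<bar>(1 / 2 :: real) gchoose n\<bar> * norm (x ^ n)"
      by (simp add: f_def d_def abs_mult power_abs)
    also have "\<dots> \<le> 1 * norm x ^ n"
      by (intro mult_mono abs_half_gbinomial_le norm_power_ineq) auto
    finally show ?thesis by simp
  qed
  then have sn: "summable (\<lambda>n. norm (f n))"
    using x by (intro summable_comparison_test[OF _ summable_geometric[of "norm x"]]) auto
  then have sf: "summable f"
    by (rule summable_norm_cancel)
  define s where "s = suminf f"
  have "f i * f (k - i) = ((- 1) ^ k * (((1/2 :: real) gchoose i) * ((1/2) gchoose (k - i)))) *\<^sub>R x ^ k" if "i \<le> k" for i k
  proof -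
    have "f i * f (k - i) = (((- 1) ^ i * (- 1) ^ (k - i)) * (((1/2) gchoose i) * ((1/2) gchoose (k - i)))) *\<^sub>R (x ^ i * x ^ (k - i))"
      by (simp add: f_def d_def mult_ac)
    also have "(- 1 :: real) ^ i * (- 1) ^ (k - i) = (- 1) ^ k"
      using that by (simp flip: power_add)
    also have "x ^ i * x ^ (k - i) = x ^ k"
      using that by (simp flip: power_add)
    finally show ?thesis .
  qed
  then have "(\<Sum>i\<le>k. f i * f (k - i)) = (\<Sum>i\<le>k. ((- 1) ^ k * (((1/2) gchoose i) * ((1/2) gchoose (k - i)))) *\<^sub>R x ^ k)" for k
    by (intro sum.cong) auto
  also have "\<dots> k = ((- 1) ^ k * (\<Sum>i=0..k. ((1/2) gchoose i) * ((1/2) gchoose (k - i)))) *\<^sub>R x ^ k" for k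
    by (simp add: sum_distrib_left scaleR_sum_left atLeast0AtMost)
  also have "\<dots> k = ((- 1) ^ k * ((1 :: real) gchoose k)) *\<^sub>R x ^ k" for k
    using gbinomial_Vandermonde[of "1/2 :: real" "1/2" k] by simp
  finally have prod: "(\<Sum>i\<le>k. f i * f (k - i)) = ((- 1) ^ k * ((1 :: real) gchoose k)) *\<^sub>R x ^ k" for k .
  have zero: "(1 :: real) gchoose k = 0" if "k \<notin> {..1}" for k
    using that binomial_gbinomial[of 1 k, where ?'a = real] by (simp add: binomial_eq_0)
  have "(\<lambda>k. ((- 1) ^ k * ((1 :: real) gchoose k)) *\<^sub>R x ^ k) sums (s * s)"
    using Cauchy_product_sums[OF sn sn] by (simp add: prod s_def)
  moreover have "(\<lambda>k. ((- 1) ^ k * ((1 :: real) gchoose k)) *\<^sub>R x ^ k) sums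
      (\<Sum>k\<le>1. ((- 1) ^ k * ((1 :: real) gchoose k)) *\<^sub>R x ^ k)"
    by (rule sums_finite) (auto simp: zero)
  ultimately have "s * s = (\<Sum>k\<le>1. ((- 1) ^ k * ((1 :: real) gchoose k)) *\<^sub>R x ^ k)"
    by (rule sums_unique2)
  then have 1: "s * s = 1 - x"
    by (simp add: atMost_Suc)
  have "star s = (\<Sum>n. star (f n))"
    unfolding s_def by (rule bounded_linear.suminf[OF bounded_linear_star sf])
  then have 2: "star s = s"
    using x(2) by (simp add: s_def f_def[abs_def] star_power)
  have 3: "s * y = y * s" if "x * y = y * x" for y
  proof -
    have "x ^ n * y = y * x ^ n" for n
      by (metis that power_commuting_commutes)
    then have "f n * y = y * f n" for n
      by (simp add: f_def)
    then show ?thesis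
      unfolding s_def using suminf_mult2[OF sf, of y] suminf_mult[OF sf, of y] by simp
  qed
  show ?thesis
    using that 1 2 3 by blast
qed

text \<open>A self-adjoint \<open>a\<close> with \<open>\<parallel>a\<parallel> < 1\<close> is the real part of the unitary
  \<open>a + \<i> sqrt (1 - a\<^sup>2)\<close>, so \<open>T\<^sub>n(a)\<close> is the real part of its \<open>n\<close>-th power.\<close>

lemma norm_chebyshev_le_1:
  fixes a :: "'a::cstar_algebra_1"
  assumes a: "star a = a" "norm a < 1"
  shows "norm (peval (chebyshev n) a) \<le> 1"
proof -
  have "norm (a * a) < 1"
    using a mult_strict_mono[of "norm a" 1 "norm a" 1] by (simp add: norm_selfadjoint_square)
  moreover have "star (a * a) = a * a"
    using a by (simp add: star_mult)
  ultimately obtain s where s: "star s = s" "s * s = 1 - a * a" and "\<And>y. (a * a) * y = y * (a * a) \<Longrightarrow> s * y = y * s"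
    using exists_sqrt_one_minus by blast
  then have comm: "s * a = a * s"
    by (metis mult.assoc)
  define u v where "u = a + \<i> *\<^sub>C s" and "v = a - \<i> *\<^sub>C s"
  have uv: "u * v = 1" and vu: "v * u = 1"
    using s(2) by (simp_all add: u_def v_def algebra_simps mult_scaleC_left mult_scaleC_right
      scaleC_scaleC scaleC_add_right scaleC_diff_right comm)
  have uv': "u * (v * y) = y" and vu': "v * (u * y) = y" for y
    using uv vu by (simp_all flip: mult.assoc)
  have star_u: "star u = v" and star_v: "star v = u"
    using a s by (simp_all add: u_def v_def star_add star_diff star_scaleC)
  have "(norm u)\<^sup>2 = 1" "(norm v)\<^sup>2 = 1"
    using norm_star_mult_self[of u] norm_star_mult_self[of v] uv vu star_u star_v by simp_all
  then have norms: "norm u = 1" "norm v = 1"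
    by (simp_all add: power2_eq_1_iff) (use norm_ge_zero[of u] norm_ge_zero[of v] in linarith)+
  \<comment> \<open>De Moivre: as \<open>u\<close> and \<open>v\<close> are inverse to each other,
    \<open>u ^ n + v ^ n\<close> obeys the Chebyshev recursion.\<close>
  have pw: "2 *\<^sub>R peval (chebyshev n) a = u ^ n + v ^ n" for n
  proof (induction n rule: chebyshev.induct)
    case 1
    then show ?case by (simp add: scaleR_2)
  next
    case 2
    then show ?case by (simp add: scaleR_2 u_def v_def)
  next
    case (3 n)
    have "2 *\<^sub>R a = u + v"
      by (simp add: u_def v_def scaleR_2)
    moreover have "2 *\<^sub>R peval (chebyshev (Suc (Suc n))) a =
        (2 *\<^sub>R a) * (2 *\<^sub>R peval (chebyshev (Suc n)) a) - 2 *\<^sub>R peval (chebyshev n) a"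
      by (simp add: peval_diff peval_mult peval_smult algebra_simps of_real_def)
    moreover have "(u + v) * (u ^ Suc n + v ^ Suc n) - (u ^ n + v ^ n) = u ^ Suc (Suc n) + v ^ Suc (Suc n)"
      by (simp add: algebra_simps uv' vu')
    ultimately show ?case
      using 3 by simp
  qed
  have "norm (2 *\<^sub>R peval (chebyshev n) a) \<le> norm (u ^ n) + norm (v ^ n)"
    unfolding pw by (rule norm_triangle_ineq)
  also have "\<dots> \<le> 1 + 1"
    using norm_power_ineq[of u n] norm_power_ineq[of v n] norms by simp
  finally show ?thesis by simp
qed

text \<open>The Chebyshev polynomials up to index \<open>m\<close> span the polynomials of degree at
  most \<open>m\<close>, since X T_0 = T_1 and 2 X T_i = T_(i+1) + T_(i-1). Identities that are
  linear in \<open>p\<close> thus have to be checked on them only.\<close>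

lemma chebyshev_induct:
  assumes "degree p \<le> m"
    and "\<And>i. i \<le> m \<Longrightarrow> Q (chebyshev i)"
    and "\<And>p q. Q p \<Longrightarrow> Q q \<Longrightarrow> Q (p + q)"
    and "\<And>c p. Q p \<Longrightarrow> Q (smult c p)"
  shows "Q p"
  using assms
proof (induction m arbitrary: p Q)
  case 0
  then obtain c where "p = [:c:]"
    using degree_eq_zeroE by blast
  then have "p = smult c (chebyshev 0)"
    by simp
  with 0(4)[OF 0(2)[of 0]] show ?case by simp
next
  case (Suc m)
  obtain c q where p: "p = pCons c q"
    by (cases p) auto
  have "degree q \<le> m"
    using Suc.prems(1) p by (cases "q = 0") auto
  \<comment> \<open>The induction hypothesis is applied to the predicate "\<open>Q\<close> holds for
    X q", hence the generalisation over \<open>Q\<close>.\<close>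
  then have "Q ([:0, 1:] * q)"
  proof (rule Suc.IH[where Q = "\<lambda>q. Q ([:0, 1:] * q)"])
    fix i assume i: "i \<le> m"
    show "Q ([:0, 1:] * chebyshev i)"
    proof (cases i)
      case 0
      then show ?thesis using Suc.prems(2)[of 1] by simp
    next
      case (Suc k)
      have "[:0, 1:] * chebyshev i = smult (1/2) (chebyshev (Suc i) + chebyshev k)"
        by (simp add: Suc smult_add_right)
      then show ?thesis
        using Suc.prems(2)[of "Suc i"] Suc.prems(2)[of k] Suc.prems(3,4) i Suc by (simp del: chebyshev.simps)
    qed
  next
    fix p q assume "Q ([:0, 1:] * p)" "Q ([:0, 1:] * q)"
    then show "Q ([:0, 1:] * (p + q))"
      using Suc.prems(3) by (metis distrib_left)
  next
    fix c p assume "Q ([:0, 1:] * p)"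
    then show "Q ([:0, 1:] * smult c p)"
      using Suc.prems(4) by (metis mult_smult_right)
  qed
  moreover have "p = smult c (chebyshev 0) + [:0, 1:] * q"
    by (simp add: p)
  ultimately show ?case
    using Suc.prems(2)[of 0] Suc.prems(3,4) by (metis le0)
qed

text \<open>The cosines are the real parts of the powers of an \<open>N\<close>-th root of unity
  \<open>w\<close>, whose geometric sum vanishes unless \<open>w = 1\<close>.\<close>

lemma sum_cos_roots_of_unity:
  assumes "N > 0"
  shows "(\<Sum>k<N. cos (real l * (2 * pi * real k / real N))) = (if N dvd l then real N else 0)"
proof -
  define w where "w = cis (2 * pi * real l / real N)"
  have "cos (real l * (2 * pi * real k / real N)) = Re (w ^ k)" for k
  proof -
    have "real l * (2 * pi * real k / real N) = real k * (2 * pi * real l / real N)"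
      by simp
    then show ?thesis
      by (simp only: w_def Complex.DeMoivre cis.sel)
  qed
  then have sum: "(\<Sum>k<N. cos (real l * (2 * pi * real k / real N))) = Re (\<Sum>k<N. w ^ k)"
    by simp
  have wN: "w ^ N = 1"
    using assms by (simp add: w_def Complex.DeMoivre)
  show ?thesis
  proof (cases "N dvd l")
    case True
    then obtain j where "l = N * j" by blast
    then have "2 * pi * real l / real N = 2 * pi * real j"
      using assms by simp
    then have "w = 1"
      by (simp only: w_def cis_multiple_2pi Ints_of_nat)
    then show ?thesis
      using sum True by simp
  next
    case False
    have "w \<noteq> 1"
    proof
      assume "w = 1"
      then have "cos (2 * pi * real l / real N) = 1"
        by (simp add: w_def complex_eq_iff)
      then obtain n :: int where "2 * pi * real l / real N = of_int n * 2 * pi"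
        using cos_one_2pi_int by blast
      then have "real l = of_int n * real N"
        using assms by (simp add: field_simps)
      then have "int l = n * int N"
        by (metis of_int_eq_iff of_int_mult of_int_of_nat_eq)
      then have "N dvd l"
        by (metis dvd_triv_right int_dvd_int_iff)
      with False show False ..
    qed
    then have "(\<Sum>k<N. w ^ k) = 0"
      using wN by (simp add: geometric_sum)
    then show ?thesis
      using sum False by simp
  qed
qed

text \<open>Discrete orthogonality of the Chebyshev polynomials writes \<open>p(a)\<close> as a combination of
  the values of \<open>p\<close> at \<open>2 m + 1\<close> nodes; only the subexponential growth of the constant
  \<open>2 m + 1\<close> matters, as it disappears on passing to high powers of \<open>p\<close>.\<close>

lemma norm_peval_le_degree:
  fixes a :: "'a::cstar_algebra_1"
  assumes a: "star a = a" "norm a < 1"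
    and p: "degree p \<le> m" "\<And>t. t \<in> {-1..1} \<Longrightarrow> \<bar>poly p t\<bar> \<le> M"
  shows "norm (peval p a) \<le> real (2 * m + 1) * M"
proof -
  \<comment> \<open>With this many nodes there is no aliasing: \<open>i + j\<close> lies between 1
    and \<open>2 * m\<close> and is not a multiple of \<open>N\<close>. The same number makes
    \<open>norm (D k) \<le> 1\<close>, as the sum in \<open>D k\<close> has norm at most 1 + 2
    m.\<close>
  define N where "N = 2 * m + 1"
  define \<theta> where "\<theta> k = 2 * pi * real k / real N" for k
  \<comment> \<open>The Dirichlet kernel with one variable replaced by \<open>a\<close>:
    \<open>D k\<close> is the coefficient of the sample of \<open>p\<close> at
    \<open>cos (\<theta> k)\<close>.\<close>
  define D where "D k = (1 / real N) *\<^sub>R (1 + (\<Sum>j=1..m. (2 * cos (real j * \<theta> k)) *\<^sub>R peval (chebyshev j) a))" for k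
  have "N > 0" by (simp add: N_def)
  have nD: "norm (D k) \<le> 1" for k
  proof -
    have "norm ((2 * cos (real j * \<theta> k)) *\<^sub>R peval (chebyshev j) a) \<le> 2" for j
    proof -
      have "norm ((2 * cos (real j * \<theta> k)) *\<^sub>R peval (chebyshev j) a) =
          2 * \<bar>cos (real j * \<theta> k)\<bar> * norm (peval (chebyshev j) a)"
        by (simp add: abs_mult)
      also have "\<dots> \<le> 2 * 1 * 1"
        by (intro mult_mono norm_chebyshev_le_1 a) auto
      finally show ?thesis by simp
    qed
    then have "norm (\<Sum>j=1..m. (2 * cos (real j * \<theta> k)) *\<^sub>R peval (chebyshev j) a) \<le> (\<Sum>j=1..m. 2)"
      by (intro sum_norm_le) auto
    then have "norm (1 + (\<Sum>j=1..m. (2 * cos (real j * \<theta> k)) *\<^sub>R peval (chebyshev j) a)) \<le> 1 + 2 * real m"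
      by (intro norm_triangle_le) auto
    also have "\<dots> = real N"
      by (simp add: N_def)
    finally show ?thesis
      using \<open>N > 0\<close> by (simp add: D_def divide_simps)
  qed
  have cosprod: "(\<Sum>k<N. cos (real i * \<theta> k) * (2 * cos (real j * \<theta> k))) = (if i = j then real N else 0)"
    if "i \<le> m" "1 \<le> j" "j \<le> m" for i j
  proof -
    define l where "l = (if i \<le> j then j - i else i - j)"
    have "cos (real i * \<theta> k) * (2 * cos (real j * \<theta> k)) = cos (real l * \<theta> k) + cos (real (i + j) * \<theta> k)" for k
    proof -
      have "2 * (cos (real i * \<theta> k) * cos (real j * \<theta> k)) =
          cos (real i * \<theta> k - real j * \<theta> k) + cos (real i * \<theta> k + real j * \<theta> k)"
        using cos_times_cos[of "real i * \<theta> k" "real j * \<theta> k"] by simp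
      moreover have "cos (real i * \<theta> k - real j * \<theta> k) = cos (real l * \<theta> k)"
      proof (cases "i \<le> j")
        case True
        then have "real i * \<theta> k - real j * \<theta> k = - (real l * \<theta> k)"
          by (simp add: l_def algebra_simps of_nat_diff)
        then show ?thesis by (metis cos_minus)
      next
        case False
        then have "real i * \<theta> k - real j * \<theta> k = real l * \<theta> k"
          by (simp add: l_def algebra_simps of_nat_diff)
        then show ?thesis by simp
      qed
      ultimately show ?thesis by (simp add: algebra_simps)
    qed
    then have "(\<Sum>k<N. cos (real i * \<theta> k) * (2 * cos (real j * \<theta> k))) =
        (if N dvd l then real N else 0) + (if N dvd (i + j) then real N else 0)"
      using sum_cos_roots_of_unity[OF \<open>N > 0\<close>] by (simp only: sum.distrib \<theta>_def)
    moreover have "\<not> N dvd (i + j)"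
      using that by (auto simp: N_def dest!: dvd_imp_le)
    moreover have "N dvd l \<longleftrightarrow> i = j"
      using that by (auto simp: N_def l_def dest!: dvd_imp_le split: if_splits)
    ultimately show ?thesis by simp
  qed
  have "peval p a = (\<Sum>k<N. poly p (cos (\<theta> k)) *\<^sub>R D k)"
    using p(1)
  proof (rule chebyshev_induct)
    fix i assume i: "i \<le> m"
    have "real N *\<^sub>R (\<Sum>k<N. poly (chebyshev i) (cos (\<theta> k)) *\<^sub>R D k) =
      (\<Sum>k<N. cos (real i * \<theta> k) *\<^sub>R (1 + (\<Sum>j=1..m. (2 * cos (real j * \<theta> k)) *\<^sub>R peval (chebyshev j) a)))"
      using \<open>N > 0\<close> by (simp add: scaleR_sum_right D_def poly_chebyshev)
    also have "\<dots> = (\<Sum>k<N. cos (real i * \<theta> k)) *\<^sub>R 1 +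
        (\<Sum>k<N. \<Sum>j=1..m. (cos (real i * \<theta> k) * (2 * cos (real j * \<theta> k))) *\<^sub>R peval (chebyshev j) a)"
      by (simp add: scaleR_add_right sum.distrib scaleR_sum_right scaleR_sum_left)
    also have "(\<Sum>k<N. \<Sum>j=1..m. (cos (real i * \<theta> k) * (2 * cos (real j * \<theta> k))) *\<^sub>R peval (chebyshev j) a) =
        (\<Sum>j=1..m. (\<Sum>k<N. cos (real i * \<theta> k) * (2 * cos (real j * \<theta> k))) *\<^sub>R peval (chebyshev j) a)"
      by (subst sum.swap) (simp add: scaleR_sum_left)
    also have "\<dots> = (\<Sum>j=1..m. if i = j then real N *\<^sub>R peval (chebyshev j) a else 0)"
      using i by (intro sum.cong) (auto simp: cosprod)
    also have "\<dots> = (if i \<ge> 1 then real N *\<^sub>R peval (chebyshev i) a else 0)"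
      using i by (simp add: sum.delta')
    also have "(\<Sum>k<N. cos (real i * \<theta> k)) = (if i = 0 then real N else 0)"
      using i sum_cos_roots_of_unity[OF \<open>N > 0\<close>, of i] by (auto simp: \<theta>_def N_def dest!: dvd_imp_le)
    finally have "real N *\<^sub>R (\<Sum>k<N. poly (chebyshev i) (cos (\<theta> k)) *\<^sub>R D k) = real N *\<^sub>R peval (chebyshev i) a"
      by (cases i) auto
    then show "peval (chebyshev i) a = (\<Sum>k<N. poly (chebyshev i) (cos (\<theta> k)) *\<^sub>R D k)"
      using \<open>N > 0\<close> by simp
  next
    fix p q assume "peval p a = (\<Sum>k<N. poly p (cos (\<theta> k)) *\<^sub>R D k)" "peval q a = (\<Sum>k<N. poly q (cos (\<theta> k)) *\<^sub>R D k)"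
    then show "peval (p + q) a = (\<Sum>k<N. poly (p + q) (cos (\<theta> k)) *\<^sub>R D k)"
      by (simp add: peval_add scaleR_add_left sum.distrib)
  next
    fix c p assume "peval p a = (\<Sum>k<N. poly p (cos (\<theta> k)) *\<^sub>R D k)"
    then show "peval (smult c p) a = (\<Sum>k<N. poly (smult c p) (cos (\<theta> k)) *\<^sub>R D k)"
      by (simp add: peval_smult scaleR_sum_right)
  qed
  also have "norm \<dots> \<le> (\<Sum>k<N. M * 1)"
  proof (intro sum_norm_le)
    fix k
    have "\<bar>poly p (cos (\<theta> k))\<bar> * norm (D k) \<le> M * 1"
      using p(2)[of "cos (\<theta> k)"] by (intro mult_mono nD) auto
    then show "norm (poly p (cos (\<theta> k)) *\<^sub>R D k) \<le> M * 1"
      by simp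
  qed
  finally show ?thesis
    by (simp add: N_def)
qed

section \<open>Sets that bound the spectrum\<close>

text \<open>Stands for the inclusion of the spectrum of the self-adjoint \<open>a\<close> in
  \<open>K\<close>. As a norm inequality for polynomials it passes through substitutions without any
  appeal to invertibility.\<close>

definition spectral_bound :: "real set \<Rightarrow> 'a::cstar_algebra_1 \<Rightarrow> bool" where
  "spectral_bound K a \<longleftrightarrow> star a = a \<and>
     (\<forall>p M. 0 \<le> M \<longrightarrow> (\<forall>t\<in>K. \<bar>poly p t\<bar> \<le> M) \<longrightarrow> norm (peval p a) \<le> M)"

lemma spectral_bound_strict_unit_ball:
  fixes a :: "'a::cstar_algebra_1"
  assumes a: "star a = a" "norm a < 1"
  shows "spectral_bound {-1..1} a"
  unfolding spectral_bound_def
proof (intro conjI a(1) allI impI)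
  fix p :: "real poly" and M :: real
  assume M: "0 \<le> M" "\<forall>t\<in>{-1..1}. \<bar>poly p t\<bar> \<le> M"
  define b where "b = peval p a"
  define d where "d = degree p"
  have bound: "norm b ^ (2 ^ k) \<le> real (2 * (2 ^ k * d) + 1) * M ^ (2 ^ k)" for k
  proof -
    have "star b = b"
      by (simp add: b_def star_peval a)
    then have "norm b ^ (2 ^ k) = norm (peval (p ^ (2 ^ k)) a)"
      by (simp add: norm_selfadjoint_power peval_power b_def)
    also have "\<dots> \<le> real (2 * (2 ^ k * d) + 1) * M ^ (2 ^ k)"
    proof (rule norm_peval_le_degree[OF a])
      show "degree (p ^ (2 ^ k)) \<le> 2 ^ k * d"
        using degree_power_le[of p "2 ^ k"] by (simp add: d_def mult.commute)
      show "\<bar>poly (p ^ (2 ^ k)) t\<bar> \<le> M ^ (2 ^ k)" if "t \<in> {-1..1}" for t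
        using M that by (auto simp: poly_power power_abs intro!: power_mono)
    qed
    finally show ?thesis .
  qed
  show "norm (peval p a) \<le> M"
  proof (rule ccontr)
    assume "\<not> ?thesis"
    then have lt: "M < norm b" by (simp add: b_def)
    with M have "0 < norm b" by linarith
    \<comment> \<open>Dividing \<open>bound\<close> by the power of \<open>norm b\<close> gives 1
      \<le> (2 n d + 1) r^n for n = 2^k, although the right-hand side tends to 0.\<close>
    define r where "r = M / norm b"
    have r: "0 \<le> r" "r < 1"
      using lt M \<open>0 < norm b\<close> by (auto simp: r_def)
    then have "norm r < 1" by simp
    have "(\<lambda>n. real n * r ^ n) \<longlonglongrightarrow> 0" "(\<lambda>n. r ^ n) \<longlonglongrightarrow> 0"
      using powser_times_n_limit_0[OF \<open>norm r < 1\<close>] LIMSEQ_power_zero[OF \<open>norm r < 1\<close>] by simp_all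
    then have "(\<lambda>n. 2 * real d * (real n * r ^ n) + r ^ n) \<longlonglongrightarrow> 2 * real d * 0 + 0"
      by (intro tendsto_add tendsto_mult tendsto_const)
    moreover have "strict_mono (\<lambda>k::nat. 2 ^ k :: nat)"
      by (simp add: strict_mono_def)
    ultimately have "((\<lambda>n. 2 * real d * (real n * r ^ n) + r ^ n) \<circ> (\<lambda>k. 2 ^ k)) \<longlonglongrightarrow> 2 * real d * 0 + 0"
      by (rule LIMSEQ_subseq_LIMSEQ)
    then have "\<forall>\<^sub>F k in sequentially. ((\<lambda>n. 2 * real d * (real n * r ^ n) + r ^ n) \<circ> (\<lambda>k. 2 ^ k)) k < 1"
      by (rule order_tendstoD(2)) simp
    then have "\<forall>\<^sub>F k in sequentially. 2 * real d * (real (2 ^ k) * r ^ (2 ^ k)) + r ^ (2 ^ k) < 1"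
      unfolding o_def .
    then obtain k where "2 * real d * (real (2 ^ k) * r ^ (2 ^ k)) + r ^ (2 ^ k) < 1"
      by (auto simp: eventually_sequentially)
    moreover define n :: nat where "n = 2 ^ k"
    ultimately have "real (2 * (n * d) + 1) * r ^ n < 1"
      by (simp add: algebra_simps)
    then have "real (2 * (n * d) + 1) * M ^ n < norm b ^ n"
      using \<open>0 < norm b\<close> by (simp add: r_def power_divide divide_simps)
    with bound[of k] show False by (simp add: n_def)
  qed
qed

text \<open>The square root series asked for norm less than 1. The closed ball follows by letting
  \<open>r\<close> tend to 1 from below in \<open>r *\<^sub>R a\<close>.\<close>

lemma spectral_bound_unit_ball:
  fixes a :: "'a::cstar_algebra_1"
  assumes a: "star a = a" "norm a \<le> 1"
  shows "spectral_bound {-1..1} a"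
  unfolding spectral_bound_def
proof (intro conjI a(1) allI impI)
  fix p :: "real poly" and M :: real
  assume M: "0 \<le> M" "\<forall>t\<in>{-1..1}. \<bar>poly p t\<bar> \<le> M"
  have "isCont (\<lambda>r. peval p (r *\<^sub>R a)) 1"
    by (intro continuous_peval continuous_intros)
  then have "((\<lambda>r. peval p (r *\<^sub>R a)) \<longlongrightarrow> peval p (1 *\<^sub>R a)) (at_left 1)"
    unfolding isCont_def by (meson at_le filterlim_mono order_refl subset_UNIV tendsto_within_subset)
  then have lim: "((\<lambda>r. norm (peval p (r *\<^sub>R a))) \<longlongrightarrow> norm (peval p a)) (at_left 1)"
    by (simp add: tendsto_norm)
  have "norm (peval p (r *\<^sub>R a)) \<le> M" if "0 < r" "r < 1" for r
  proof -
    have "r * norm a \<le> r"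
      using that a by (intro mult_left_le) auto
    moreover have "norm (r *\<^sub>R a) = r * norm a"
      using that by simp
    ultimately have "norm (r *\<^sub>R a) < 1"
      using that by linarith
    moreover have "star (r *\<^sub>R a) = r *\<^sub>R a"
      using a by simp
    ultimately show ?thesis
      using spectral_bound_strict_unit_ball[of "r *\<^sub>R a"] M unfolding spectral_bound_def by blast
  qed
  then have "\<forall>\<^sub>F r in at_left 1. norm (peval p (r *\<^sub>R a)) \<le> M"
    unfolding eventually_at_left_field by (intro exI[of _ 0]) auto
  with lim show "norm (peval p a) \<le> M"
    using tendsto_upperbound by (metis trivial_limit_at_left_real)
qed

text \<open>An affine change of variable, with radius 0 apart because of the division by
  \<open>r\<close>. Balls off the origin are what positivity supplies:
  \<open>norm (h - of_real t) \<le> t\<close> yields the interval from 0 to 2 t.\<close>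

lemma spectral_bound_ball:
  fixes a :: "'a::cstar_algebra_1"
  assumes a: "star a = a" "norm (a - of_real m) \<le> r"
  shows "spectral_bound {m - r..m + r} a"
  unfolding spectral_bound_def
proof (intro conjI a(1) allI impI)
  fix p :: "real poly" and M :: real
  assume M: "0 \<le> M" "\<forall>t\<in>{m - r..m + r}. \<bar>poly p t\<bar> \<le> M"
  have "0 \<le> r" using a(2) norm_ge_zero order_trans by blast
  show "norm (peval p a) \<le> M"
  proof (cases "r = 0")
    case True
    then have "a = of_real m"
      using a by simp
    moreover have "peval p (of_real m :: 'a) = of_real (poly p m)"
      by (induction p) auto
    ultimately show ?thesis
      using M True by simp
  next
    case False
    then have r: "r > 0" using \<open>0 \<le> r\<close> by simp
    define b where "b = (1 / r) *\<^sub>R (a - of_real m)"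
    define q where "q = pcompose p [:m, r:]"
    have "star b = b"
      using a by (simp add: b_def star_diff of_real_def)
    moreover have "norm b \<le> 1"
      using a r by (simp add: b_def divide_simps)
    ultimately have "spectral_bound {-1..1} b"
      by (rule spectral_bound_unit_ball)
    moreover have "\<bar>poly q t\<bar> \<le> M" if "t \<in> {-1..1}" for t
    proof -
      have "t * r \<le> 1 * r" "(- 1) * r \<le> t * r"
        using that r by (intro mult_right_mono; simp)+
      then have "m + t * r \<in> {m - r..m + r}"
        by auto
      then show ?thesis
        using M(2) by (auto simp: q_def poly_pcompose)
    qed
    ultimately have "norm (peval q b) \<le> M"
      using M(1) unfolding spectral_bound_def by blast
    moreover have "peval q b = peval p a"
      using r by (simp add: q_def peval_pcompose b_def of_real_def algebra_simps)
    ultimately show ?thesis by simp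
  qed
qed

section \<open>Continuous functional calculus and positivity\<close>

lemma uniform_limit_polynomials:
  fixes f :: "real \<Rightarrow> real"
  assumes "compact K" "continuous_on K f"
  obtains p where "uniform_limit K (\<lambda>n. poly (p n)) f sequentially"
proof -
  have "\<exists>p. \<forall>t\<in>K. \<bar>f t - poly p t\<bar> < 1 / real (Suc n)" for n
  proof -
    obtain g where g: "real_polynomial_function g" "\<And>t. t \<in> K \<Longrightarrow> \<bar>f t - g t\<bar> < 1 / real (Suc n)"
      using Stone_Weierstrass_real_polynomial_function[OF assms, of "1 / real (Suc n)"] by auto
    then obtain a m where "g = (\<lambda>x. \<Sum>i\<le>m. a i * x ^ i)"
      by (auto simp: real_polynomial_function_iff_sum)
    then have "g = poly (\<Sum>i\<le>m. monom (a i) i)"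
      by (auto simp: poly_sum poly_monom fun_eq_iff)
    with g(2) show ?thesis by blast
  qed
  then obtain p where p: "\<And>n t. t \<in> K \<Longrightarrow> \<bar>f t - poly (p n) t\<bar> < 1 / real (Suc n)"
    by metis
  have "uniform_limit K (\<lambda>n. poly (p n)) f sequentially"
    unfolding uniform_limit_iff
  proof (intro allI impI)
    fix e :: real assume "e > 0"
    then have "\<forall>\<^sub>F n in sequentially. 1 / real (Suc n) < e"
      using order_tendstoD(2)[OF LIMSEQ_inverse_real_of_nat] by (simp add: inverse_eq_divide)
    then show "\<forall>\<^sub>F n in sequentially. \<forall>t\<in>K. dist (poly (p n) t) (f t) < e"
      by eventually_elim (metis p dist_real_def abs_minus_commute less_trans)
  qed
  then show ?thesis by (rule that)
qed

text \<open>\<open>cfc K a f b\<close>: the value of \<open>f\<close> at \<open>a\<close> is \<open>b\<close>, where \<open>K\<close> plays the role of the spectrum.\<close>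

definition cfc :: "real set \<Rightarrow> 'a::cstar_algebra_1 \<Rightarrow> (real \<Rightarrow> real) \<Rightarrow> 'a \<Rightarrow> bool" where
  "cfc K a f b \<longleftrightarrow> (\<exists>p. uniform_limit K (\<lambda>n. poly (p n)) f sequentially \<and> (\<lambda>n. peval (p n) a) \<longlonglongrightarrow> b)"

lemma spectral_boundD:
  "spectral_bound K a \<Longrightarrow> 0 \<le> M \<Longrightarrow> (\<And>t. t \<in> K \<Longrightarrow> \<bar>poly p t\<bar> \<le> M) \<Longrightarrow> norm (peval p a) \<le> M"
  by (simp add: spectral_bound_def)

lemma spectral_bound_mono: "spectral_bound K a \<Longrightarrow> K \<subseteq> L \<Longrightarrow> spectral_bound L a"
  unfolding spectral_bound_def by blast

lemma convergent_peval:
  assumes "spectral_bound K a" "uniform_limit K (\<lambda>n. poly (p n)) f sequentially"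
  shows "convergent (\<lambda>n. peval (p n) a)"
proof (intro Cauchy_convergent CauchyI)
  fix e :: real assume e: "e > 0"
  then have "e / 4 > 0" by simp
  then have "\<forall>\<^sub>F n in sequentially. \<forall>t\<in>K. dist (poly (p n) t) (f t) < e / 4"
    using assms(2) unfolding uniform_limit_iff by blast
  then obtain N where N: "\<And>n t. n \<ge> N \<Longrightarrow> t \<in> K \<Longrightarrow> \<bar>poly (p n) t - f t\<bar> < e / 4"
    by (auto simp: eventually_sequentially dist_real_def)
  have "norm (peval (p m) a - peval (p n) a) < e" if "m \<ge> N" "n \<ge> N" for m n
  proof -
    have "norm (peval (p m - p n) a) \<le> e / 2"
    proof (rule spectral_boundD[OF assms(1)])
      fix t assume "t \<in> K"
      then show "\<bar>poly (p m - p n) t\<bar> \<le> e / 2"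
        using N[OF that(1), of t] N[OF that(2), of t] unfolding poly_diff by linarith
    qed (use e in simp)
    then show ?thesis
      using e by (simp add: peval_diff)
  qed
  then show "\<exists>N. \<forall>m\<ge>N. \<forall>n\<ge>N. norm (peval (p m) a - peval (p n) a) < e" by blast
qed

lemma cfc_exists:
  assumes "spectral_bound K a" "compact K" "continuous_on K f"
  obtains b where "cfc K a f b"
proof -
  obtain p where p: "uniform_limit K (\<lambda>n. poly (p n)) f sequentially"
    using uniform_limit_polynomials assms(2,3) by blast
  then obtain b where "(\<lambda>n. peval (p n) a) \<longlonglongrightarrow> b"
    using convergent_peval assms(1) unfolding convergent_def by blast
  with p show ?thesis
    using that unfolding cfc_def by blast
qed

lemma cfc_norm_le:
  assumes "spectral_bound K a" "cfc K a f b" "0 \<le> M" "\<And>t. t \<in> K \<Longrightarrow> \<bar>f t\<bar> \<le> M"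
  shows "norm b \<le> M"
proof (rule field_le_epsilon)
  fix e :: real assume e: "e > 0"
  obtain p where p: "uniform_limit K (\<lambda>n. poly (p n)) f sequentially" "(\<lambda>n. peval (p n) a) \<longlonglongrightarrow> b"
    using assms(2) unfolding cfc_def by blast
  have "\<forall>\<^sub>F n in sequentially. \<forall>t\<in>K. dist (poly (p n) t) (f t) < e"
    using p(1) e unfolding uniform_limit_iff by simp
  then have "\<forall>\<^sub>F n in sequentially. norm (peval (p n) a) \<le> M + e"
  proof eventually_elim
    case (elim n)
    show ?case
    proof (rule spectral_boundD[OF assms(1)])
      fix t assume "t \<in> K"
      then have "\<bar>poly (p n) t - f t\<bar> < e" "\<bar>f t\<bar> \<le> M"
        using elim assms(4) by (auto simp: dist_real_def)
      then show "\<bar>poly (p n) t\<bar> \<le> M + e" by linarith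
    qed (use assms(3) e in simp)
  qed
  then show "norm b \<le> M + e"
    using tendsto_upperbound[OF tendsto_norm[OF p(2)]] by simp
qed

lemma cfc_cong: "cfc K a f b \<Longrightarrow> (\<And>t. t \<in> K \<Longrightarrow> f t = g t) \<Longrightarrow> cfc K a g b"
  unfolding cfc_def using uniform_limit_cong'[of K _ _ f g] by (metis (no_types, lifting))

lemma cfc_subset: "cfc L a f b \<Longrightarrow> K \<subseteq> L \<Longrightarrow> cfc K a f b"
  unfolding cfc_def using uniform_limit_on_subset by blast

lemma cfc_poly: "cfc K a (poly p) (peval p a)"
  unfolding cfc_def by (intro exI[of _ "\<lambda>_. p"]) (auto simp: uniform_limit_iff)

lemma cfc_id: "cfc K a (\<lambda>t. t) a"
proof (rule cfc_cong)
  show "cfc K a (poly [:0, 1:]) a"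
    using cfc_poly[of K a "[:0, 1:]"] by simp
qed simp

lemma cfc_add:
  assumes "cfc K a f b" "cfc K a g c"
  shows "cfc K a (\<lambda>t. f t + g t) (b + c)"
proof -
  obtain p q where
    "uniform_limit K (\<lambda>n. poly (p n)) f sequentially" "(\<lambda>n. peval (p n) a) \<longlonglongrightarrow> b"
    "uniform_limit K (\<lambda>n. poly (q n)) g sequentially" "(\<lambda>n. peval (q n) a) \<longlonglongrightarrow> c"
    using assms unfolding cfc_def by blast
  then show ?thesis
    unfolding cfc_def
    by (intro exI[of _ "\<lambda>n. p n + q n"])
      (auto simp: peval_add poly_add[abs_def] intro!: tendsto_add uniform_limit_add)
qed

lemma cfc_mult:
  assumes "cfc K a f b" "cfc K a g c" "bounded (f ` K)" "bounded (g ` K)"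
  shows "cfc K a (\<lambda>t. f t * g t) (b * c)"
proof -
  obtain p q where
    "uniform_limit K (\<lambda>n. poly (p n)) f sequentially" "(\<lambda>n. peval (p n) a) \<longlonglongrightarrow> b"
    "uniform_limit K (\<lambda>n. poly (q n)) g sequentially" "(\<lambda>n. peval (q n) a) \<longlonglongrightarrow> c"
    using assms unfolding cfc_def by blast
  then show ?thesis
    unfolding cfc_def using assms(3,4)
    by (intro exI[of _ "\<lambda>n. p n * q n"])
      (auto simp: peval_mult poly_mult[abs_def] intro!: tendsto_mult uniform_lim_mult)
qed

lemma cfc_minus: "cfc K a f b \<Longrightarrow> cfc K a (\<lambda>t. - f t) (- b)"
  unfolding cfc_def
proof (elim exE conjE)
  fix p assume "uniform_limit K (\<lambda>n. poly (p n)) f sequentially" "(\<lambda>n. peval (p n) a) \<longlonglongrightarrow> b"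
  then show "\<exists>p. uniform_limit K (\<lambda>n. poly (p n)) (\<lambda>t. - f t) sequentially \<and> (\<lambda>n. peval (p n) a) \<longlonglongrightarrow> - b"
    by (intro exI[of _ "\<lambda>n. - p n"])
      (auto simp: peval_minus poly_minus[abs_def] intro!: tendsto_minus uniform_limit_uminus)
qed

text \<open>Agreement is asked for on a set that bounds the spectrum, although the polynomials may
  converge on a larger one. Comparing the same element on two such sets in turn is the device behind
  \<open>norm_le_if_positive\<close>.\<close>

lemma cfc_unique:
  assumes "spectral_bound K a" "cfc K a f b" "cfc K a g c" "\<And>t. t \<in> K \<Longrightarrow> f t = g t"
  shows "b = c"
proof -
  have "cfc K a (\<lambda>t. f t + - g t) (b + - c)"
    by (intro cfc_add cfc_minus assms)
  then have "norm (b + - c) \<le> 0"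
    by (rule cfc_norm_le[OF assms(1)]) (simp_all add: assms(4))
  then show ?thesis by simp
qed

lemma cfc_star:
  assumes "spectral_bound K a" "cfc K a f b"
  shows "star b = b"
proof -
  obtain p where "(\<lambda>n. peval (p n) a) \<longlonglongrightarrow> b"
    using assms(2) unfolding cfc_def by blast
  moreover from tendsto_star[OF this] have "(\<lambda>n. peval (p n) a) \<longlonglongrightarrow> star b"
    using assms(1) by (simp add: star_peval spectral_bound_def)
  ultimately show ?thesis
    using LIMSEQ_unique by blast
qed

section \<open>Positive elements and their order\<close>

text \<open>A self-adjoint \<open>h\<close> has nonnegative spectrum exactly if it lies in some ball
  of radius \<open>t\<close> around \<open>t\<close>. In this form sums of positive elements are
  positive by the triangle inequality.\<close>

definition is_positive :: "'a::cstar_algebra_1 \<Rightarrow> bool" where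
  "is_positive h \<longleftrightarrow> star h = h \<and> (\<exists>t. norm (h - of_real t) \<le> t)"

lemma star_of_real [simp]: "star (of_real r :: 'a::cstar_algebra_1) = of_real r"
  by (simp add: of_real_def)

lemma positive_star: "is_positive h \<Longrightarrow> star h = h"
  by (simp add: is_positive_def)

lemma spectral_bound_if_positive:
  assumes "is_positive h"
  obtains s where "0 \<le> s" "spectral_bound {0..s} h"
proof -
  obtain t where t: "norm (h - of_real t) \<le> t" "star h = h"
    using assms by (auto simp: is_positive_def)
  then have "0 \<le> t" using norm_ge_zero order_trans by blast
  moreover have "spectral_bound {t - t..t + t} h"
    using t by (intro spectral_bound_ball)
  ultimately show ?thesis
    using that[of "t + t"] by simp
qed

lemma positive_add:
  assumes "is_positive h" "is_positive k"
  shows "is_positive (h + k)"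
proof -
  obtain s t where "norm (h - of_real s) \<le> s" "norm (k - of_real t) \<le> t"
    using assms by (auto simp: is_positive_def)
  then have "norm ((h - of_real s) + (k - of_real t)) \<le> s + t"
    by (intro norm_triangle_le) simp
  then have "norm ((h + k) - of_real (s + t)) \<le> s + t"
    by (simp add: algebra_simps)
  moreover have "star (h + k) = h + k"
    using assms by (simp add: is_positive_def star_add)
  ultimately show ?thesis
    unfolding is_positive_def by blast
qed

lemma positive_scaleR:
  assumes "is_positive h" "0 \<le> r"
  shows "is_positive (r *\<^sub>R h)"
proof -
  obtain s where s: "norm (h - of_real s) \<le> s"
    using assms by (auto simp: is_positive_def)
  have "r *\<^sub>R h - of_real (r * s) = r *\<^sub>R (h - of_real s)"
    by (simp add: scaleR_diff_right of_real_def)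
  then have "norm (r *\<^sub>R h - of_real (r * s)) \<le> r * s"
    using s assms(2) by (simp add: mult_left_mono)
  moreover have "star (r *\<^sub>R h) = r *\<^sub>R h"
    using assms(1) by (simp add: is_positive_def)
  ultimately show ?thesis
    unfolding is_positive_def by blast
qed

lemma positive_zero [simp]: "is_positive 0"
  unfolding is_positive_def by (auto intro: exI[of _ 0])

lemma positive_sum: "(\<And>i. i \<in> S \<Longrightarrow> is_positive (f i)) \<Longrightarrow> is_positive (sum f S)"
  by (induction S rule: infinite_finite_induct) (auto intro: positive_add)

text \<open>With \<open>r = norm k\<close>, the polynomial X^2 - r^2 is bounded by r^2 on the
  interval from -r to r, so \<open>r\<^sup>2\<close> is a witness.\<close>

lemma positive_square:
  assumes "star k = k"
  shows "is_positive (k * k)"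
proof -
  define r where "r = norm k"
  have "spectral_bound {0 - r..0 + r} k"
    by (rule spectral_bound_ball) (auto simp: assms r_def)
  then have "norm (peval [:- r\<^sup>2, 0, 1:] k) \<le> r\<^sup>2"
  proof (rule spectral_boundD)
    fix t assume "t \<in> {0 - r..0 + r}"
    then have "\<bar>t\<bar> \<le> r" by auto
    then have "t\<^sup>2 \<le> r\<^sup>2"
      by (metis abs_ge_zero power2_abs power_mono)
    then have "\<bar>t * t - r\<^sup>2\<bar> \<le> r\<^sup>2"
      by (simp add: power2_eq_square abs_le_iff)
    then show "\<bar>poly [:- r\<^sup>2, 0, 1:] t\<bar> \<le> r\<^sup>2"
      by simp
  qed simp
  then show ?thesis
    unfolding is_positive_def using assms
    by (auto intro!: exI[of _ "r\<^sup>2"] simp: star_mult of_real_def algebra_simps)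
qed

lemma positive_sqrt:
  assumes "is_positive h"
  obtains k where "star k = k" "k * k = h"
proof -
  obtain s where s: "spectral_bound {0..s} h"
    using spectral_bound_if_positive assms by blast
  have cont: "continuous_on {0..s} sqrt"
    by (intro continuous_intros)
  obtain k where k: "cfc {0..s} h sqrt k"
    using cfc_exists[OF s _ cont] by blast
  have bd: "bounded (sqrt ` {0..s})"
    by (intro compact_imp_bounded compact_continuous_image cont) simp
  have "k * k = h"
    by (rule cfc_unique[OF s cfc_mult[OF k k bd bd] cfc_id]) auto
  with cfc_star[OF s k] show ?thesis
    using that by blast
qed

lemma positive_diff_iff_norm_le:
  assumes "star h = h" "norm h \<le> t"
  shows "is_positive (of_real t - h)"
  using assms unfolding is_positive_def by (auto simp: star_diff intro!: exI[of _ t])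

text \<open>Positivity of \<open>h\<close> and of \<open>of_real t - h\<close> gives two sets that
  bound the spectrum, one in t \<ge> 0 and one below \<open>t\<close>. The function
  \<open>min x t\<close> is the identity on the second and has modulus at most \<open>t\<close> on
  the first. One element \<open>g\<close> computed on the union therefore equals \<open>h\<close>
  and has norm at most \<open>t\<close>.\<close>

lemma norm_le_if_positive:
  assumes "is_positive h" "is_positive (of_real t - h)" "0 \<le> t"
  shows "norm h \<le> t"
proof -
  obtain s where s: "spectral_bound {0..s} h"
    using spectral_bound_if_positive assms(1) by blast
  obtain r where r: "norm ((of_real t - h) - of_real r) \<le> r"
    using assms(2) by (auto simp: is_positive_def)
  have "h - of_real (t - r) = - ((of_real t - h) - of_real r)"
    by simp
  then have "norm (h - of_real (t - r)) \<le> r"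
    using r by (metis norm_minus_cancel)
  then have "spectral_bound {(t - r) - r..(t - r) + r} h"
    using assms(1) by (intro spectral_bound_ball) (auto simp: is_positive_def)
  then have r': "spectral_bound {t - 2 * r..t} h"
    by simp
  let ?L = "{0..s} \<union> {t - 2 * r..t}"
  have "spectral_bound ?L h"
    using s by (rule spectral_bound_mono) simp
  moreover have "compact ?L" "continuous_on ?L (\<lambda>x. min x t)"
    by (auto intro!: continuous_intros)
  ultimately obtain g where g: "cfc ?L h (\<lambda>x. min x t) g"
    by (rule cfc_exists)
  have "g = h"
    by (rule cfc_unique[OF r' cfc_subset[OF g] cfc_id]) auto
  moreover have "norm g \<le> t"
    by (rule cfc_norm_le[OF s cfc_subset[OF g]]) (use assms(3) in auto)
  ultimately show ?thesis by simp
qed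

lemma norm_mono_if_positive:
  assumes "is_positive h" "is_positive (k - h)"
  shows "norm h \<le> norm k"
proof (rule norm_le_if_positive[OF assms(1)])
  have "star k = k"
    using positive_add[OF assms] by (simp add: is_positive_def)
  then have "is_positive (of_real (norm k) - k)"
    by (intro positive_diff_iff_norm_le) auto
  from positive_add[OF this assms(2)] show "is_positive (of_real (norm k) - h)"
    by simp
qed simp

lemma selfadjoint_cube_eq_0:
  fixes z :: "'a::cstar_algebra"
  assumes "star z = z" "z * z * z = 0"
  shows "z = 0"
proof -
  have "norm ((z * z) * (z * z)) = norm (z * z) * norm (z * z)"
    using assms(1) by (intro norm_selfadjoint_square) (simp add: star_mult)
  moreover have "(z * z) * (z * z) = 0"
    using assms(2) by (metis mult.assoc mult_zero_left)
  ultimately show ?thesis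
    using norm_selfadjoint_square[OF assms(1)] by simp
qed

text \<open>The Kelley--Vaught theorem. The negative part of \<open>x\<^sup>* x\<close> is brought into the form
  \<open>z = y\<^sup>* y \<le> 0\<close>; then \<open>y y\<^sup>* \<ge> 0\<close>, and as \<open>y p(y\<^sup>* y) = p(y y\<^sup>*) y\<close> for every polynomial
  \<open>p\<close>, the two products have the same spectrum up to \<open>0\<close>, which forces \<open>z = 0\<close>.\<close>

lemma positive_star_mult_aux:
  fixes y :: "'a::cstar_algebra_1"
  assumes neg: "is_positive (- (star y * y))"
  shows "star y * y = 0"
proof -
  define z w where "z = star y * y" and "w = y * star y"
  have star_z: "star z = z" and star_w: "star w = w"
    by (simp_all add: z_def w_def star_mult star_star)
  \<comment> \<open>Real and imaginary part of \<open>y\<close> up to scaling: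
    \<open>p * p + q * q = 2 *\<^sub>R (z + w)\<close>, so \<open>w\<close> is positive as a sum of
    positive elements.\<close>
  define p q where "p = y + star y" and "q = \<i> *\<^sub>C (y - star y)"
  have "star p = p" "star q = q"
    by (simp_all add: p_def q_def star_add star_diff star_star star_scaleC scaleC_diff_right add.commute)
  then have "is_positive (p * p + q * q + 2 *\<^sub>R (- z))"
    using neg by (intro positive_add positive_square positive_scaleR) (auto simp: z_def)
  moreover have "p * p + q * q + 2 *\<^sub>R (- z) = 2 *\<^sub>R w"
    by (simp add: p_def q_def z_def w_def mult_scaleC_left mult_scaleC_right scaleC_scaleC
        scaleC_diff_right algebra_simps scaleR_2)
  ultimately have "is_positive (2 *\<^sub>R w)"
    by (simp only:)
  then have "is_positive ((1 / 2) *\<^sub>R (2 *\<^sub>R w))"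
    by (rule positive_scaleR) simp
  then have "is_positive w" by simp
  then obtain s where s: "0 \<le> s" "spectral_bound {0..s} w"
    using spectral_bound_if_positive by blast
  obtain u where u: "norm (- z - of_real u) \<le> u"
    using neg by (auto simp: is_positive_def z_def)
  then have "0 \<le> u" using norm_ge_zero order_trans by blast
  have "z - of_real (- u) = - (- z - of_real u)"
    by simp
  then have "norm (z - of_real (- u)) \<le> u"
    using u by (metis norm_minus_cancel)
  then have "spectral_bound {(- u) - u..(- u) + u} z"
    using star_z by (intro spectral_bound_ball)
  then have u': "spectral_bound {- (2 * u)..0} z" by simp
  \<comment> \<open>One sequence of polynomials approximates the negative part on both sets at once.
    It therefore sends \<open>z\<close> to \<open>- z\<close> and \<open>w\<close> to 0.\<close>
  define L where "L = {- (2 * u)..0} \<union> {0..s}"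
  have "compact L" "continuous_on L (\<lambda>t. max 0 (- t))"
    by (auto simp: L_def intro!: continuous_intros)
  then obtain P where P: "uniform_limit L (\<lambda>n. poly (P n)) (\<lambda>t. max 0 (- t)) sequentially"
    using uniform_limit_polynomials by blast
  have Pz: "(\<lambda>n. peval (P n) z) \<longlonglongrightarrow> - z"
  proof -
    have lim: "uniform_limit {- (2 * u)..0} (\<lambda>n. poly (P n)) (\<lambda>t. max 0 (- t)) sequentially"
      using P by (rule uniform_limit_on_subset) (auto simp: L_def)
    then obtain g where g: "(\<lambda>n. peval (P n) z) \<longlonglongrightarrow> g"
      using convergent_peval[OF u'] unfolding convergent_def by blast
    then have "cfc {- (2 * u)..0} z (\<lambda>t. max 0 (- t)) g"
      unfolding cfc_def using lim by blast
    then have "g = - z"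
      by (rule cfc_unique[OF u' _ cfc_minus[OF cfc_id]]) auto
    with g show ?thesis by simp
  qed
  have Pw: "(\<lambda>n. peval (P n) w) \<longlonglongrightarrow> 0"
  proof -
    have lim: "uniform_limit {0..s} (\<lambda>n. poly (P n)) (\<lambda>t. max 0 (- t)) sequentially"
      using P by (rule uniform_limit_on_subset) (auto simp: L_def)
    then obtain g where g: "(\<lambda>n. peval (P n) w) \<longlonglongrightarrow> g"
      using convergent_peval[OF s(2)] unfolding convergent_def by blast
    then have "cfc {0..s} w (\<lambda>t. max 0 (- t)) g"
      unfolding cfc_def using lim by blast
    then have "g = 0"
      by (rule cfc_unique[OF s(2) _ cfc_poly[of _ _ 0, simplified]]) auto
    with g show ?thesis by simp
  qed
  have swap: "y * peval p z = peval p w * y" for p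
  proof (induction p)
    case (pCons c p)
    have "y * (z * peval p z) = w * peval p w * y"
      using pCons by (simp add: z_def w_def mult.assoc)
    then show ?case
      by (simp add: distrib_left distrib_right of_real_def)
  qed simp
  \<comment> \<open>Both sides are C*-identities for the element
    \<open>y * peval p z = peval p w * y\<close>: the left one for \<open>star b * b\<close>, the
    right one for \<open>b * star b\<close>.\<close>
  have norms: "norm (peval p z * z * peval p z) = norm (peval p w * w * peval p w)" for p
  proof -
    have "norm (peval p z * z * peval p z) = (norm (y * peval p z))\<^sup>2"
      using norm_star_mult_self[of "y * peval p z"] by (simp add: star_mult star_peval star_star z_def mult.assoc)
    also have "\<dots> = (norm (star (peval p w * y)))\<^sup>2"
      by (simp add: swap)
    also have "\<dots> = norm (peval p w * w * peval p w)"
      using norm_star_mult_self[of "star (peval p w * y)"]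
      by (simp add: star_mult star_peval star_w w_def mult.assoc star_star)
    finally show ?thesis .
  qed
  have "(\<lambda>n. norm (peval (P n) z * z * peval (P n) z)) \<longlonglongrightarrow> norm (- z * z * - z)"
    by (intro tendsto_intros Pz)
  moreover have "(\<lambda>n. norm (peval (P n) w * w * peval (P n) w)) \<longlonglongrightarrow> norm (0 * w * 0)"
    by (intro tendsto_intros Pw)
  ultimately have "norm (- z * z * - z) = norm (0 * w * 0)"
    unfolding norms by (rule LIMSEQ_unique)
  then have "z * z * z = 0" by simp
  then show ?thesis
    using selfadjoint_cube_eq_0[OF star_z] by (simp add: z_def)
qed

lemma positive_star_mult: "is_positive (star x * x)" for x :: "'a::cstar_algebra_1"
proof -
  define h where "h = star x * x"
  define r where "r = norm h"
  define K where "K = {0 - r..0 + r}"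
  have star_h: "star h = h"
    by (simp add: h_def star_mult star_star)
  have K: "spectral_bound K h"
    unfolding K_def by (rule spectral_bound_ball) (auto simp: star_h r_def)
  have "compact K" by (simp add: K_def)
  \<comment> \<open>\<open>fn\<close> is the negative part, \<open>fp\<close> the root of the
    positive part, \<open>fr\<close> the power 3/2 of the negative part. Hence \<open>m * m\<close>
    is the cube of \<open>g\<close>, and \<open>g * h * g\<close> is its negative; this is the shape
    that the preceding lemma needs for \<open>y = x * g\<close>.\<close>
  define fn fp fr where "fn t = max 0 (- t)" and "fp t = sqrt (max 0 t)" and "fr t = sqrt (max 0 (- t)) ^ 3"
    for t :: real
  have cont: "continuous_on K fn" "continuous_on K fp" "continuous_on K fr"
    unfolding fn_def fp_def fr_def by (intro continuous_intros)+
  then have bd: "bounded (fn ` K)" "bounded (fp ` K)" "bounded (fr ` K)"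
    using \<open>compact K\<close> by (auto intro!: compact_imp_bounded compact_continuous_image)
  obtain g k m where g: "cfc K h fn g" and k: "cfc K h fp k" and m: "cfc K h fr m"
    using cfc_exists[OF K \<open>compact K\<close>] cont by metis
  have stars: "star g = g" "star k = k" "star m = m"
    using cfc_star[OF K] g k m by auto
  have bdid: "bounded ((\<lambda>t. t) ` K)"
    using \<open>compact K\<close> by (simp add: compact_imp_bounded)
  have bdm: "bounded ((\<lambda>t. f t * f' t) ` K)" if "continuous_on K f" "continuous_on K f'" for f f' :: "real \<Rightarrow> real"
    using that \<open>compact K\<close> by (intro compact_imp_bounded compact_continuous_image continuous_intros)
  have "g * h * g = - (m * m)"
  proof (rule cfc_unique[OF K])
    show "cfc K h (\<lambda>t. fn t * t * fn t) (g * h * g)"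
      by (intro cfc_mult g cfc_id bd bdid bdm cont continuous_intros)
    show "cfc K h (\<lambda>t. - (fr t * fr t)) (- (m * m))"
      by (intro cfc_minus cfc_mult m bd)
    fix t
    have "fr t * fr t = max 0 (- t) ^ 3"
      by (simp add: fr_def flip: power_mult_distrib)
    then show "fn t * t * fn t = - (fr t * fr t)"
      by (auto simp: fn_def max_def power3_eq_cube)
  qed
  moreover have "star (x * g) * (x * g) = g * h * g"
    by (simp add: h_def star_mult stars mult.assoc)
  ultimately have "star (x * g) * (x * g) = - (m * m)" by simp
  moreover from this have "star (x * g) * (x * g) = 0"
    using positive_square[OF stars(3)] by (intro positive_star_mult_aux) simp
  ultimately have "m * m = 0" by simp
  moreover have "g * g * g = m * m"
  proof (rule cfc_unique[OF K])
    show "cfc K h (\<lambda>t. fn t * fn t * fn t) (g * g * g)"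
      by (intro cfc_mult g bd bdm cont)
    show "cfc K h (\<lambda>t. fr t * fr t) (m * m)"
      by (intro cfc_mult m bd)
    show "fn t * fn t * fn t = fr t * fr t" for t
      by (simp add: fr_def fn_def power3_eq_cube flip: power_mult_distrib)
  qed
  ultimately have "g = 0"
    using selfadjoint_cube_eq_0[OF stars(1)] by simp
  moreover have "k * k = h + g"
  proof (rule cfc_unique[OF K])
    show "cfc K h (\<lambda>t. fp t * fp t) (k * k)"
      by (intro cfc_mult k bd)
    show "cfc K h (\<lambda>t. t + fn t) (h + g)"
      by (intro cfc_add cfc_id g)
    show "fp t * fp t = t + fn t" for t
      by (auto simp: fp_def fn_def)
  qed
  ultimately show ?thesis
    using positive_square[OF stars(2)] by (simp add: h_def)
qed

lemma positive_conjugate: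
  assumes "is_positive h"
  shows "is_positive (star x * h * x)"
proof -
  obtain k where "star k = k" "k * k = h"
    using positive_sqrt assms by blast
  then have "star x * h * x = star (k * x) * (k * x)"
    by (metis mult.assoc star_mult)
  then show ?thesis
    by (simp add: positive_star_mult)
qed

lemma positive_conjugate_norm:
  fixes c :: "'a::cstar_algebra_1"
  assumes "star h = h" "norm h \<le> r"
  shows "is_positive (r *\<^sub>R (star x * x) - star x * h * x)"
proof -
  have "is_positive (star x * (of_real r - h) * x)"
    by (intro positive_conjugate positive_diff_iff_norm_le assms)
  then show ?thesis
    by (simp add: algebra_simps of_real_def)
qed

section \<open>Norm inequalities for sums of products\<close>

lemma norm_sum_mono_1:
  fixes x :: "'i \<Rightarrow> 'a::cstar_algebra_1"
  assumes "finite G" "F \<subseteq> G"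
  shows "norm (\<Sum>i\<in>F. star (x i) * x i) \<le> norm (\<Sum>i\<in>G. star (x i) * x i)"
proof (rule norm_mono_if_positive)
  have "(\<Sum>i\<in>G. star (x i) * x i) - (\<Sum>i\<in>F. star (x i) * x i) = (\<Sum>i\<in>G - F. star (x i) * x i)"
    using assms by (simp add: sum_diff)
  then show "is_positive ((\<Sum>i\<in>G. star (x i) * x i) - (\<Sum>i\<in>F. star (x i) * x i))"
    by (simp add: positive_sum positive_star_mult)
qed (simp add: positive_sum positive_star_mult)

lemma norm_sum_mult_left_le_1:
  fixes x :: "'i \<Rightarrow> 'a::cstar_algebra_1"
  assumes "finite F" "\<And>i. i \<in> F \<Longrightarrow> norm (c i) \<le> r"
  shows "norm (\<Sum>i\<in>F. star (c i * x i) * (c i * x i)) \<le> r\<^sup>2 * norm (\<Sum>i\<in>F. star (x i) * x i)"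
proof -
  have "norm (\<Sum>i\<in>F. star (c i * x i) * (c i * x i)) \<le> norm (r\<^sup>2 *\<^sub>R (\<Sum>i\<in>F. star (x i) * x i))"
  proof (rule norm_mono_if_positive)
    have "is_positive (r\<^sup>2 *\<^sub>R (star (x i) * x i) - star (c i * x i) * (c i * x i))" if "i \<in> F" for i
    proof -
      have "norm (star (c i) * c i) \<le> r\<^sup>2"
        using assms(2)[OF that] by (simp add: norm_star_mult_self power_mono)
      then have "is_positive (r\<^sup>2 *\<^sub>R (star (x i) * x i) - star (x i) * (star (c i) * c i) * x i)"
        by (intro positive_conjugate_norm) (auto simp: star_mult star_star)
      then show ?thesis
        by (simp add: star_mult mult.assoc)
    qed
    then have "is_positive (\<Sum>i\<in>F. r\<^sup>2 *\<^sub>R (star (x i) * x i) - star (c i * x i) * (c i * x i))"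
      by (rule positive_sum)
    then show "is_positive (r\<^sup>2 *\<^sub>R (\<Sum>i\<in>F. star (x i) * x i) - (\<Sum>i\<in>F. star (c i * x i) * (c i * x i)))"
      by (simp add: sum_subtractf scaleR_sum_right)
  qed (simp add: positive_sum positive_star_mult)
  then show ?thesis by simp
qed

text \<open>For t > norm X, positivity of the sum of the inner squares of
  \<open>x i * c - t *\<^sub>R y i\<close>, together with star c X c \<le> t star c c, gives star c
  c \<le> t Y. Taking norms and letting \<open>t\<close> decrease to norm X yields the claim; the
  strict inequality allows the division by \<open>t\<close>.\<close>

lemma Cauchy_Schwarz_sum_1:
  fixes x y :: "'i \<Rightarrow> 'a::cstar_algebra_1"
  assumes "finite F"
  shows "(norm (\<Sum>i\<in>F. star (x i) * y i))\<^sup>2 \<le>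
    norm (\<Sum>i\<in>F. star (x i) * x i) * norm (\<Sum>i\<in>F. star (y i) * y i)"
proof -
  define X Y c where "X = (\<Sum>i\<in>F. star (x i) * x i)" and "Y = (\<Sum>i\<in>F. star (y i) * y i)"
    and "c = (\<Sum>i\<in>F. star (x i) * y i)"
  have star_c: "star c = (\<Sum>i\<in>F. star (y i) * x i)"
    by (simp add: c_def star_sum star_mult star_star)
  have le: "(norm c)\<^sup>2 \<le> t * norm Y" if t: "norm X < t" for t
  proof -
    have "0 < t" using t norm_ge_zero le_less_trans by blast
    have "is_positive (\<Sum>i\<in>F. star (x i * c - t *\<^sub>R y i) * (x i * c - t *\<^sub>R y i))"
      by (simp add: positive_sum positive_star_mult)
    also have "(\<Sum>i\<in>F. star (x i * c - t *\<^sub>R y i) * (x i * c - t *\<^sub>R y i)) =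
        (\<Sum>i\<in>F. star c * (star (x i) * x i) * c - t *\<^sub>R (star c * (star (x i) * y i))
          - t *\<^sub>R ((star (y i) * x i) * c) + (t * t) *\<^sub>R (star (y i) * y i))"
      by (intro sum.cong) (simp_all add: star_diff star_mult algebra_simps)
    also have "\<dots> = star c * X * c - t *\<^sub>R (star c * c) - t *\<^sub>R (star c * c) + (t * t) *\<^sub>R Y"
      by (simp add: sum.distrib sum_subtractf X_def Y_def star_c flip: scaleR_sum_right sum_distrib_left sum_distrib_right)
        (simp add: c_def)
    finally have "is_positive (star c * X * c - t *\<^sub>R (star c * c) - t *\<^sub>R (star c * c) + (t * t) *\<^sub>R Y)" .
    moreover have "is_positive (t *\<^sub>R (star c * c) - star c * X * c)"
      by (rule positive_conjugate_norm) (use t in \<open>auto simp: X_def star_sum star_mult star_star\<close>)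
    ultimately have "is_positive (star c * X * c - t *\<^sub>R (star c * c) - t *\<^sub>R (star c * c) + (t * t) *\<^sub>R Y +
        (t *\<^sub>R (star c * c) - star c * X * c))"
      by (rule positive_add)
    then have "is_positive ((1 / t) *\<^sub>R ((t * t) *\<^sub>R Y - t *\<^sub>R (star c * c)))"
      using \<open>0 < t\<close> by (intro positive_scaleR) (auto simp: algebra_simps)
    then have "is_positive (t *\<^sub>R Y - star c * c)"
      using \<open>0 < t\<close> by (simp add: scaleR_diff_right)
    then have "norm (star c * c) \<le> norm (t *\<^sub>R Y)"
      by (intro norm_mono_if_positive positive_star_mult)
    then show ?thesis
      using \<open>0 < t\<close> by (simp add: norm_star_mult_self)
  qed
  have "(norm c)\<^sup>2 \<le> norm X * norm Y"
  proof (cases "norm Y = 0")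
    case True
    then show ?thesis using le[of "norm X + 1"] by simp
  next
    case False
    then have "(norm c)\<^sup>2 / norm Y \<le> t" if "norm X < t" for t
      using le[OF that] by (simp add: divide_simps)
    then have "(norm c)\<^sup>2 / norm Y \<le> norm X"
      by (rule dense_ge)
    then show ?thesis
      using False by (simp add: divide_simps split: if_splits)
  qed
  then show ?thesis
    by (simp add: X_def Y_def c_def)
qed

section \<open>Unitization\<close>

datatype 'a unitization = Unitization (base: 'a) (scalar: complex)

lemma unitization_eq_iff: "x = y \<longleftrightarrow> base x = base y \<and> scalar x = scalar y"
  by (cases x; cases y) simp

definition left_mult :: "'a::cstar_algebra unitization \<Rightarrow> 'a \<Rightarrow> 'a" where
  "left_mult x b = base x * b + scalar x *\<^sub>C b"

lemma bounded_linear_left_mult: "bounded_linear (left_mult x)"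
  unfolding left_mult_def[abs_def]
  by (intro bounded_linear_add bounded_linear_mult_right bounded_linear_scaleC)

instantiation unitization :: (cstar_algebra) real_normed_algebra_1
begin

definition "0 = Unitization 0 0"
definition "1 = Unitization 0 1"
definition "x + y = Unitization (base x + base y) (scalar x + scalar y)"
definition "x - y = Unitization (base x - base y) (scalar x - scalar y)"
definition "- x = Unitization (- base x) (- scalar x)"
definition "x * y = Unitization (base x * base y + scalar y *\<^sub>C base x + scalar x *\<^sub>C base y) (scalar x * scalar y)"
definition "r *\<^sub>R x = Unitization (r *\<^sub>R base x) (of_real r * scalar x)" for x :: "'a unitization"
text \<open>The operator norm of the left multiplication alone fails to be definite if the algebra
  has a unit e, since \<open>Unitization (- e) 1\<close> acts as 0. The maximum with the modulus of
  the scalar part is the C*-norm in all cases.\<close>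

definition "norm x = max (onorm (left_mult x)) (cmod (scalar x))"
definition "dist x y = norm (x - y)" for x y :: "'a unitization"
definition "sgn x = scaleR (inverse (norm x)) x" for x :: "'a unitization"
definition "uniformity = (INF e\<in>{0 <..}. principal {(x, y :: 'a unitization). dist x y < e})"
definition "open U \<longleftrightarrow> (\<forall>x\<in>U. \<forall>\<^sub>F (x', y) in uniformity. x' = x \<longrightarrow> y \<in> U)" for U :: "'a unitization set"

lemmas unitization_defs = zero_unitization_def one_unitization_def plus_unitization_def
  minus_unitization_def uminus_unitization_def times_unitization_def scaleR_unitization_def

lemma left_mult_add: "left_mult (x + y) b = left_mult x b + left_mult y b"
  by (simp add: left_mult_def unitization_defs scaleC_add_left algebra_simps)

lemma left_mult_mult: "left_mult (x * y) b = left_mult x (left_mult y b)"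
  by (simp add: left_mult_def unitization_defs scaleC_add_right mult_scaleC_left mult_scaleC_right
      scaleC_scaleC algebra_simps)

lemma norm_left_mult_le: "norm (left_mult x b) \<le> onorm (left_mult x) * norm b"
  by (rule onorm[OF bounded_linear_left_mult])

lemma onorm_left_mult_nonneg: "0 \<le> onorm (left_mult x)"
  by (rule onorm_pos_le[OF bounded_linear_left_mult])

lemma onorm_left_mult_mult: "onorm (left_mult (x * y)) \<le> onorm (left_mult x) * onorm (left_mult y)"
proof -
  have "left_mult (x * y) = left_mult x \<circ> left_mult y"
    by (auto simp: left_mult_mult)
  then show ?thesis
    using onorm_compose bounded_linear_left_mult by metis
qed

text \<open>Evaluate the left multiplication at \<open>star (base x)\<close> and use the
  C*-identity. Definiteness and completeness of the norm rest on this control of the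
  coordinate.\<close>

lemma norm_base_le: "norm (base x) \<le> onorm (left_mult x) + cmod (scalar x)"
proof (cases "base x = 0")
  case False
  let ?b = "star (base x)"
  have "norm (base x) * norm ?b = norm (base x * ?b)"
    using norm_star_mult_self[of ?b] by (simp add: star_star power2_eq_square)
  also have "base x * ?b = left_mult x ?b - scalar x *\<^sub>C ?b"
    by (simp add: left_mult_def)
  also have "norm \<dots> \<le> onorm (left_mult x) * norm ?b + cmod (scalar x) * norm ?b"
    using norm_triangle_ineq4[of "left_mult x ?b" "scalar x *\<^sub>C ?b"] norm_left_mult_le[of x ?b]
    by (simp add: norm_scaleC)
  finally have "norm (base x) * norm ?b \<le> (onorm (left_mult x) + cmod (scalar x)) * norm ?b"
    by (simp add: distrib_right)
  then show ?thesis
    using False by simp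
qed (simp add: onorm_left_mult_nonneg)

lemma norm_unitization_le: "norm x \<le> norm (base x) + cmod (scalar x)"
proof -
  have "onorm (left_mult x) \<le> norm (base x) + cmod (scalar x)"
  proof (rule onorm_bound)
    fix b
    have "norm (left_mult x b) \<le> norm (base x * b) + norm (scalar x *\<^sub>C b)"
      unfolding left_mult_def by (rule norm_triangle_ineq)
    also have "\<dots> \<le> norm (base x) * norm b + cmod (scalar x) * norm b"
      by (intro add_mono norm_mult_ineq) (simp add: norm_scaleC)
    finally show "norm (left_mult x b) \<le> (norm (base x) + cmod (scalar x)) * norm b"
      by (simp add: distrib_right)
  qed simp
  then show ?thesis by (simp add: norm_unitization_def)
qed

lemma norm_unitization_triangle: "norm (x + y) \<le> norm x + norm y" for x y :: "'a unitization"
proof -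
  have "left_mult (x + y) = (\<lambda>b. left_mult x b + left_mult y b)"
    by (auto simp: left_mult_add)
  then have "onorm (left_mult (x + y)) \<le> onorm (left_mult x) + onorm (left_mult y)"
    using onorm_triangle[OF bounded_linear_left_mult bounded_linear_left_mult, of x y] by simp
  moreover have "cmod (scalar (x + y)) \<le> cmod (scalar x) + cmod (scalar y)"
    by (simp add: plus_unitization_def norm_triangle_ineq)
  ultimately show ?thesis
    unfolding norm_unitization_def by linarith
qed

lemma scalar_le_norm: "cmod (scalar x) \<le> norm x" and onorm_le_norm: "onorm (left_mult x) \<le> norm x"
  by (auto simp: norm_unitization_def)

lemma norm_unitization_eq_0: "norm x = 0 \<longleftrightarrow> x = 0" for x :: "'a unitization"
proof
  assume "norm x = 0"
  then have "scalar x = 0" "onorm (left_mult x) \<le> 0"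
    using scalar_le_norm[of x] onorm_le_norm[of x] by auto
  then show "x = 0"
    using norm_base_le[of x] order_trans by (fastforce simp: unitization_eq_iff zero_unitization_def)
next
  assume "x = 0"
  then show "norm x = 0"
    using norm_unitization_le[of x] scalar_le_norm[of x] by (simp add: zero_unitization_def)
qed

instance
proof
  fix x y z :: "'a unitization" and r s :: real
  show "x + y + z = x + (y + z)" "x + y = y + x" "0 + x = x" "- x + x = 0" "x - y = x + - y"
    by (simp_all add: unitization_defs)
  show "r *\<^sub>R (x + y) = r *\<^sub>R x + r *\<^sub>R y" "(r + s) *\<^sub>R x = r *\<^sub>R x + s *\<^sub>R x"
    "r *\<^sub>R s *\<^sub>R x = (r * s) *\<^sub>R x" "1 *\<^sub>R x = x"
    by (simp_all add: unitization_defs algebra_simps)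
  show "x * y * z = x * (y * z)" "(x + y) * z = x * z + y * z" "x * (y + z) = x * y + x * z"
    by (simp_all add: unitization_defs algebra_simps scaleC_add_left scaleC_add_right
        mult_scaleC_left mult_scaleC_right scaleC_scaleC)
  show "r *\<^sub>R x * y = r *\<^sub>R (x * y)" "x * r *\<^sub>R y = r *\<^sub>R (x * y)"
    by (simp_all add: unitization_defs algebra_simps scaleR_scaleC scaleC_add_right
        mult_scaleC_left mult_scaleC_right scaleC_scaleC)
  have "left_mult (r *\<^sub>R x) = (\<lambda>b. r *\<^sub>R left_mult x b)"
    by (auto simp: left_mult_def unitization_defs scaleR_scaleC scaleC_add_right scaleC_scaleC mult_scaleC_left)
  then show "norm (r *\<^sub>R x) = \<bar>r\<bar> * norm x"
    by (simp add: norm_unitization_def onorm_scaleR[OF bounded_linear_left_mult] scaleR_unitization_def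
        norm_mult max_mult_distrib_left)
  show "dist x y = norm (x - y)" "sgn x = inverse (norm x) *\<^sub>R x"
    by (simp_all add: dist_unitization_def sgn_unitization_def)
  show "(uniformity :: ('a unitization \<times> 'a unitization) filter) = (INF e\<in>{0 <..}. principal {(x, y). dist x y < e})"
    by (rule uniformity_unitization_def)
  show "open U \<longleftrightarrow> (\<forall>x\<in>U. \<forall>\<^sub>F (x', y) in uniformity. x' = x \<longrightarrow> y \<in> U)" for U :: "'a unitization set"
    by (rule open_unitization_def)
  show "norm x = 0 \<longleftrightarrow> x = 0"
    by (rule norm_unitization_eq_0)
  show "norm (x + y) \<le> norm x + norm y"
    by (rule norm_unitization_triangle)
  show "norm (x * y) \<le> norm x * norm y"
  proof -
    have "onorm (left_mult (x * y)) \<le> norm x * norm y"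
      using onorm_left_mult_mult[of x y] onorm_le_norm[of x] onorm_le_norm[of y]
      by (meson mult_mono onorm_left_mult_nonneg order_trans)
    moreover have "cmod (scalar (x * y)) \<le> norm x * norm y"
      using scalar_le_norm[of x] scalar_le_norm[of y]
      by (simp add: times_unitization_def norm_mult mult_mono')
    ultimately show ?thesis
      by (simp add: norm_unitization_def)
  qed
  show "1 * x = x" "x * 1 = x" "0 \<noteq> (1 :: 'a unitization)"
    by (simp_all add: unitization_defs unitization_eq_iff)
  have "onorm (left_mult (1 :: 'a unitization)) \<le> 1"
    by (rule onorm_bound) (simp_all add: left_mult_def one_unitization_def)
  then show "norm (1 :: 'a unitization) = 1"
    by (simp add: norm_unitization_def one_unitization_def)
qed

end

instance unitization :: (cstar_algebra) complete_space
proof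
  show "convergent X" if X: "Cauchy X" for X :: "nat \<Rightarrow> 'a unitization"
  proof -
    have dists: "cmod (scalar x - scalar y) \<le> dist x y" "norm (base x - base y) \<le> 2 * dist x y" for x y :: "'a unitization"
      using scalar_le_norm[of "x - y"] norm_base_le[of "x - y"] onorm_le_norm[of "x - y"]
      by (auto simp: dist_unitization_def minus_unitization_def)
    have "Cauchy (\<lambda>n. scalar (X n))"
      unfolding Cauchy_def
    proof (intro allI impI)
      fix e :: real assume "e > 0"
      then obtain M where "\<And>m n. m \<ge> M \<Longrightarrow> n \<ge> M \<Longrightarrow> dist (X m) (X n) < e"
        using X unfolding Cauchy_def by blast
      then show "\<exists>M. \<forall>m\<ge>M. \<forall>n\<ge>M. dist (scalar (X m)) (scalar (X n)) < e"
        using dists(1) by (metis dist_norm le_less_trans)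
    qed
    moreover have "Cauchy (\<lambda>n. base (X n))"
      unfolding Cauchy_def
    proof (intro allI impI)
      fix e :: real assume "e > 0"
      then have "e / 2 > 0" by simp
      then obtain M where "\<And>m n. m \<ge> M \<Longrightarrow> n \<ge> M \<Longrightarrow> dist (X m) (X n) < e / 2"
        using X unfolding Cauchy_def by blast
      then show "\<exists>M. \<forall>m\<ge>M. \<forall>n\<ge>M. dist (base (X m)) (base (X n)) < e"
        using dists(2) by (smt (verit) dist_norm field_sum_of_halves)
    qed
    ultimately obtain b s where b: "(\<lambda>n. base (X n)) \<longlonglongrightarrow> b" and s: "(\<lambda>n. scalar (X n)) \<longlonglongrightarrow> s"
      by (meson Cauchy_convergent convergent_def)
    have "(\<lambda>n. norm (base (X n) - b) + norm (scalar (X n) - s)) \<longlonglongrightarrow> 0 + 0"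
      by (intro tendsto_add tendsto_norm_zero LIM_zero b s)
    then have lim: "(\<lambda>n. norm (base (X n) - b) + norm (scalar (X n) - s)) \<longlonglongrightarrow> 0"
      by simp
    have le: "dist (X n) (Unitization b s) \<le> norm (base (X n) - b) + norm (scalar (X n) - s)" for n
      using norm_unitization_le[of "X n - Unitization b s"]
      by (simp add: dist_unitization_def minus_unitization_def)
    have "\<exists>N. \<forall>n\<ge>N. dist (X n) (Unitization b s) < e" if "e > 0" for e
    proof -
      obtain N where N: "\<And>n. n \<ge> N \<Longrightarrow> norm (base (X n) - b) + norm (scalar (X n) - s) < e"
        using order_tendstoD(2)[OF lim \<open>e > 0\<close>] by (auto simp: eventually_sequentially)
      show ?thesis
        by (intro exI[of _ N] allI impI le_less_trans[OF le N])
    qed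
    then have "X \<longlonglongrightarrow> Unitization b s"
      by (simp add: lim_sequentially)
    then show ?thesis
      by (rule convergentI)
  qed
qed

instantiation unitization :: (cstar_algebra) cstar_algebra
begin

definition "c *\<^sub>C x = Unitization (c *\<^sub>C base x) (c * scalar x)" for x :: "'a unitization"
definition "star x = Unitization (star (base x)) (cnj (scalar x))"

lemma left_mult_scaleC: "left_mult (c *\<^sub>C x) b = c *\<^sub>C left_mult x b"
  by (simp add: left_mult_def scaleC_unitization_def scaleC_add_right mult_scaleC_left scaleC_scaleC)

lemma star_left_mult: "star (left_mult x b) * c = star b * left_mult (star x) c"
  by (simp add: left_mult_def star_unitization_def star_add star_mult star_scaleC mult_scaleC_left
      mult_scaleC_right algebra_simps)

lemma onorm_left_mult_scaleC_le: "onorm (left_mult (c *\<^sub>C x)) \<le> cmod c * onorm (left_mult x)"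
  by (rule onorm_bound)
    (simp_all add: left_mult_scaleC norm_scaleC onorm_left_mult_nonneg mult.assoc mult_left_mono norm_left_mult_le)

lemma norm_unitization_scaleC: "norm (c *\<^sub>C x) = cmod c * norm x" for x :: "'a unitization"
proof -
  have "onorm (left_mult (c *\<^sub>C x)) = cmod c * onorm (left_mult x)"
  proof (cases "c = 0")
    case True
    then show ?thesis
      using onorm_left_mult_scaleC_le[of 0 x] onorm_left_mult_nonneg[of "0 *\<^sub>C x"] by simp
  next
    case False
    have "inverse c *\<^sub>C c *\<^sub>C x = x"
      using False by (simp add: scaleC_unitization_def scaleC_scaleC unitization_eq_iff)
    then have "onorm (left_mult x) \<le> cmod (inverse c) * onorm (left_mult (c *\<^sub>C x))"
      using onorm_left_mult_scaleC_le[of "inverse c" "c *\<^sub>C x"] by simp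
    then have "cmod c * onorm (left_mult x) \<le> onorm (left_mult (c *\<^sub>C x))"
      using False by (simp add: norm_inverse norm_divide field_simps)
    then show ?thesis
      using onorm_left_mult_scaleC_le[of c x] by simp
  qed
  moreover have "scalar (c *\<^sub>C x) = c * scalar x"
    by (simp add: scaleC_unitization_def)
  ultimately show ?thesis
    by (simp add: norm_unitization_def norm_mult max_mult_distrib_left)
qed

text \<open>The square of \<open>norm (left_mult x b)\<close> is the norm of
  \<open>star b * left_mult (star x * x) b\<close>: the unitization acts by adjointable operators on
  the algebra as a module over itself.\<close>

lemma onorm_left_mult_square: "(onorm (left_mult x))\<^sup>2 \<le> onorm (left_mult (star x * x))"
proof -
  let ?N = "onorm (left_mult (star x * x))"
  have "onorm (left_mult x) \<le> sqrt ?N"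
  proof (rule onorm_bound)
    fix b
    have "(norm (left_mult x b))\<^sup>2 = norm (star b * left_mult (star x * x) b)"
      by (simp add: left_mult_mult star_left_mult flip: norm_star_mult_self)
    also have "\<dots> \<le> norm b * (?N * norm b)"
      by (rule order_trans[OF norm_mult_ineq]) (simp add: mult_left_mono norm_left_mult_le)
    also have "\<dots> = (sqrt ?N * norm b)\<^sup>2"
      by (simp add: power_mult_distrib onorm_left_mult_nonneg power2_eq_square)
    finally show "norm (left_mult x b) \<le> sqrt ?N * norm b"
      by (rule power2_le_imp_le) (simp add: onorm_left_mult_nonneg)
  qed (simp add: onorm_left_mult_nonneg)
  then have "(onorm (left_mult x))\<^sup>2 \<le> (sqrt ?N)\<^sup>2"
    using onorm_left_mult_nonneg by (rule power_mono)
  then show ?thesis by (simp add: onorm_left_mult_nonneg)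
qed

lemma onorm_left_mult_star: "onorm (left_mult (star x)) = onorm (left_mult x)"
proof -
  have *: "onorm (left_mult y) \<le> onorm (left_mult (star y))" for y :: "'a unitization"
  proof (cases "onorm (left_mult y) = 0")
    case False
    then have "0 < onorm (left_mult y)"
      using onorm_left_mult_nonneg[of y] by simp
    moreover have "onorm (left_mult y) * onorm (left_mult y) \<le> onorm (left_mult (star y)) * onorm (left_mult y)"
      using onorm_left_mult_square[of y] onorm_left_mult_mult[of "star y" y] by (simp add: power2_eq_square)
    ultimately show ?thesis by simp
  qed (simp add: onorm_left_mult_nonneg)
  have "star (star x) = x"
    by (simp add: star_unitization_def star_star)
  with *[of x] *[of "star x"] show ?thesis by simp
qed

instance
proof
  fix x y z :: "'a unitization" and r s :: real and c d :: complex
  show "c *\<^sub>C (x + y) = c *\<^sub>C x + c *\<^sub>C y" "(c + d) *\<^sub>C x = c *\<^sub>C x + d *\<^sub>C x"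
    "c *\<^sub>C d *\<^sub>C x = (c * d) *\<^sub>C x" "r *\<^sub>R x = complex_of_real r *\<^sub>C x"
    by (simp_all add: unitization_defs scaleC_unitization_def star_unitization_def algebra_simps scaleC_add_left scaleC_add_right scaleC_scaleC scaleR_scaleC)
  show "(c *\<^sub>C x) * y = c *\<^sub>C (x * y)" "x * (c *\<^sub>C y) = c *\<^sub>C (x * y)"
    by (simp_all add: unitization_defs scaleC_unitization_def star_unitization_def algebra_simps scaleC_add_right
        mult_scaleC_left mult_scaleC_right scaleC_scaleC)
  show "star (x + y) = star x + star y" "star (c *\<^sub>C x) = cnj c *\<^sub>C star x"
    "star (x * y) = star y * star x" "star (star x) = x"
    by (simp_all add: unitization_defs scaleC_unitization_def star_unitization_def star_add star_scaleC star_mult star_star algebra_simps)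
  show "norm (c *\<^sub>C x) = cmod c * norm x"
    by (rule norm_unitization_scaleC)
  show "norm (star x * x) = (norm x)\<^sup>2"
  proof -
    have "onorm (left_mult (star x * x)) = (onorm (left_mult x))\<^sup>2"
      using onorm_left_mult_square[of x] onorm_left_mult_mult[of "star x" x]
      by (simp add: onorm_left_mult_star power2_eq_square)
    moreover have "cmod (scalar (star x * x)) = (cmod (scalar x))\<^sup>2"
      by (simp add: star_unitization_def times_unitization_def norm_mult power2_eq_square)
    ultimately show ?thesis
      unfolding norm_unitization_def using onorm_left_mult_nonneg[of x]
      by (metis max_def norm_ge_zero power2_le_imp_le power_mono)
  qed
qed

end

instance unitization :: (cstar_algebra) cstar_algebra_1 ..

definition unitize :: "'a::cstar_algebra \<Rightarrow> 'a unitization" where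
  "unitize a = Unitization a 0"

lemma unitize_add: "unitize (a + b) = unitize a + unitize b"
  and unitize_diff: "unitize (a - b) = unitize a - unitize b"
  and unitize_mult: "unitize (a * b) = unitize a * unitize b"
  and unitize_star: "unitize (star a) = star (unitize a)"
  and unitize_scaleR: "unitize (r *\<^sub>R a) = r *\<^sub>R unitize a"
  and unitize_zero [simp]: "unitize 0 = 0"
  by (simp_all add: unitize_def unitization_defs star_unitization_def)

lemma unitize_sum: "unitize (sum f S) = (\<Sum>i\<in>S. unitize (f i))"
  by (induction S rule: infinite_finite_induct) (auto simp: unitize_add)

lemma norm_unitize [simp]: "norm (unitize a) = norm a"
  using norm_unitization_le[of "unitize a"] norm_base_le[of "unitize a"] onorm_le_norm[of "unitize a"]
  by (simp add: unitize_def)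

lemma norm_sum_unitize:
  "norm (\<Sum>i\<in>S. star (unitize (x i)) * unitize (y i)) = norm (\<Sum>i\<in>S. star (x i) * y i)"
  by (simp flip: unitize_star unitize_mult unitize_sum)

lemma norm_sum_star_mult_mono:
  fixes x :: "'i \<Rightarrow> 'a::cstar_algebra"
  assumes "finite G" "F \<subseteq> G"
  shows "norm (\<Sum>i\<in>F. star (x i) * x i) \<le> norm (\<Sum>i\<in>G. star (x i) * x i)"
proof -
  show ?thesis
    using norm_sum_mono_1[OF assms, of "\<lambda>i. unitize (x i)"] by (simp only: norm_sum_unitize)
qed

lemma norm_sum_mult_left_le:
  fixes x :: "'i \<Rightarrow> 'a::cstar_algebra"
  assumes "finite F" "\<And>i. i \<in> F \<Longrightarrow> norm (c i) \<le> r"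
  shows "norm (\<Sum>i\<in>F. star (c i * x i) * (c i * x i)) \<le> r\<^sup>2 * norm (\<Sum>i\<in>F. star (x i) * x i)"
proof -
  show ?thesis
    using norm_sum_mult_left_le_1[OF assms(1), of "\<lambda>i. unitize (c i)" r "\<lambda>i. unitize (x i)"] assms(2)
    by (simp only: norm_sum_unitize norm_unitize flip: unitize_mult)
qed

lemma Cauchy_Schwarz_sum:
  fixes x y :: "'i \<Rightarrow> 'a::cstar_algebra"
  assumes "finite F"
  shows "norm (\<Sum>i\<in>F. star (x i) * y i) \<le>
    sqrt (norm (\<Sum>i\<in>F. star (x i) * x i)) * sqrt (norm (\<Sum>i\<in>F. star (y i) * y i))"
proof -
  have "(norm (\<Sum>i\<in>F. star (x i) * y i))\<^sup>2 \<le>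
      norm (\<Sum>i\<in>F. star (x i) * x i) * norm (\<Sum>i\<in>F. star (y i) * y i)"
    using Cauchy_Schwarz_sum_1[OF assms, of "\<lambda>i. unitize (x i)" "\<lambda>i. unitize (y i)"] by (simp only: norm_sum_unitize)
  then show ?thesis
    by (simp add: real_le_rsqrt flip: real_sqrt_mult)
qed

section \<open>Endomorphisms are contractive\<close>

lemma star_endomorphism_simps:
  assumes "star_endomorphism f"
  shows "f (x + y) = f x + f y" "f (x * y) = f x * f y" "f (star x) = star (f x)" "f (c *\<^sub>C x) = c *\<^sub>C f x"
    "f (r *\<^sub>R x) = r *\<^sub>R f x" "f 0 = 0" "f (- x) = - f x" "f (x - y) = f x - f y"
proof -
  show add: "f (x + y) = f x + f y" for x y
    using assms by (simp add: star_endomorphism_def)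
  show "f (x * y) = f x * f y" "f (star x) = star (f x)" "f (c *\<^sub>C x) = c *\<^sub>C f x"
    using assms by (simp_all add: star_endomorphism_def)
  show "f (r *\<^sub>R x) = r *\<^sub>R f x"
    using assms by (simp add: star_endomorphism_def scaleR_scaleC)
  show zero: "f 0 = 0"
    using add[of 0 0] by simp
  show minus: "f (- x) = - f x" for x
    using add[of x "- x"] zero by (simp add: eq_neg_iff_add_eq_0 add.commute)
  show "f (x - y) = f x - f y"
    using add[of x "- y"] minus by simp
qed

text \<open>If \<open>1 - a\<^sup>2 = s\<^sup>2\<close> with a self-adjoint \<open>s\<close>, then \<open>1 - f(a)\<^sup>2\<close> is a square as well.\<close>

lemma norm_star_endomorphism_le:
  assumes f: "star_endomorphism f"
  shows "norm (f a) \<le> norm a"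
proof -
  note f_simps = star_endomorphism_simps[OF f]
  have 1: "norm (f a) \<le> 1" if a: "star a = a" "norm a < 1" for a
  proof -
    let ?x = "unitize (a * a)"
    have "norm (a * a) < 1"
      using a mult_strict_mono[of "norm a" 1 "norm a" 1] by (simp add: norm_selfadjoint_square)
    moreover have "star ?x = ?x"
      using a by (simp flip: unitize_star add: star_mult)
    ultimately obtain s where s: "star s = s" "s * s = 1 - ?x"
      using exists_sqrt_one_minus[of ?x] by (metis norm_unitize)
    define b \<sigma> where "b = base s" and "\<sigma> = scalar s"
    have "s = Unitization b \<sigma>"
      by (simp add: b_def \<sigma>_def)
    with s have b: "star b = b" "cnj \<sigma> = \<sigma>" "b * b + \<sigma> *\<^sub>C b + \<sigma> *\<^sub>C b = - (a * a)" "\<sigma> * \<sigma> = 1"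
      by (simp_all add: unitization_defs star_unitization_def unitize_def)
    \<comment> \<open>The image of \<open>s\<close> under the unital extension of \<open>f\<close>
      to the unitization.\<close>
    define t where "t = Unitization (f b) \<sigma>"
    have "star t = t"
      using b by (simp add: t_def star_unitization_def flip: f_simps)
    have "f b * f b + \<sigma> *\<^sub>C f b + \<sigma> *\<^sub>C f b = - (f a * f a)"
      using arg_cong[OF b(3), of f] by (simp add: f_simps)
    then have "t * t = 1 - unitize (f a * f a)"
      using b(4) by (simp add: t_def unitization_defs unitize_def)
    then have "is_positive (of_real 1 - unitize (f a * f a))"
      using positive_square[OF \<open>star t = t\<close>] by simp
    moreover have fa: "star (f a) = f a"
      using a by (simp flip: f_simps)
    then have "is_positive (unitize (f a * f a))"
      using positive_star_mult[of "unitize (f a)"] by (simp add: unitize_mult flip: unitize_star)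
    ultimately have "norm (f a * f a) \<le> 1"
      using norm_le_if_positive[of "unitize (f a * f a)" 1] by simp
    then show ?thesis
      using norm_selfadjoint_square[OF fa] by (metis norm_ge_zero power2_eq_square power2_le_imp_le one_power2 zero_le_one)
  qed
  have 2: "norm (f a) \<le> norm a" if a: "star a = a" for a
  proof (rule dense_ge)
    fix t assume t: "norm a < t"
    then have "0 < t" using norm_ge_zero le_less_trans by blast
    have "norm (f ((1 / t) *\<^sub>R a)) \<le> 1"
      by (rule 1) (use a t \<open>0 < t\<close> in auto)
    then show "norm (f a) \<le> t"
      using \<open>0 < t\<close> by (simp add: f_simps divide_simps)
  qed
  have "norm (f (star a * a)) \<le> norm (star a * a)"
    by (rule 2) (simp add: star_mult star_star)
  then have "(norm (f a))\<^sup>2 \<le> (norm a)\<^sup>2"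
    by (simp add: f_simps norm_star_mult_self)
  then show ?thesis
    by (rule power2_le_imp_le) simp
qed

section \<open>The Hilbert module of square-summable families\<close>

definition norm2 :: "'i set \<Rightarrow> ('i \<Rightarrow> 'a::cstar_algebra) \<Rightarrow> real" where
  "norm2 F f = sqrt (norm (\<Sum>i\<in>F. star (f i) * f i))"

lemma norm2_nonneg [simp]: "0 \<le> norm2 F f"
  by (simp add: norm2_def)

lemma norm2_power2: "(norm2 F f)\<^sup>2 = norm (\<Sum>i\<in>F. star (f i) * f i)"
  by (simp add: norm2_def)

lemma norm2_mono: "finite G \<Longrightarrow> F \<subseteq> G \<Longrightarrow> norm2 F f \<le> norm2 G f"
  by (simp add: norm2_def norm_sum_star_mult_mono)

lemma norm2_cong: "(\<And>i. i \<in> F \<Longrightarrow> f i = g i) \<Longrightarrow> norm2 F f = norm2 F g"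
  by (simp add: norm2_def cong: sum.cong)

lemma norm_sum_inner_le: "finite F \<Longrightarrow> norm (\<Sum>i\<in>F. star (f i) * g i) \<le> norm2 F f * norm2 F g"
  unfolding norm2_def by (rule Cauchy_Schwarz_sum)

lemma norm2_singleton [simp]: "norm2 {i} f = norm (f i)"
  by (simp add: norm2_def norm_star_mult_self)

lemma norm2_triangle:
  assumes "finite F"
  shows "norm2 F (\<lambda>i. f i + g i) \<le> norm2 F f + norm2 F g"
proof (rule power2_le_imp_le)
  let ?s = "\<lambda>f g. \<Sum>i\<in>F. star (f i) * g i"
  have "(norm2 F (\<lambda>i. f i + g i))\<^sup>2 = norm ((?s f f + ?s f g) + (?s g f + ?s g g))"
    by (simp add: norm2_power2 star_add algebra_simps sum.distrib)
  also have "\<dots> \<le> (norm (?s f f) + norm (?s f g)) + (norm (?s g f) + norm (?s g g))"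
    by (intro norm_triangle_le add_mono) (rule order_refl norm_triangle_ineq)+
  also have "\<dots> \<le> (norm2 F f * norm2 F f + norm2 F f * norm2 F g) + (norm2 F g * norm2 F f + norm2 F g * norm2 F g)"
    by (intro add_mono norm_sum_inner_le assms)
  also have "\<dots> = (norm2 F f + norm2 F g)\<^sup>2"
    by (simp add: power2_eq_square algebra_simps)
  finally show "(norm2 F (\<lambda>i. f i + g i))\<^sup>2 \<le> (norm2 F f + norm2 F g)\<^sup>2" .
qed simp

lemma norm2_mult_left:
  assumes "finite F" "\<And>i. i \<in> F \<Longrightarrow> norm (c i) \<le> r" "0 \<le> r"
  shows "norm2 F (\<lambda>i. c i * f i) \<le> r * norm2 F f"
proof (rule power2_le_imp_le)
  show "(norm2 F (\<lambda>i. c i * f i))\<^sup>2 \<le> (r * norm2 F f)\<^sup>2"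
    using norm_sum_mult_left_le[OF assms(1,2)] by (simp add: norm2_power2 power_mult_distrib)
qed (use assms in simp)

lemma norm2_scaleC: "norm2 F (\<lambda>i. c *\<^sub>C f i) = cmod c * norm2 F f"
proof (rule power2_eq_imp_eq)
  have "(\<Sum>i\<in>F. star (c *\<^sub>C f i) * (c *\<^sub>C f i)) = (\<Sum>i\<in>F. (c * cnj c) *\<^sub>C (star (f i) * f i))"
    by (simp add: star_scaleC mult_scaleC_left mult_scaleC_right scaleC_scaleC mult.commute)
  also have "\<dots> = (c * cnj c) *\<^sub>C (\<Sum>i\<in>F. star (f i) * f i)"
    by (simp add: linear_sum[OF bounded_linear.linear[OF bounded_linear_scaleC]])
  finally show "(norm2 F (\<lambda>i. c *\<^sub>C f i))\<^sup>2 = (cmod c * norm2 F f)\<^sup>2"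
    unfolding norm2_power2 power_mult_distrib
    by (simp add: norm_scaleC norm_mult power2_eq_square[of "cmod c"])
qed auto

lemma norm2_Un_le:
  assumes "finite F" "finite G"
  shows "norm2 (F \<union> G) f \<le> norm2 F f + norm2 G f"
proof -
  have "norm2 (F \<union> (G - F)) f \<le> norm2 F f + norm2 (G - F) f"
  proof (rule power2_le_imp_le)
    have "(norm2 (F \<union> (G - F)) f)\<^sup>2 \<le> (norm2 F f)\<^sup>2 + (norm2 (G - F) f)\<^sup>2"
      unfolding norm2_power2 using assms by (subst sum.union_disjoint) (auto intro: norm_triangle_ineq)
    also have "\<dots> \<le> (norm2 F f + norm2 (G - F) f)\<^sup>2"
      by (simp add: power2_eq_square algebra_simps)
    finally show "(norm2 (F \<union> (G - F)) f)\<^sup>2 \<le> (norm2 F f + norm2 (G - F) f)\<^sup>2" .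
  qed simp
  also have "norm2 (G - F) f \<le> norm2 G f"
    using assms by (intro norm2_mono) auto
  finally show ?thesis by simp
qed

text \<open>The Cauchy criterion for unordered norm convergence of the sum of
  \<open>star (f i) * f i\<close>, in general weaker than summability of the squared norms. Finite
  sets take the place of partial sums because the indices will be words.\<close>

definition square_summable :: "('i \<Rightarrow> 'a::cstar_algebra) \<Rightarrow> bool" where
  "square_summable f \<longleftrightarrow> (\<forall>e>0. \<exists>F. finite F \<and> (\<forall>G. finite G \<longrightarrow> G \<inter> F = {} \<longrightarrow> norm2 G f < e))"

lemma square_summableD:
  assumes "square_summable f" "e > 0"
  obtains F where "finite F" "\<And>G. finite G \<Longrightarrow> G \<inter> F = {} \<Longrightarrow> norm2 G f < e"
  using assms unfolding square_summable_def by blast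

lemma square_summable_comparison:
  assumes "square_summable f" "0 < r" "\<And>F. finite F \<Longrightarrow> norm2 F g \<le> r * norm2 F f"
  shows "square_summable g"
  unfolding square_summable_def
proof (intro allI impI)
  fix e :: real assume "e > 0"
  then have "e / r > 0" using assms(2) by simp
  then obtain F where F: "finite F" "\<And>G. finite G \<Longrightarrow> G \<inter> F = {} \<Longrightarrow> norm2 G f < e / r"
    using square_summableD assms(1) by blast
  have "norm2 G g < e" if "finite G" "G \<inter> F = {}" for G
    using F(2)[OF that] assms(3)[OF that(1)] assms(2) by (simp add: field_simps)
  then show "\<exists>F. finite F \<and> (\<forall>G. finite G \<longrightarrow> G \<inter> F = {} \<longrightarrow> norm2 G g < e)"
    using F(1) by blast
qed

lemma square_summable_add:
  assumes "square_summable f" "square_summable g"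
  shows "square_summable (\<lambda>i. f i + g i)"
  unfolding square_summable_def
proof (intro allI impI)
  fix e :: real assume "e > 0"
  then have "e / 2 > 0" by simp
  obtain F where F: "finite F" "\<And>G. finite G \<Longrightarrow> G \<inter> F = {} \<Longrightarrow> norm2 G f < e / 2"
    using square_summableD[OF assms(1) \<open>e / 2 > 0\<close>] by blast
  obtain F' where F': "finite F'" "\<And>G. finite G \<Longrightarrow> G \<inter> F' = {} \<Longrightarrow> norm2 G g < e / 2"
    using square_summableD[OF assms(2) \<open>e / 2 > 0\<close>] by blast
  have "norm2 G (\<lambda>i. f i + g i) < e" if "finite G" "G \<inter> (F \<union> F') = {}" for G
  proof -
    have "norm2 G f < e / 2" "norm2 G g < e / 2"
      by (rule F(2) F'(2); use that in auto)+
    then show ?thesis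
      using norm2_triangle[OF that(1), of f g] by linarith
  qed
  then show "\<exists>F. finite F \<and> (\<forall>G. finite G \<longrightarrow> G \<inter> F = {} \<longrightarrow> norm2 G (\<lambda>i. f i + g i) < e)"
    using F(1) F'(1) by (intro exI[of _ "F \<union> F'"]) auto
qed

lemma square_summable_finite_support:
  assumes "finite F" "\<And>i. i \<notin> F \<Longrightarrow> f i = 0"
  shows "square_summable f"
  unfolding square_summable_def
proof (intro allI impI exI[of _ F] conjI assms(1))
  fix e :: real and G :: "'a set" assume "e > 0" "finite G" "G \<inter> F = {}"
  then have "norm2 G f = norm2 G (\<lambda>_. 0 :: 'b)"
    using assms(2) by (intro norm2_cong) auto
  with \<open>e > 0\<close> show "norm2 G f < e"
    by (simp add: norm2_def)
qed

lemma square_summable_scaleC: "square_summable f \<Longrightarrow> square_summable (\<lambda>i. c *\<^sub>C f i)"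
  by (erule square_summable_comparison[of _ "cmod c + 1"])
    (auto simp: norm2_scaleC mult_right_mono add_nonneg_pos)

lemma square_summable_mult_left:
  "square_summable f \<Longrightarrow> (\<And>i. norm (c i) \<le> r) \<Longrightarrow> square_summable (\<lambda>i. c i * f i)"
  using norm_ge_zero[of "c undefined"]
  by (erule_tac square_summable_comparison[of _ "\<bar>r\<bar> + 1"], simp) (intro norm2_mult_left, auto intro: order_trans[of _ r])

lemma square_summable_uminus: "square_summable f \<Longrightarrow> square_summable (\<lambda>i. - f i)"
  using square_summable_scaleC[of f "- 1"] by simp

lemma square_summable_diff:
  "square_summable f \<Longrightarrow> square_summable g \<Longrightarrow> square_summable (\<lambda>i. f i - g i)"
  using square_summable_add[of f "\<lambda>i. - g i"] square_summable_uminus[of g] by simp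

lemma square_summable_bounded:
  assumes "square_summable f"
  obtains B where "0 < B" "\<And>F. finite F \<Longrightarrow> norm2 F f \<le> B"
proof -
  obtain F where F: "finite F" "\<And>G. finite G \<Longrightarrow> G \<inter> F = {} \<Longrightarrow> norm2 G f < 1"
    using square_summableD[OF assms, of 1] by auto
  have "norm2 G f \<le> norm2 F f + 1" if "finite G" for G
  proof -
    have "norm2 G f \<le> norm2 (F \<union> (G - F)) f"
      using that F by (intro norm2_mono) auto
    also have "\<dots> \<le> norm2 F f + norm2 (G - F) f"
      using that F by (intro norm2_Un_le) auto
    also have "norm2 (G - F) f < 1"
      using that by (intro F) auto
    finally show ?thesis by simp
  qed
  then show ?thesis
    using that[of "norm2 F f + 1"] by (simp add: add_nonneg_pos)
qed

lemma summable_on_UNIV_Cauchy: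
  fixes f :: "'i \<Rightarrow> 'b::banach"
  assumes "\<And>e. e > 0 \<Longrightarrow> \<exists>F. finite F \<and> (\<forall>G. finite G \<longrightarrow> G \<inter> F = {} \<longrightarrow> norm (sum f G) < e)"
  shows "f summable_on UNIV"
proof -
  have "\<exists>P. eventually P (finite_subsets_at_top UNIV) \<and> (\<forall>F F'. P F \<and> P F' \<longrightarrow> dist (sum f F) (sum f F') < e)"
    if "e > 0" for e
  proof -
    obtain F where F: "finite F" "\<And>G. finite G \<Longrightarrow> G \<inter> F = {} \<Longrightarrow> norm (sum f G) < e / 2"
      using assms[of "e / 2"] \<open>e > 0\<close> by auto
    have "norm (sum f G - sum f F) < e / 2" if "finite G" "F \<subseteq> G" for G
      using F that by (subst sum_diff[symmetric]) auto
    then have "dist (sum f G) (sum f G') < e" if "finite G \<and> F \<subseteq> G" "finite G' \<and> F \<subseteq> G'" for G G'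
      using that by (metis dist_norm dist_triangle_half_l)
    then show ?thesis
      using F(1) by (intro exI[of _ "\<lambda>G. finite G \<and> F \<subseteq> G"]) (auto simp: eventually_finite_subsets_at_top)
  qed
  then have "cauchy_filter (filtermap (sum f) (finite_subsets_at_top UNIV))"
    by (simp add: cauchy_filter_metric_filtermap)
  moreover have "complete (UNIV :: 'b set)"
    by (meson Cauchy_convergent UNIV_I complete_def convergent_def)
  ultimately obtain L where "(sum f \<longlongrightarrow> L) (finite_subsets_at_top UNIV)"
    using complete_uniform[where S = UNIV] by (force simp: filterlim_def)
  then show ?thesis
    using summable_on_def has_sum_def by blast
qed

lemma summable_on_inner:
  assumes "square_summable f" "square_summable g"
  shows "(\<lambda>i. star (f i) * g i) summable_on UNIV"
proof (rule summable_on_UNIV_Cauchy)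
  fix e :: real assume "e > 0"
  obtain B where B: "0 < B" "\<And>F. finite F \<Longrightarrow> norm2 F g \<le> B"
    using square_summable_bounded assms(2) by blast
  have "e / B > 0" using B \<open>e > 0\<close> by simp
  then obtain F where F: "finite F" "\<And>G. finite G \<Longrightarrow> G \<inter> F = {} \<Longrightarrow> norm2 G f < e / B"
    using square_summableD assms(1) by blast
  have "norm (\<Sum>i\<in>G. star (f i) * g i) < e" if "finite G" "G \<inter> F = {}" for G
  proof -
    have "norm (\<Sum>i\<in>G. star (f i) * g i) \<le> norm2 G f * norm2 G g"
      by (rule norm_sum_inner_le[OF that(1)])
    also have "\<dots> \<le> norm2 G f * B"
      using B that by (intro mult_left_mono) auto
    also have "\<dots> < e"
      using F(2)[OF that] B by (simp add: field_simps)
    finally show ?thesis .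
  qed
  then show "\<exists>F. finite F \<and> (\<forall>G. finite G \<longrightarrow> G \<inter> F = {} \<longrightarrow> norm (\<Sum>i\<in>G. star (f i) * g i) < e)"
    using F(1) by blast
qed

section \<open>The Hilbert module as a Banach space\<close>

typedef (overloaded) ('i, 'a) l2 = "{f :: 'i \<Rightarrow> 'a::cstar_algebra. square_summable f}"
  morphisms l2_nth Abs_l2
  using square_summable_finite_support[of "{}" "\<lambda>_. 0"] by auto

setup_lifting type_definition_l2

lemma square_summable_l2_nth [simp]: "square_summable (l2_nth f)"
  using l2_nth by simp

lemma l2_eqI: "(\<And>i. l2_nth f i = l2_nth g i) \<Longrightarrow> f = g"
  by (simp add: l2_nth_inject[symmetric] fun_eq_iff)

definition l2_inner :: "('i, 'a::cstar_algebra) l2 \<Rightarrow> ('i, 'a) l2 \<Rightarrow> 'a" where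
  "l2_inner f g = infsum (\<lambda>i. star (l2_nth f i) * l2_nth g i) UNIV"

lemma has_sum_l2_inner: "((\<lambda>i. star (l2_nth f i) * l2_nth g i) has_sum l2_inner f g) UNIV"
  unfolding l2_inner_def by (intro has_sum_infsum summable_on_inner) auto

lift_definition l2_scaleC :: "complex \<Rightarrow> ('i, 'a::cstar_algebra) l2 \<Rightarrow> ('i, 'a) l2" is "\<lambda>c f i. c *\<^sub>C f i"
  by (rule square_summable_scaleC)

lift_definition l2_single :: "'i \<Rightarrow> 'a \<Rightarrow> ('i, 'a::cstar_algebra) l2" is "\<lambda>i a j. if j = i then a else 0"
  by (rule square_summable_finite_support[of "{_}"]) auto

instantiation l2 :: (type, cstar_algebra) real_normed_vector
begin

lift_definition zero_l2 :: "('a, 'b) l2" is "\<lambda>_. 0"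
  using square_summable_finite_support[of "{}" "\<lambda>_. 0"] by simp

lift_definition plus_l2 :: "('a, 'b) l2 \<Rightarrow> ('a, 'b) l2 \<Rightarrow> ('a, 'b) l2" is "\<lambda>f g i. f i + g i"
  by (rule square_summable_add)

lift_definition minus_l2 :: "('a, 'b) l2 \<Rightarrow> ('a, 'b) l2 \<Rightarrow> ('a, 'b) l2" is "\<lambda>f g i. f i - g i"
  by (rule square_summable_diff)

lift_definition uminus_l2 :: "('a, 'b) l2 \<Rightarrow> ('a, 'b) l2" is "\<lambda>f i. - f i"
  by (rule square_summable_uminus)

lift_definition scaleR_l2 :: "real \<Rightarrow> ('a, 'b) l2 \<Rightarrow> ('a, 'b) l2" is "\<lambda>r f i. r *\<^sub>R f i"
  unfolding scaleR_scaleC by (rule square_summable_scaleC)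

definition "norm f = sqrt (norm (l2_inner f f))" for f :: "('a, 'b) l2"
definition "dist f g = norm (f - g)" for f g :: "('a, 'b) l2"
definition "sgn f = scaleR (inverse (norm f)) f" for f :: "('a, 'b) l2"
definition "uniformity = (INF e\<in>{0 <..}. principal {(f, g :: ('a, 'b) l2). dist f g < e})"
definition "open U \<longleftrightarrow> (\<forall>x\<in>U. \<forall>\<^sub>F (x', y) in uniformity. x' = x \<longrightarrow> y \<in> U)" for U :: "('a, 'b) l2 set"

lemma tendsto_norm2: "((\<lambda>F. norm2 F (l2_nth f)) \<longlongrightarrow> norm f) (finite_subsets_at_top UNIV)"
  unfolding norm2_def norm_l2_def using has_sum_l2_inner[of f f]
  by (intro tendsto_real_sqrt tendsto_norm) (simp add: has_sum_def)

lemma norm2_le_norm: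
  assumes "finite F"
  shows "norm2 F (l2_nth f) \<le> norm f"
proof (rule tendsto_lowerbound[OF tendsto_norm2])
  show "\<forall>\<^sub>F G in finite_subsets_at_top UNIV. norm2 F (l2_nth f) \<le> norm2 G (l2_nth f)"
    unfolding eventually_finite_subsets_at_top using assms by (auto intro!: exI[of _ F] norm2_mono)
qed simp

lemma norm_l2_le:
  assumes "\<And>F. finite F \<Longrightarrow> norm2 F (l2_nth f) \<le> B"
  shows "norm f \<le> B"
  by (rule tendsto_upperbound[OF tendsto_norm2]) (auto intro!: eventually_finite_subsets_at_top_weakI assms)

instance
proof
  fix f g h :: "('a, 'b) l2" and r s :: real
  show "f + g + h = f + (g + h)" "f + g = g + f" "0 + f = f" "- f + f = 0" "f - g = f + - g"
    by (transfer; simp add: algebra_simps)+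
  show "r *\<^sub>R (f + g) = r *\<^sub>R f + r *\<^sub>R g" "(r + s) *\<^sub>R f = r *\<^sub>R f + s *\<^sub>R f"
    "r *\<^sub>R s *\<^sub>R f = (r * s) *\<^sub>R f" "1 *\<^sub>R f = f"
    by (transfer; simp add: algebra_simps)+
  show "dist f g = norm (f - g)" "sgn f = inverse (norm f) *\<^sub>R f"
    by (simp_all add: dist_l2_def sgn_l2_def)
  show "(uniformity :: (('a, 'b) l2 \<times> ('a, 'b) l2) filter) = (INF e\<in>{0 <..}. principal {(x, y). dist x y < e})"
    by (rule uniformity_l2_def)
  show "open U \<longleftrightarrow> (\<forall>x\<in>U. \<forall>\<^sub>F (x', y) in uniformity. x' = x \<longrightarrow> y \<in> U)" for U :: "('a, 'b) l2 set"
    by (rule open_l2_def)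
  show "norm f = 0 \<longleftrightarrow> f = 0"
  proof
    assume "norm f = 0"
    then have "norm (l2_nth f i) = 0" for i
      using norm2_le_norm[of "{i}" f] by simp
    then show "f = 0"
      by (intro l2_eqI) (simp add: zero_l2.rep_eq)
  next
    assume "f = 0"
    then show "norm f = 0"
      by (simp add: norm_l2_def l2_inner_def zero_l2.rep_eq)
  qed
  show "norm (f + g) \<le> norm f + norm g"
  proof (rule norm_l2_le)
    fix F :: "'a set" assume "finite F"
    then have "norm2 F (l2_nth (f + g)) \<le> norm2 F (l2_nth f) + norm2 F (l2_nth g)"
      unfolding plus_l2.rep_eq by (rule norm2_triangle)
    also have "\<dots> \<le> norm f + norm g"
      using \<open>finite F\<close> by (intro add_mono norm2_le_norm)
    finally show "norm2 F (l2_nth (f + g)) \<le> norm f + norm g" .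
  qed
  have "((\<lambda>F. norm2 F (l2_nth (r *\<^sub>R f))) \<longlongrightarrow> \<bar>r\<bar> * norm f) (finite_subsets_at_top UNIV)"
    unfolding scaleR_l2.rep_eq scaleR_scaleC norm2_scaleC norm_of_real
    by (intro tendsto_mult tendsto_const tendsto_norm2)
  then show "norm (r *\<^sub>R f) = \<bar>r\<bar> * norm f"
    using tendsto_norm2 tendsto_unique finite_subsets_at_top_neq_bot by blast
qed

end

lemma norm_l2_nth_le: "norm (l2_nth f i) \<le> norm f"
  using norm2_le_norm[of "{i}" f] by simp

lemma tendsto_l2_nth: "X \<longlonglongrightarrow> f \<Longrightarrow> (\<lambda>n. l2_nth (X n) i) \<longlonglongrightarrow> l2_nth f i"
  by (rule bounded_linear.tendsto[OF bounded_linear_intro[where K = 1]])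
    (auto simp: plus_l2.rep_eq scaleR_l2.rep_eq norm_l2_nth_le)

instance l2 :: (type, cstar_algebra) complete_space
proof
  fix X :: "nat \<Rightarrow> ('a, 'b) l2"
  assume X: "Cauchy X"
  have "Cauchy (\<lambda>n. l2_nth (X n) i)" for i
    using X unfolding Cauchy_def dist_norm
    by (metis minus_l2.rep_eq norm_l2_nth_le le_less_trans)
  then have "(\<lambda>n. l2_nth (X n) i) \<longlonglongrightarrow> lim (\<lambda>n. l2_nth (X n) i)" for i
    using Cauchy_convergent convergent_LIMSEQ_iff by blast
  moreover define f where "f i = lim (\<lambda>n. l2_nth (X n) i)" for i
  ultimately have f: "(\<lambda>n. l2_nth (X n) i) \<longlonglongrightarrow> f i" for i
    by simp
  have tail: "\<exists>N. \<forall>n\<ge>N. \<forall>F. finite F \<longrightarrow> norm2 F (\<lambda>i. f i - l2_nth (X n) i) \<le> e" if "e > 0" for e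
  proof -
    obtain N where N: "\<And>m n. m \<ge> N \<Longrightarrow> n \<ge> N \<Longrightarrow> norm (X m - X n) < e"
      using CauchyD[OF X \<open>e > 0\<close>] by blast
    have "norm2 F (\<lambda>i. f i - l2_nth (X n) i) \<le> e" if "n \<ge> N" "finite F" for n F
    proof (rule tendsto_upperbound)
      show "(\<lambda>m. norm2 F (\<lambda>i. l2_nth (X m) i - l2_nth (X n) i)) \<longlonglongrightarrow> norm2 F (\<lambda>i. f i - l2_nth (X n) i)"
        unfolding norm2_def
        by (intro tendsto_real_sqrt tendsto_norm tendsto_sum tendsto_mult tendsto_star tendsto_diff f tendsto_const)
      show "\<forall>\<^sub>F m in sequentially. norm2 F (\<lambda>i. l2_nth (X m) i - l2_nth (X n) i) \<le> e"
        unfolding eventually_sequentially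
      proof (intro exI[of _ N] allI impI)
        fix m assume "N \<le> m"
        have "norm2 F (\<lambda>i. l2_nth (X m) i - l2_nth (X n) i) \<le> norm (X m - X n)"
          using norm2_le_norm[OF that(2), of "X m - X n"] by (simp add: minus_l2.rep_eq)
        with N[OF \<open>N \<le> m\<close> that(1)] show "norm2 F (\<lambda>i. l2_nth (X m) i - l2_nth (X n) i) \<le> e"
          by simp
      qed
    qed simp
    then show ?thesis by blast
  qed
  have "square_summable f"
    unfolding square_summable_def
  proof (intro allI impI)
    fix e :: real assume "e > 0"
    then obtain n where n: "\<And>F. finite F \<Longrightarrow> norm2 F (\<lambda>i. f i - l2_nth (X n) i) \<le> e / 2"
      using tail[of "e / 2"] by auto
    obtain F where F: "finite F" "\<And>G. finite G \<Longrightarrow> G \<inter> F = {} \<Longrightarrow> norm2 G (l2_nth (X n)) < e / 2"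
      using square_summableD[of "l2_nth (X n)" "e / 2"] \<open>e > 0\<close> by auto
    have "norm2 G f < e" if "finite G" "G \<inter> F = {}" for G
    proof -
      have "norm2 G f \<le> norm2 G (\<lambda>i. f i - l2_nth (X n) i) + norm2 G (l2_nth (X n))"
        using norm2_triangle[OF that(1), of "\<lambda>i. f i - l2_nth (X n) i" "l2_nth (X n)"] by simp
      then show ?thesis
        using n[OF that(1)] F(2)[OF that] by linarith
    qed
    then show "\<exists>F. finite F \<and> (\<forall>G. finite G \<longrightarrow> G \<inter> F = {} \<longrightarrow> norm2 G f < e)"
      using F(1) by blast
  qed
  then have nth: "l2_nth (Abs_l2 f) = f"
    by (simp add: Abs_l2_inverse)
  have "X \<longlonglongrightarrow> Abs_l2 f"
    unfolding lim_sequentially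
  proof (intro allI impI)
    fix e :: real assume "e > 0"
    then obtain N where N: "\<And>n F. n \<ge> N \<Longrightarrow> finite F \<Longrightarrow> norm2 F (\<lambda>i. f i - l2_nth (X n) i) \<le> e / 2"
      using tail[of "e / 2"] by auto
    have "dist (X n) (Abs_l2 f) < e" if "n \<ge> N" for n
    proof -
      have "norm (Abs_l2 f - X n) \<le> e / 2"
        using N[OF that] by (intro norm_l2_le) (simp add: minus_l2.rep_eq nth)
      then show ?thesis
        using \<open>e > 0\<close> by (simp add: dist_norm norm_minus_commute)
    qed
    then show "\<exists>N. \<forall>n\<ge>N. dist (X n) (Abs_l2 f) < e"
      by blast
  qed
  then show "convergent X"
    by (rule convergentI)
qed

instance l2 :: (type, cstar_algebra) banach ..

lemma norm_l2_inner_le: "norm (l2_inner f g) \<le> norm f * norm g"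
proof (rule tendsto_upperbound)
  show "((\<lambda>F. norm (\<Sum>i\<in>F. star (l2_nth f i) * l2_nth g i)) \<longlongrightarrow> norm (l2_inner f g)) (finite_subsets_at_top UNIV)"
    using has_sum_l2_inner[of f g] by (intro tendsto_norm) (simp add: has_sum_def)
  have "norm (\<Sum>i\<in>F. star (l2_nth f i) * l2_nth g i) \<le> norm f * norm g" if "finite F" for F
    using norm_sum_inner_le[OF that, of "l2_nth f" "l2_nth g"] norm2_le_norm[OF that, of f] norm2_le_norm[OF that, of g]
    by (meson mult_mono norm2_nonneg norm_ge_zero order_trans)
  then show "\<forall>\<^sub>F F in finite_subsets_at_top UNIV. norm (\<Sum>i\<in>F. star (l2_nth f i) * l2_nth g i) \<le> norm f * norm g"
    by (intro eventually_finite_subsets_at_top_weakI)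
qed simp

lemma norm_l2_power2: "(norm f)\<^sup>2 = norm (l2_inner f f)"
  by (simp add: norm_l2_def)

lemma l2_inner_eqI: "((\<lambda>i. star (l2_nth f i) * l2_nth g i) has_sum s) UNIV \<Longrightarrow> l2_inner f g = s"
  using has_sum_l2_inner has_sum_unique by blast

lemma l2_inner_add_left: "l2_inner (f + g) h = l2_inner f h + l2_inner g h"
  by (rule l2_inner_eqI)
    (simp add: plus_l2.rep_eq star_add distrib_right has_sum_add has_sum_l2_inner)

lemma l2_inner_add_right: "l2_inner f (g + h) = l2_inner f g + l2_inner f h"
  by (rule l2_inner_eqI)
    (simp add: plus_l2.rep_eq distrib_left has_sum_add has_sum_l2_inner)

lemma l2_inner_scaleC_right: "l2_inner f (l2_scaleC c g) = c *\<^sub>C l2_inner f g"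
  by (rule l2_inner_eqI)
    (simp add: l2_scaleC.rep_eq mult_scaleC_right has_sum_bounded_linear[OF bounded_linear_scaleC] has_sum_l2_inner)

lemma l2_inner_scaleC_left: "l2_inner (l2_scaleC c f) g = cnj c *\<^sub>C l2_inner f g"
  by (rule l2_inner_eqI)
    (simp add: l2_scaleC.rep_eq star_scaleC mult_scaleC_left has_sum_bounded_linear[OF bounded_linear_scaleC] has_sum_l2_inner)

lemma l2_scaleC_of_real: "l2_scaleC (of_real r) f = r *\<^sub>R f"
  by transfer (simp add: scaleR_scaleC)

lemma star_l2_inner: "star (l2_inner f g) = l2_inner g f"
  by (rule sym, rule l2_inner_eqI)
    (use has_sum_bounded_linear[OF bounded_linear_star has_sum_l2_inner[of f g]] in
      \<open>simp add: star_mult star_star\<close>)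

lemma bounded_bilinear_l2_inner: "bounded_bilinear (l2_inner :: ('i, 'a::cstar_algebra) l2 \<Rightarrow> _)"
proof
  fix f f' g g' :: "('i, 'a) l2" and r :: real
  show "l2_inner (f + f') g = l2_inner f g + l2_inner f' g" "l2_inner f (g + g') = l2_inner f g + l2_inner f g'"
    by (rule l2_inner_add_left l2_inner_add_right)+
  show "l2_inner (r *\<^sub>R f) g = r *\<^sub>R l2_inner f g" "l2_inner f (r *\<^sub>R g) = r *\<^sub>R l2_inner f g"
    by (simp_all flip: l2_scaleC_of_real add: l2_inner_scaleC_left l2_inner_scaleC_right scaleR_scaleC)
  show "\<exists>K. \<forall>f g. norm (l2_inner f g :: 'a) \<le> norm f * norm g * K"
    by (intro exI[of _ 1]) (simp add: norm_l2_inner_le)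
qed

interpretation l2_inner: bounded_bilinear l2_inner
  by (rule bounded_bilinear_l2_inner)

lemma l2_inner_single_left: "l2_inner (l2_single i a) f = star a * l2_nth f i"
proof (rule l2_inner_eqI)
  have "((\<lambda>j. star (l2_nth (l2_single i a) j) * l2_nth f j) has_sum
      (\<Sum>j\<in>{i}. star (l2_nth (l2_single i a) j) * l2_nth f j)) UNIV"
    by (rule has_sum_finite_neutralI[where B = "{i}"]) (auto simp: l2_single.rep_eq)
  then show "((\<lambda>j. star (l2_nth (l2_single i a) j) * l2_nth f j) has_sum star a * l2_nth f i) UNIV"
    by (simp add: l2_single.rep_eq)
qed

lemma norm_l2_single [simp]: "norm (l2_single i a) = norm a"
  by (simp add: norm_l2_def l2_inner_single_left l2_single.rep_eq norm_star_mult_self)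

lemma l2_scaleC_linear: "bounded_linear (l2_scaleC c :: ('i, 'a::cstar_algebra) l2 \<Rightarrow> _)"
proof (rule bounded_linear_intro[where K = "cmod c"])
  fix f g :: "('i, 'a) l2" and r :: real
  show "l2_scaleC c (f + g) = l2_scaleC c f + l2_scaleC c g" "l2_scaleC c (r *\<^sub>R f) = r *\<^sub>R l2_scaleC c f"
    by (transfer; simp add: scaleC_add_right scaleC_scaleR)+
  have "(norm (l2_scaleC c f))\<^sup>2 = (norm f * cmod c)\<^sup>2"
    by (simp add: norm_l2_power2 l2_inner_scaleC_left l2_inner_scaleC_right scaleC_scaleC norm_scaleC
        norm_mult power_mult_distrib) (simp add: power2_eq_square)
  then show "norm (l2_scaleC c f) \<le> norm f * cmod c"
    by (simp add: power2_eq_iff_nonneg)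
qed

lemma l2_zero_if_inner_zero:
  assumes "\<And>g. l2_inner g f = 0"
  shows "f = 0"
  using assms[of f] by (metis norm_eq_zero norm_l2_power2 power_eq_0_iff norm_zero)

text \<open>The finite truncations \<open>P F\<close> converge to \<open>f\<close> by
  square-summability. Scalars are covered by admitting \<open>l2_single i a\<close> for every
  \<open>a\<close>.\<close>

lemma l2_induct [consumes 1, case_names zero add single]:
  assumes "closed S" "0 \<in> S" "\<And>f g. f \<in> S \<Longrightarrow> g \<in> S \<Longrightarrow> f + g \<in> S" "\<And>i a. l2_single i a \<in> S"
  shows "f \<in> S"
proof -
  define P where "P F = (\<Sum>i\<in>F. l2_single i (l2_nth f i))" for F
  have "P F \<in> S" if "finite F" for F
    using that unfolding P_def by induction (auto intro: assms)
  moreover have "\<exists>F. finite F \<and> dist (P F) f < e" if "e > 0" for e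
  proof -
    obtain F where F: "finite F" "\<And>G. finite G \<Longrightarrow> G \<inter> F = {} \<Longrightarrow> norm2 G (l2_nth f) < e / 2"
      using square_summableD[of "l2_nth f" "e / 2"] \<open>e > 0\<close> by auto
    have nth_sum: "l2_nth (\<Sum>i\<in>F. g i) j = (\<Sum>i\<in>F. l2_nth (g i) j)" for g :: "'a \<Rightarrow> ('a, 'b) l2" and j
      by (induction F rule: infinite_finite_induct) (auto simp: zero_l2.rep_eq plus_l2.rep_eq)
    have nth: "l2_nth (f - P F) j = (if j \<in> F then 0 else l2_nth f j)" for j
      using F(1) by (simp add: minus_l2.rep_eq P_def nth_sum l2_single.rep_eq if_distrib cong: if_cong)
    have "norm (f - P F) \<le> e / 2"
    proof (rule norm_l2_le)
      fix G :: "'a set" assume "finite G"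
      have "norm2 G (l2_nth (f - P F)) \<le> norm2 (G - F) (l2_nth (f - P F)) + norm2 (G \<inter> F) (l2_nth (f - P F))"
        using norm2_Un_le[of "G - F" "G \<inter> F"] \<open>finite G\<close> by (simp add: Un_Diff_Int)
      also have "norm2 (G \<inter> F) (l2_nth (f - P F)) = 0"
        by (simp add: norm2_def nth)
      also have "norm2 (G - F) (l2_nth (f - P F)) = norm2 (G - F) (l2_nth f)"
        by (rule norm2_cong) (simp add: nth)
      also have "\<dots> < e / 2"
        using \<open>finite G\<close> by (intro F) auto
      finally show "norm2 G (l2_nth (f - P F)) \<le> e / 2" by simp
    qed
    then have "dist (P F) f < e"
      using \<open>e > 0\<close> by (simp add: dist_norm norm_minus_commute)
    with F(1) show ?thesis by blast
  qed
  ultimately have "f \<in> closure S"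
    by (metis closure_approachable)
  with assms(1) show ?thesis by simp
qed

section \<open>Adjointable operators\<close>

definition blinfun_adjoint ::
  "(('i, 'a::cstar_algebra) l2 \<Rightarrow>\<^sub>L ('i, 'a) l2) \<Rightarrow> (('i, 'a) l2 \<Rightarrow>\<^sub>L ('i, 'a) l2) \<Rightarrow> bool" where
  "blinfun_adjoint T S \<longleftrightarrow> (\<forall>f g. l2_inner (T f) g = l2_inner f (S g))"

lemma blinfun_adjointD: "blinfun_adjoint T S \<Longrightarrow> l2_inner (T f) g = l2_inner f (S g)"
  by (simp add: blinfun_adjoint_def)

lemma blinfun_adjoint_sym: "blinfun_adjoint T S \<Longrightarrow> blinfun_adjoint S T"
  unfolding blinfun_adjoint_def by (metis star_l2_inner)

text \<open>Applied to differences, this makes the adjoints of a Cauchy sequence a Cauchy sequence,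
  on which the completeness of \<open>lop\<close> rests.\<close>

lemma norm_blinfun_adjoint_le:
  assumes "blinfun_adjoint T S"
  shows "norm S \<le> norm T"
proof (rule norm_blinfun_bound)
  fix g
  have "norm (S g) * norm (S g) = norm (l2_inner (T (S g)) g)"
    using blinfun_adjointD[OF assms, of "S g" g] norm_l2_power2[of "S g"] by (simp add: power2_eq_square)
  also have "\<dots> \<le> norm (T (S g)) * norm g"
    by (rule norm_l2_inner_le)
  also have "\<dots> \<le> (norm T * norm (S g)) * norm g"
    by (intro mult_right_mono norm_blinfun) simp
  finally have "norm (S g) * norm (S g) \<le> norm (S g) * (norm T * norm g)"
    by (simp add: mult_ac)
  then show "norm (S g) \<le> norm T * norm g"
    by (cases "norm (S g) = 0") auto
qed simp

definition l2_scaleC_blinfun :: "complex \<Rightarrow> ('i, 'a::cstar_algebra) l2 \<Rightarrow>\<^sub>L ('i, 'a) l2" where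
  "l2_scaleC_blinfun c = Blinfun (l2_scaleC c)"

lemma l2_scaleC_blinfun_apply [simp]: "blinfun_apply (l2_scaleC_blinfun c) f = l2_scaleC c f"
  by (simp add: l2_scaleC_blinfun_def bounded_linear_Blinfun_apply l2_scaleC_linear)

lemma blinfun_adjoint_intros:
  assumes "blinfun_adjoint T S" "blinfun_adjoint T' S'"
  shows "blinfun_adjoint 0 0" "blinfun_adjoint (T + T') (S + S')" "blinfun_adjoint (T - T') (S - S')"
    "blinfun_adjoint (- T) (- S)" "blinfun_adjoint (T o\<^sub>L T') (S' o\<^sub>L S)" "blinfun_adjoint (r *\<^sub>R T) (r *\<^sub>R S)"
    "blinfun_adjoint (l2_scaleC_blinfun c o\<^sub>L T) (l2_scaleC_blinfun (cnj c) o\<^sub>L S)"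
  using assms unfolding blinfun_adjoint_def
  by (simp_all add: blinfun.bilinear_simps l2_inner.bilinear_simps
      l2_inner_scaleC_left l2_inner_scaleC_right)

text \<open>A bounded operator on a Hilbert module need not have an adjoint, so its existence is
  built into the type.\<close>

typedef (overloaded) ('i, 'a) lop = "{T :: ('i, 'a::cstar_algebra) l2 \<Rightarrow>\<^sub>L ('i, 'a) l2. \<exists>S. blinfun_adjoint T S}"
  morphisms lop_blinfun Abs_lop
  by (intro exI[of _ 0]) (auto simp: blinfun_adjoint_def l2_inner.bilinear_simps intro!: exI[of _ 0])

setup_lifting type_definition_lop

definition lop_apply :: "('i, 'a::cstar_algebra) lop \<Rightarrow> ('i, 'a) l2 \<Rightarrow> ('i, 'a) l2"  (infixr "\<bullet>\<^sub>o" 75) where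
  "T \<bullet>\<^sub>o f = blinfun_apply (lop_blinfun T) f"

lemma lop_eqI: "(\<And>f. S \<bullet>\<^sub>o f = T \<bullet>\<^sub>o f) \<Longrightarrow> S = T"
  unfolding lop_apply_def by (metis blinfun_eqI lop_blinfun_inject)

instantiation lop :: (type, cstar_algebra) real_normed_algebra
begin

lift_definition zero_lop :: "('a, 'b) lop" is 0
  by (rule exI[of _ 0]) (simp add: blinfun_adjoint_def l2_inner.bilinear_simps)

lift_definition plus_lop :: "('a, 'b) lop \<Rightarrow> ('a, 'b) lop \<Rightarrow> ('a, 'b) lop" is "(+)"
  using blinfun_adjoint_intros(2) by blast

lift_definition minus_lop :: "('a, 'b) lop \<Rightarrow> ('a, 'b) lop \<Rightarrow> ('a, 'b) lop" is "(-)"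
  using blinfun_adjoint_intros(3) by blast

lift_definition uminus_lop :: "('a, 'b) lop \<Rightarrow> ('a, 'b) lop" is uminus
  using blinfun_adjoint_intros(4) by blast

lift_definition times_lop :: "('a, 'b) lop \<Rightarrow> ('a, 'b) lop \<Rightarrow> ('a, 'b) lop" is "(o\<^sub>L)"
  using blinfun_adjoint_intros(5) by blast

lift_definition scaleR_lop :: "real \<Rightarrow> ('a, 'b) lop \<Rightarrow> ('a, 'b) lop" is scaleR
  using blinfun_adjoint_intros(6) by blast

lift_definition norm_lop :: "('a, 'b) lop \<Rightarrow> real" is norm .

definition "dist S T = norm (S - T)" for S T :: "('a, 'b) lop"
definition "sgn T = scaleR (inverse (norm T)) T" for T :: "('a, 'b) lop"
definition "uniformity = (INF e\<in>{0 <..}. principal {(S, T :: ('a, 'b) lop). dist S T < e})"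
definition "open U \<longleftrightarrow> (\<forall>x\<in>U. \<forall>\<^sub>F (x', y) in uniformity. x' = x \<longrightarrow> y \<in> U)" for U :: "('a, 'b) lop set"

instance
proof
  fix R S T :: "('a, 'b) lop" and r s :: real
  show "R + S + T = R + (S + T)" "R + S = S + R" "0 + S = S" "- S + S = 0" "S - T = S + - T"
    "r *\<^sub>R (S + T) = r *\<^sub>R S + r *\<^sub>R T" "(r + s) *\<^sub>R S = r *\<^sub>R S + s *\<^sub>R S"
    "r *\<^sub>R s *\<^sub>R S = (r * s) *\<^sub>R S" "1 *\<^sub>R S = S"
    by (transfer; simp add: algebra_simps)+
  show "R * S * T = R * (S * T)" "(R + S) * T = R * T + S * T" "R * (S + T) = R * S + R * T"
    "r *\<^sub>R S * T = r *\<^sub>R (S * T)" "S * r *\<^sub>R T = r *\<^sub>R (S * T)"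
    by (transfer; auto intro!: blinfun_eqI simp: blinfun.bilinear_simps)+
  show "dist S T = norm (S - T)" "sgn S = inverse (norm S) *\<^sub>R S"
    by (simp_all add: dist_lop_def sgn_lop_def)
  show "(uniformity :: (('a, 'b) lop \<times> ('a, 'b) lop) filter) = (INF e\<in>{0 <..}. principal {(x, y). dist x y < e})"
    by (rule uniformity_lop_def)
  show "open U \<longleftrightarrow> (\<forall>x\<in>U. \<forall>\<^sub>F (x', y) in uniformity. x' = x \<longrightarrow> y \<in> U)" for U :: "('a, 'b) lop set"
    by (rule open_lop_def)
  show "norm S = 0 \<longleftrightarrow> S = 0" "norm (S + T) \<le> norm S + norm T" "norm (r *\<^sub>R S) = \<bar>r\<bar> * norm S"
    "norm (S * T) \<le> norm S * norm T"
    by (transfer; simp add: norm_triangle_ineq norm_blinfun_compose)+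
qed

end

lemma lop_apply_simps [simp]:
  "(0 :: ('i, 'a::cstar_algebra) lop) \<bullet>\<^sub>o f = 0" "(S + T) \<bullet>\<^sub>o f = S \<bullet>\<^sub>o f + T \<bullet>\<^sub>o f"
  "(S - T) \<bullet>\<^sub>o f = S \<bullet>\<^sub>o f - T \<bullet>\<^sub>o f" "(- S) \<bullet>\<^sub>o f = - (S \<bullet>\<^sub>o f)"
  "(S * T) \<bullet>\<^sub>o f = S \<bullet>\<^sub>o T \<bullet>\<^sub>o f" "(r *\<^sub>R S) \<bullet>\<^sub>o f = r *\<^sub>R (S \<bullet>\<^sub>o f)"
  by (simp_all add: lop_apply_def zero_lop.rep_eq plus_lop.rep_eq minus_lop.rep_eq uminus_lop.rep_eq
      times_lop.rep_eq scaleR_lop.rep_eq blinfun.bilinear_simps)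

lemma bounded_linear_lop_apply: "bounded_linear (\<lambda>f. S \<bullet>\<^sub>o f)"
  unfolding lop_apply_def by (rule blinfun.bounded_linear_right)

lemma lop_apply_right_simps [simp]:
  "S \<bullet>\<^sub>o 0 = 0" "S \<bullet>\<^sub>o (f + g) = S \<bullet>\<^sub>o f + S \<bullet>\<^sub>o g" "S \<bullet>\<^sub>o (f - g) = S \<bullet>\<^sub>o f - S \<bullet>\<^sub>o g"
  "S \<bullet>\<^sub>o (- f) = - (S \<bullet>\<^sub>o f)" "S \<bullet>\<^sub>o (r *\<^sub>R f) = r *\<^sub>R (S \<bullet>\<^sub>o f)"
  by (simp_all add: lop_apply_def blinfun.bilinear_simps)

lemma norm_lop_apply_le: "norm (S \<bullet>\<^sub>o f) \<le> norm S * norm f"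
  unfolding lop_apply_def norm_lop.rep_eq by (rule norm_blinfun)

lemma norm_lop_le: "0 \<le> b \<Longrightarrow> (\<And>f. norm (S \<bullet>\<^sub>o f) \<le> b * norm f) \<Longrightarrow> norm S \<le> b"
  unfolding lop_apply_def norm_lop.rep_eq by (rule norm_blinfun_bound)

lemma bounded_linear_lop_apply_left: "bounded_linear (\<lambda>S. S \<bullet>\<^sub>o f)"
  by (rule bounded_linear_intro[where K = "norm f"]) (auto simp: norm_lop_apply_le)

lemma lop_exists:
  assumes T: "bounded_linear T" and S: "bounded_linear S"
    and "\<And>f g. l2_inner (T f) g = l2_inner f (S g)"
  obtains x where "\<And>f. x \<bullet>\<^sub>o f = T f"
proof -
  have "blinfun_adjoint (Blinfun T) (Blinfun S)"
    using assms by (simp add: blinfun_adjoint_def bounded_linear_Blinfun_apply)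
  then have "lop_blinfun (Abs_lop (Blinfun T)) = Blinfun T"
    by (subst Abs_lop_inverse) auto
  then show ?thesis
    using that[of "Abs_lop (Blinfun T)"] T by (simp add: lop_apply_def bounded_linear_Blinfun_apply)
qed

instance lop :: (type, cstar_algebra) complete_space
proof
  fix X :: "nat \<Rightarrow> ('a, 'b) lop"
  assume X: "Cauchy X"
  have "\<exists>S. blinfun_adjoint (lop_blinfun (X n)) S" for n
    using lop_blinfun by blast
  then obtain S where S: "\<And>n. blinfun_adjoint (lop_blinfun (X n)) (S n)"
    by metis
  have diff: "norm (lop_blinfun (X m) - lop_blinfun (X n)) = dist (X m) (X n)" for m n
    by (simp add: dist_lop_def norm_lop.rep_eq minus_lop.rep_eq)
  have C1: "Cauchy (\<lambda>n. lop_blinfun (X n))"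
    using X unfolding Cauchy_def by (simp only: dist_norm diff)
  have "norm (S m - S n) \<le> dist (X m) (X n)" for m n
    using norm_blinfun_adjoint_le[OF blinfun_adjoint_intros(3)[OF S S]] by (simp add: diff)
  then have C2: "Cauchy S"
    using X unfolding Cauchy_def dist_norm[of "S _"] by (meson le_less_trans)
  obtain T where T: "(\<lambda>n. lop_blinfun (X n)) \<longlonglongrightarrow> T"
    using Cauchy_convergent[OF C1] by (auto simp: convergent_def)
  obtain S' where S': "S \<longlonglongrightarrow> S'"
    using Cauchy_convergent[OF C2] by (auto simp: convergent_def)
  have "l2_inner (T f) g = l2_inner f (S' g)" for f g
  proof (rule LIMSEQ_unique)
    show "(\<lambda>n. l2_inner (lop_blinfun (X n) f) g) \<longlonglongrightarrow> l2_inner (T f) g"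
      by (intro l2_inner.tendsto tendsto_const bounded_linear.tendsto[OF blinfun.bounded_linear_left] T)
    have "(\<lambda>n. l2_inner f (S n g)) \<longlonglongrightarrow> l2_inner f (S' g)"
      by (intro l2_inner.tendsto tendsto_const bounded_linear.tendsto[OF blinfun.bounded_linear_left] S')
    then show "(\<lambda>n. l2_inner (lop_blinfun (X n) f) g) \<longlonglongrightarrow> l2_inner f (S' g)"
      by (simp add: blinfun_adjointD[OF S])
  qed
  then have "lop_blinfun (Abs_lop T) = T"
    by (intro Abs_lop_inverse) (auto simp: blinfun_adjoint_def)
  then have "norm (lop_blinfun (X n) - T) = dist (X n) (Abs_lop T)" for n
    by (simp add: dist_lop_def norm_lop.rep_eq minus_lop.rep_eq)
  then have "X \<longlonglongrightarrow> Abs_lop T"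
    using T by (simp add: lim_sequentially dist_norm[of "lop_blinfun _"])
  then show "convergent X"
    by (rule convergentI)
qed

definition lop_adjoint :: "('i, 'a::cstar_algebra) lop \<Rightarrow> ('i, 'a) lop" where
  "lop_adjoint T = (THE S. \<forall>f g. l2_inner (T \<bullet>\<^sub>o f) g = l2_inner f (S \<bullet>\<^sub>o g))"

lemma lop_adjoint_unique:
  assumes "\<And>f g. l2_inner f (S \<bullet>\<^sub>o g) = l2_inner f (S' \<bullet>\<^sub>o g)"
  shows "S = S'"
proof (rule lop_eqI)
  fix g
  have "l2_inner f (S \<bullet>\<^sub>o g - S' \<bullet>\<^sub>o g) = 0" for f
    by (simp add: l2_inner.diff_right assms)
  then show "S \<bullet>\<^sub>o g = S' \<bullet>\<^sub>o g"
    using l2_zero_if_inner_zero by force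
qed

lemma lop_adjoint: "l2_inner (T \<bullet>\<^sub>o f) g = l2_inner f (lop_adjoint T \<bullet>\<^sub>o g)"
proof -
  obtain S where "blinfun_adjoint (lop_blinfun T) S"
    using lop_blinfun by blast
  moreover from this have "lop_blinfun (Abs_lop S) = S"
    using blinfun_adjoint_sym by (intro Abs_lop_inverse) blast
  ultimately have *: "\<forall>f g. l2_inner (T \<bullet>\<^sub>o f) g = l2_inner f (Abs_lop S \<bullet>\<^sub>o g)"
    by (simp add: lop_apply_def blinfun_adjointD)
  have "\<forall>f g. l2_inner (T \<bullet>\<^sub>o f) g = l2_inner f (lop_adjoint T \<bullet>\<^sub>o g)"
    unfolding lop_adjoint_def
  proof (rule theI[of _ "Abs_lop S"])
    fix S' assume "\<forall>f g. l2_inner (T \<bullet>\<^sub>o f) g = l2_inner f (S' \<bullet>\<^sub>o g)"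
    with * show "S' = Abs_lop S"
      by (intro lop_adjoint_unique) simp
  qed (rule *)
  then show ?thesis by blast
qed

instantiation lop :: (type, cstar_algebra) cstar_algebra
begin

lift_definition scaleC_lop :: "complex \<Rightarrow> ('a, 'b) lop \<Rightarrow> ('a, 'b) lop" is "\<lambda>c T. l2_scaleC_blinfun c o\<^sub>L T"
  using blinfun_adjoint_intros(7) by blast

definition "star T = lop_adjoint T" for T :: "('a, 'b) lop"

lemma lop_apply_scaleC [simp]: "(c *\<^sub>C T) \<bullet>\<^sub>o f = l2_scaleC c (T \<bullet>\<^sub>o f)"
  by (simp add: lop_apply_def scaleC_lop.rep_eq)

lemma star_lop: "l2_inner (T \<bullet>\<^sub>o f) g = l2_inner f (star T \<bullet>\<^sub>o g)"
  unfolding star_lop_def by (rule lop_adjoint)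

lemma star_lop': "l2_inner (star T \<bullet>\<^sub>o f) g = l2_inner f (T \<bullet>\<^sub>o g)"
  by (metis star_l2_inner star_lop)

lemma star_lop_eqI: "(\<And>f g. l2_inner (T \<bullet>\<^sub>o f) g = l2_inner f (S \<bullet>\<^sub>o g)) \<Longrightarrow> star T = S"
  by (rule lop_adjoint_unique) (simp flip: star_lop)

text \<open>Bounded linearity is recorded over the reals; complex homogeneity follows from the
  existence of an adjoint.\<close>

lemma lop_apply_l2_scaleC: "T \<bullet>\<^sub>o l2_scaleC c f = l2_scaleC c (T \<bullet>\<^sub>o f)" for T :: "('a, 'b) lop"
proof -
  have "l2_inner g (T \<bullet>\<^sub>o l2_scaleC c f - l2_scaleC c (T \<bullet>\<^sub>o f)) = 0" for g
    using star_lop'[of T g "l2_scaleC c f"] star_lop'[of T g f]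
    by (simp add: l2_inner.diff_right l2_inner_scaleC_right)
  then show ?thesis
    using l2_zero_if_inner_zero by force
qed

lemma norm_star_lop_le: "norm (star T) \<le> norm T" for T :: "('a, 'b) lop"
proof (rule norm_lop_le)
  fix g
  have "norm (star T \<bullet>\<^sub>o g) * norm (star T \<bullet>\<^sub>o g) = norm (l2_inner (T \<bullet>\<^sub>o star T \<bullet>\<^sub>o g) g)"
    using norm_l2_power2[of "star T \<bullet>\<^sub>o g"] by (simp add: star_lop power2_eq_square)
  also have "\<dots> \<le> norm (T \<bullet>\<^sub>o star T \<bullet>\<^sub>o g) * norm g"
    by (rule norm_l2_inner_le)
  also have "\<dots> \<le> (norm T * norm (star T \<bullet>\<^sub>o g)) * norm g"
    by (intro mult_right_mono norm_lop_apply_le) simp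
  finally have "norm (star T \<bullet>\<^sub>o g) * norm (star T \<bullet>\<^sub>o g) \<le> norm (star T \<bullet>\<^sub>o g) * (norm T * norm g)"
    by (simp add: mult_ac)
  then show "norm (star T \<bullet>\<^sub>o g) \<le> norm T * norm g"
    by (cases "norm (star T \<bullet>\<^sub>o g) = 0") auto
qed simp

instance
proof
  fix R S T :: "('a, 'b) lop" and r :: real and c d :: complex
  have sc: "l2_scaleC c (f + g) = l2_scaleC c f + l2_scaleC c g" "l2_scaleC (c + d) f = l2_scaleC c f + l2_scaleC d f"
    "l2_scaleC c (l2_scaleC d f) = l2_scaleC (c * d) f" for c d and f g :: "('a, 'b) l2"
    by (transfer; simp add: scaleC_add_right scaleC_add_left scaleC_scaleC)+
  show "c *\<^sub>C (S + T) = c *\<^sub>C S + c *\<^sub>C T" "(c + d) *\<^sub>C T = c *\<^sub>C T + d *\<^sub>C T"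
    "c *\<^sub>C d *\<^sub>C T = (c * d) *\<^sub>C T" "r *\<^sub>R T = complex_of_real r *\<^sub>C T"
    "(c *\<^sub>C S) * T = c *\<^sub>C (S * T)" "S * (c *\<^sub>C T) = c *\<^sub>C (S * T)"
    by (rule lop_eqI, simp add: sc l2_scaleC_of_real lop_apply_l2_scaleC)+
  have le: "norm (c *\<^sub>C T) \<le> cmod c * norm T" for c and T :: "('a, 'b) lop"
  proof (rule norm_lop_le)
    fix f :: "('a, 'b) l2"
    have "(norm (l2_scaleC c (T \<bullet>\<^sub>o f)))\<^sup>2 = (cmod c * norm (T \<bullet>\<^sub>o f))\<^sup>2"
      by (simp add: norm_l2_power2 l2_inner_scaleC_left l2_inner_scaleC_right scaleC_scaleC norm_scaleC
          norm_mult power_mult_distrib) (simp add: power2_eq_square)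
    then have "norm (l2_scaleC c (T \<bullet>\<^sub>o f)) = cmod c * norm (T \<bullet>\<^sub>o f)"
      by (simp add: power2_eq_iff_nonneg)
    also have "\<dots> \<le> cmod c * (norm T * norm f)"
      by (intro mult_left_mono norm_lop_apply_le) simp
    finally show "norm ((c *\<^sub>C T) \<bullet>\<^sub>o f) \<le> cmod c * norm T * norm f"
      by (simp add: mult.assoc)
  qed simp
  show "norm (c *\<^sub>C T) = cmod c * norm T"
  proof (cases "c = 0")
    case True
    then show ?thesis using le[of c T] by simp
  next
    case False
    have "inverse c *\<^sub>C c *\<^sub>C T = T"
      using False l2_scaleC_of_real[of 1] by (intro lop_eqI) (simp add: sc)
    then have "norm T \<le> cmod (inverse c) * norm (c *\<^sub>C T)"
      using le[of "inverse c" "c *\<^sub>C T"] by simp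
    then have "cmod c * norm T \<le> norm (c *\<^sub>C T)"
      using False by (simp add: norm_inverse norm_divide field_simps)
    then show ?thesis
      using le[of c T] by simp
  qed
  show "star (S + T) = star S + star T" "star (c *\<^sub>C T) = cnj c *\<^sub>C star T"
    "star (S * T) = star T * star S"
    by (rule star_lop_eqI, simp add: l2_inner.bilinear_simps l2_inner_scaleC_left l2_inner_scaleC_right
        star_lop star_lop')+
  show "star (star T) = T"
    by (rule star_lop_eqI) (rule star_lop')
  show "norm (star T * T) = (norm T)\<^sup>2"
  proof (rule antisym)
    show "norm (star T * T) \<le> (norm T)\<^sup>2"
      using norm_mult_ineq[of "star T" T] mult_right_mono[OF norm_star_lop_le[of T], of "norm T"]
      by (simp add: power2_eq_square)
    have "norm T \<le> sqrt (norm (star T * T))"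
    proof (rule norm_lop_le)
      fix f
      have "(norm (T \<bullet>\<^sub>o f))\<^sup>2 = norm (l2_inner f ((star T * T) \<bullet>\<^sub>o f))"
        by (simp add: norm_l2_power2 star_lop)
      also have "\<dots> \<le> norm f * (norm (star T * T) * norm f)"
        by (rule order_trans[OF norm_l2_inner_le mult_left_mono[OF norm_lop_apply_le]]) simp
      also have "\<dots> = (sqrt (norm (star T * T)) * norm f)\<^sup>2"
        by (simp add: power_mult_distrib power2_eq_square)
      finally show "norm (T \<bullet>\<^sub>o f) \<le> sqrt (norm (star T * T)) * norm f"
        by (rule power2_le_imp_le) simp
    qed simp
    then have "(norm T)\<^sup>2 \<le> (sqrt (norm (star T * T)))\<^sup>2"
      by (rule power_mono) simp
    then show "(norm T)\<^sup>2 \<le> norm (star T * T)"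
      by simp
  qed
qed

end

lemma id_lop_exists: "\<exists>x :: ('i, 'a::cstar_algebra) lop. \<forall>f. x \<bullet>\<^sub>o f = f"
  using lop_exists[of "\<lambda>f. f" "\<lambda>f. f"] bounded_linear_ident by metis

text \<open>The unit is supplied without \<open>norm 1 = 1\<close>, which fails when the coefficient
  algebra is zero.\<close>

instantiation lop :: (type, cstar_algebra) monoid_mult
begin

definition one_lop :: "('a, 'b) lop" where
  "1 = (SOME x. \<forall>f. x \<bullet>\<^sub>o f = f)"

lemma lop_apply_one [simp]: "1 \<bullet>\<^sub>o f = f"
  unfolding one_lop_def using someI_ex[OF id_lop_exists] by blast

instance
  by standard (auto intro: lop_eqI)

end

lemma star_lop_one [simp]: "star (1 :: ('i, 'a::cstar_algebra) lop) = 1"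
  by (rule star_lop_eqI) simp

section \<open>Diagonal operators and shifts\<close>

lemma diagonal_lop_exists:
  fixes c :: "'i \<Rightarrow> 'a::cstar_algebra"
  assumes "\<And>i. norm (c i) \<le> r"
  shows "\<exists>x. \<forall>f i. l2_nth (x \<bullet>\<^sub>o f) i = c i * l2_nth f i"
proof -
  define T where "T c f = Abs_l2 (\<lambda>i. c i * l2_nth f i)" for c and f :: "('i, 'a) l2"
  have "0 \<le> r" using assms norm_ge_zero order_trans by blast
  have nth: "l2_nth (T c f) i = c i * l2_nth f i" if "\<And>i. norm (c i) \<le> r" for c f i
    unfolding T_def using square_summable_mult_left[of "l2_nth f" c, OF _ that] by (subst Abs_l2_inverse) auto
  have bl: "bounded_linear (T c)" if c: "\<And>i. norm (c i) \<le> r" for c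
  proof (rule bounded_linear_intro[where K = r])
    fix f g s
    show "T c (f + g) = T c f + T c g" "T c (s *\<^sub>R f) = s *\<^sub>R T c f"
      by (rule l2_eqI, simp add: nth[OF c] plus_l2.rep_eq scaleR_l2.rep_eq distrib_left)+
    show "norm (T c f) \<le> norm f * r"
    proof (rule norm_l2_le)
      fix F :: "'i set" assume "finite F"
      have "norm2 F (l2_nth (T c f)) = norm2 F (\<lambda>i. c i * l2_nth f i)"
        by (simp add: nth[OF c] cong: norm2_cong)
      also have "\<dots> \<le> r * norm2 F (l2_nth f)"
        by (intro norm2_mult_left \<open>finite F\<close> c \<open>0 \<le> r\<close>)
      also have "\<dots> \<le> r * norm f"
        by (intro mult_left_mono norm2_le_norm \<open>finite F\<close> \<open>0 \<le> r\<close>)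
      finally show "norm2 F (l2_nth (T c f)) \<le> norm f * r"
        by (simp add: mult.commute)
    qed
  qed
  have star: "norm (star (c i)) \<le> r" for i
    using assms by simp
  have "l2_inner (T c f) g = l2_inner f (T (\<lambda>i. star (c i)) g)" for f g
    by (simp add: l2_inner_def nth assms star star_mult mult.assoc)
  then obtain x where x: "\<And>f. x \<bullet>\<^sub>o f = T c f"
    using lop_exists[OF bl[of c, OF assms] bl[of "\<lambda>i. star (c i)", OF star]] by blast
  then show ?thesis
    by (intro exI[of _ x]) (simp add: x nth[of c, OF assms])
qed

text \<open>An injection of the index set moves coordinates isometrically, and the adjoint is
  composition with \<open>\<sigma>\<close>. The operator and its adjoint are described in one
  existential statement because \<open>isometry_lop\<close> is obtained from it by choice.\<close>

lemma shift_lop_exists: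
  fixes \<sigma> :: "'i \<Rightarrow> 'i"
  assumes "inj \<sigma>"
  shows "\<exists>x :: ('i, 'a::cstar_algebra) lop. \<forall>f. (\<forall>i. l2_nth (x \<bullet>\<^sub>o f) (\<sigma> i) = l2_nth f i) \<and>
    (\<forall>j. j \<notin> range \<sigma> \<longrightarrow> l2_nth (x \<bullet>\<^sub>o f) j = 0) \<and> (\<forall>i. l2_nth (star x \<bullet>\<^sub>o f) i = l2_nth f (\<sigma> i))"
proof -
  define u where "u f j = (if j \<in> range \<sigma> then f (inv \<sigma> j) else 0)" for f :: "'i \<Rightarrow> 'a" and j
  have u_\<sigma>: "u f (\<sigma> i) = f i" for f i
    using assms by (simp add: u_def)
  have norm_u: "norm2 F (u f) = norm2 (\<sigma> -` F) f" if "finite F" for F f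
  proof -
    have "(\<Sum>j\<in>F. star (u f j) * u f j) = (\<Sum>j\<in>\<sigma> ` (\<sigma> -` F). star (u f j) * u f j)"
      by (rule sum.mono_neutral_right[OF that]) (auto simp: u_def)
    also have "\<dots> = (\<Sum>i\<in>\<sigma> -` F. star (f i) * f i)"
      using assms by (subst sum.reindex) (auto simp: u_\<sigma> intro: inj_on_subset)
    finally show ?thesis by (simp add: norm2_def)
  qed
  have norm_comp: "norm2 F (\<lambda>i. f (\<sigma> i)) = norm2 (\<sigma> ` F) f" for F and f :: "'i \<Rightarrow> 'a"
    using assms unfolding norm2_def by (subst sum.reindex) (auto intro: inj_on_subset)
  have fin: "finite (\<sigma> -` F)" if "finite F" for F
    using that assms by (rule finite_vimageI)
  have ss_u: "square_summable (u f)" if "square_summable f" for f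
    unfolding square_summable_def
  proof (intro allI impI)
    fix e :: real assume "e > 0"
    then obtain F where F: "finite F" "\<And>G. finite G \<Longrightarrow> G \<inter> F = {} \<Longrightarrow> norm2 G f < e"
      using square_summableD \<open>square_summable f\<close> by blast
    have "norm2 G (u f) < e" if "finite G" "G \<inter> \<sigma> ` F = {}" for G
      unfolding norm_u[OF that(1)] using that by (intro F(2) fin) auto
    then show "\<exists>F. finite F \<and> (\<forall>G. finite G \<longrightarrow> G \<inter> F = {} \<longrightarrow> norm2 G (u f) < e)"
      using F(1) by (intro exI[of _ "\<sigma> ` F"]) auto
  qed
  have ss_comp: "square_summable (\<lambda>i. f (\<sigma> i))" if "square_summable f" for f :: "'i \<Rightarrow> 'a"
    unfolding square_summable_def
  proof (intro allI impI)
    fix e :: real assume "e > 0"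
    then obtain F where F: "finite F" "\<And>G. finite G \<Longrightarrow> G \<inter> F = {} \<Longrightarrow> norm2 G f < e"
      using square_summableD \<open>square_summable f\<close> by blast
    have "norm2 G (\<lambda>i. f (\<sigma> i)) < e" if "finite G" "G \<inter> \<sigma> -` F = {}" for G
      unfolding norm_comp using that by (intro F(2)) auto
    then show "\<exists>F. finite F \<and> (\<forall>G. finite G \<longrightarrow> G \<inter> F = {} \<longrightarrow> norm2 G (\<lambda>i. f (\<sigma> i)) < e)"
      using fin[OF F(1)] by (intro exI[of _ "\<sigma> -` F"]) auto
  qed
  define S S' where "S f = Abs_l2 (u (l2_nth f))" and "S' f = Abs_l2 (\<lambda>i. l2_nth f (\<sigma> i))"
    for f :: "('i, 'a) l2"
  have S_nth: "l2_nth (S f) = u (l2_nth f)" and S'_nth: "l2_nth (S' f) = (\<lambda>i. l2_nth f (\<sigma> i))" for f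
    unfolding S_def S'_def by (simp_all add: Abs_l2_inverse ss_u ss_comp)
  have "bounded_linear S"
  proof (rule bounded_linear_intro[where K = 1])
    fix f g r
    show "S (f + g) = S f + S g" "S (r *\<^sub>R f) = r *\<^sub>R S f"
      by (rule l2_eqI, simp add: S_nth plus_l2.rep_eq scaleR_l2.rep_eq u_def)+
    show "norm (S f) \<le> norm f * 1"
      by (rule norm_l2_le) (simp add: S_nth norm_u norm2_le_norm fin)
  qed
  moreover have "bounded_linear S'"
  proof (rule bounded_linear_intro[where K = 1])
    fix f g r
    show "S' (f + g) = S' f + S' g" "S' (r *\<^sub>R f) = r *\<^sub>R S' f"
      by (rule l2_eqI, simp add: S'_nth plus_l2.rep_eq scaleR_l2.rep_eq)+
    show "norm (S' f) \<le> norm f * 1"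
      by (rule norm_l2_le) (simp add: S'_nth norm_comp norm2_le_norm)
  qed
  moreover have adj: "l2_inner (S f) g = l2_inner f (S' g)" for f g
  proof (rule l2_inner_eqI)
    have "((\<lambda>j. star (u (l2_nth f) j) * l2_nth g j) has_sum l2_inner f (S' g)) (range \<sigma>)"
      using has_sum_l2_inner[of f "S' g"] assms
      by (subst has_sum_reindex) (auto simp: o_def u_\<sigma> S'_nth)
    then show "((\<lambda>j. star (l2_nth (S f) j) * l2_nth g j) has_sum l2_inner f (S' g)) UNIV"
      unfolding S_nth by (subst has_sum_cong_neutral[where T = "range \<sigma>" and g = "\<lambda>j. star (u (l2_nth f) j) * l2_nth g j"])
        (auto simp: u_def)
  qed
  ultimately obtain x where x: "\<And>f. x \<bullet>\<^sub>o f = S f"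
    using lop_exists by blast
  have adj': "l2_inner (S' f) g = l2_inner f (S g)" for f g
    by (metis adj star_l2_inner)
  obtain y where y: "\<And>f. y \<bullet>\<^sub>o f = S' f"
    using lop_exists[OF \<open>bounded_linear S'\<close> \<open>bounded_linear S\<close> adj'] by blast
  have "star x = y"
    by (rule star_lop_eqI) (simp add: x y adj)
  then have "l2_nth (x \<bullet>\<^sub>o f) (\<sigma> i) = l2_nth f i" "j \<notin> range \<sigma> \<Longrightarrow> l2_nth (x \<bullet>\<^sub>o f) j = 0"
    "l2_nth (star x \<bullet>\<^sub>o f) i = l2_nth f (\<sigma> i)" for f i j
    by (simp_all add: x y S_nth S'_nth u_\<sigma>) (simp add: u_def)
  then show ?thesis by blast
qed

section \<open>Spectral gap argument\<close>

text \<open>\<open>npeval q x\<close> is the value at \<open>x\<close> of the polynomial \<open>X q(X)\<close>, which makes sense without a unit.\<close>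

definition npeval :: "real poly \<Rightarrow> 'a::real_algebra \<Rightarrow> 'a" where
  "npeval q x = fold_coeffs (\<lambda>c y. c *\<^sub>R x + x * y) q 0"

lemma npeval_0 [simp]: "npeval 0 x = 0"
  by (simp add: npeval_def)

lemma npeval_pCons [simp]: "npeval (pCons c q) x = c *\<^sub>R x + x * npeval q x"
  by (cases "q = 0 \<and> c = 0") (auto simp: npeval_def)

lemma unitize_npeval: "unitize (npeval q x) = peval ([:0, 1:] * q) (unitize x)"
  by (induction q) (simp_all add: unitize_add unitize_mult unitize_scaleR of_real_def distrib_left)

text \<open>Write \<open>h = k * k\<close> with \<open>norm k \<le> 1\<close> and substitute X^2.
  The definition of positivity yields an interval from 0 to some unspecified \<open>s\<close>,
  whereas Bernstein approximation takes place on the unit interval.\<close>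

lemma spectral_bound_unit_interval:
  assumes "is_positive h" "norm h \<le> 1"
  shows "spectral_bound {0..1} h"
proof -
  obtain k where k: "star k = k" "k * k = h"
    using positive_sqrt assms(1) by blast
  have "norm k * norm k \<le> 1 * 1"
    using norm_selfadjoint_square[OF k(1)] k(2) assms(2) by simp
  then have "norm k \<le> 1"
    using abs_square_le_1[of "norm k"] by (simp add: power2_eq_square)
  then have sb: "spectral_bound {-1..1} k"
    using k by (intro spectral_bound_unit_ball)
  have "norm (peval p h) \<le> M" if M: "0 \<le> M" "\<forall>t\<in>{0..1}. \<bar>poly p t\<bar> \<le> M" for p M
  proof -
    have "norm (peval (pcompose p [:0, 0, 1:]) k) \<le> M"
    proof (rule spectral_boundD[OF sb M(1)])
      fix t :: real assume "t \<in> {-1..1}"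
      then have "t * t \<in> {0..1}"
        using abs_square_le_1[of t] by (auto simp: power2_eq_square)
      then show "\<bar>poly (pcompose p [:0, 0, 1:]) t\<bar> \<le> M"
        using M(2) by (simp add: poly_pcompose)
    qed
    then show ?thesis
      by (simp add: peval_pcompose k)
  qed
  then show ?thesis
    using positive_star[OF assms(1)] by (simp add: spectral_bound_def)
qed

text \<open>Vanishing up to 1/2 leaves in the Bernstein polynomials only powers X^k with k > n/2,
  which are small at small elements. Positivity at 1 keeps the value at a positive element of norm 1
  away from 0.\<close>

definition gap_fun :: "real \<Rightarrow> real" where
  "gap_fun t = max 0 (t - 1 / 2)"

text \<open>The \<open>n\<close>-th Bernstein polynomial of \<open>gap_fun\<close> divided by X; the
  term for k = 0 is absent because \<open>gap_fun 0 = 0\<close>. The division fits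
  \<open>npeval\<close>, which multiplies by X again.\<close>

definition gap_poly :: "nat \<Rightarrow> real poly" where
  "gap_poly n = (\<Sum>k=1..n. smult (gap_fun (real k / real n) * real (n choose k))
     ([:0, 1:] ^ (k - 1) * [:1, - 1:] ^ (n - k)))"

lemma gap_poly_eq: "[:0, 1:] * gap_poly n = (\<Sum>k=1..n. smult (gap_fun (real k / real n) * real (n choose k))
     ([:0, 1:] ^ k * [:1, - 1:] ^ (n - k)))"
  unfolding gap_poly_def sum_distrib_left
proof (intro sum.cong refl)
  fix k assume "k \<in> {1..n}"
  then obtain j where "k = Suc j" by (cases k) auto
  then show "[:0, 1:] * smult (gap_fun (real k / real n) * real (n choose k)) ([:0, 1:] ^ (k - 1) * [:1, - 1:] ^ (n - k)) =
      smult (gap_fun (real k / real n) * real (n choose k)) ([:0, 1:] ^ k * [:1, - 1:] ^ (n - k))"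
    by (simp only: mult_smult_right power_Suc diff_Suc_1 mult.assoc)
qed

lemma poly_gap_poly: "poly ([:0, 1:] * gap_poly n) t = (\<Sum>k\<le>n. gap_fun (real k / real n) * Bernstein n k t)"
proof -
  have "poly ([:0, 1:] * gap_poly n) t = (\<Sum>k=1..n. gap_fun (real k / real n) * Bernstein n k t)"
    unfolding gap_poly_eq by (simp add: poly_sum poly_power Bernstein_def mult_ac)
  also have "\<dots> = (\<Sum>k\<le>n. gap_fun (real k / real n) * Bernstein n k t)"
    by (rule sum.mono_neutral_left) (auto simp: gap_fun_def not_less_eq_eq)
  finally show ?thesis .
qed

lemma uniform_limit_gap_poly: "uniform_limit {0..1} (\<lambda>n. poly ([:0, 1:] * gap_poly n)) gap_fun sequentially"
  unfolding uniform_limit_iff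
proof (intro allI impI)
  fix e :: real assume "e > 0"
  have "continuous_on {0..1} gap_fun"
    unfolding gap_fun_def[abs_def] by (intro continuous_intros)
  then obtain N where "\<And>n t. N \<le> n \<and> t \<in> {0..1} \<Longrightarrow>
      \<bar>gap_fun t - (\<Sum>k\<le>n. gap_fun (real k / real n) * Bernstein n k t)\<bar> < e"
    using Bernstein_Weierstrass \<open>e > 0\<close> by blast
  then show "\<forall>\<^sub>F n in sequentially. \<forall>t\<in>{0..1}. dist (poly ([:0, 1:] * gap_poly n) t) (gap_fun t) < e"
    unfolding eventually_sequentially poly_gap_poly dist_real_def
    by (intro exI[of _ N]) (auto simp: abs_minus_commute)
qed

text \<open>The Bernstein polynomials of a function that vanishes on \<open>[0, 1/2]\<close> tend to \<open>0\<close> on every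
  small element, self-adjoint or not: only the terms with \<open>k > n / 2\<close> survive.\<close>

lemma norm_npeval_gap_poly_le:
  fixes w :: "'a::cstar_algebra"
  assumes w: "norm w \<le> 1 / 16"
  shows "norm (npeval (gap_poly n) w) \<le> (17 / 32) ^ n"
proof -
  define u where "u = unitize w"
  have u: "norm u \<le> 1 / 16"
    using w by (simp add: u_def)
  have "norm (1 - u) \<le> 1 + 1 / 16"
    using norm_triangle_ineq4[of 1 u] u by simp
  then have u1: "norm (1 - u) \<le> 17 / 16" by simp
  \<comment> \<open>For 2 k \<ge> n the bound (1/16)^k is at most (1/4)^n, and the other factor is
    at most (17/16)^n. The binomial coefficients sum to at most 2^n, which leaves the ratio 2 *
    17/64 = 17/32.\<close>
  have summand: "norm ((gap_fun (real k / real n) * real (n choose k)) *\<^sub>R (u ^ k * (1 - u) ^ (n - k))) \<le>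
      real (n choose k) * (17 / 64) ^ n" if k: "k \<in> {1..n}" for k
  proof (cases "real k / real n \<le> 1 / 2")
    case True
    then show ?thesis by (simp add: gap_fun_def)
  next
    case False
    have "real k / real n \<le> 1"
      using k by (simp add: divide_simps)
    then have g: "0 \<le> gap_fun (real k / real n)" "gap_fun (real k / real n) \<le> 1"
      by (auto simp: gap_fun_def)
    have "n \<le> 2 * k"
      using False k by (simp add: field_simps split: if_splits)
    have "norm (u ^ k) \<le> (1 / 16) ^ k"
      using norm_power_ineq[of u k] power_mono[OF u, of k] by simp
    also have "\<dots> = (1 / 4) ^ (2 * k)"
      by (simp add: power_mult) (simp add: power2_eq_square)
    also have "\<dots> \<le> (1 / 4) ^ n"
      using \<open>n \<le> 2 * k\<close> by (intro power_decreasing) auto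
    finally have 1: "norm (u ^ k) \<le> (1 / 4) ^ n" .
    have "norm ((1 - u) ^ (n - k)) \<le> (17 / 16) ^ (n - k)"
      using norm_power_ineq[of "1 - u" "n - k"] power_mono[OF u1, of "n - k"] by simp
    also have "\<dots> \<le> (17 / 16) ^ n"
      by (intro power_increasing) auto
    finally have 2: "norm ((1 - u) ^ (n - k)) \<le> (17 / 16) ^ n" .
    have "norm (u ^ k * (1 - u) ^ (n - k)) \<le> (1 / 4) ^ n * (17 / 16) ^ n"
      by (rule order_trans[OF norm_mult_ineq mult_mono[OF 1 2]]) auto
    also have "\<dots> = (17 / 64) ^ n"
      by (simp flip: power_mult_distrib)
    finally have 3: "norm (u ^ k * (1 - u) ^ (n - k)) \<le> (17 / 64) ^ n" .
    have "norm ((gap_fun (real k / real n) * real (n choose k)) *\<^sub>R (u ^ k * (1 - u) ^ (n - k))) =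
        gap_fun (real k / real n) * real (n choose k) * norm (u ^ k * (1 - u) ^ (n - k))"
      using g by (simp add: abs_mult)
    also have "\<dots> \<le> 1 * real (n choose k) * (17 / 64) ^ n"
      using g 3 by (intro mult_mono) auto
    finally show ?thesis by simp
  qed
  have "norm (npeval (gap_poly n) w) = norm (peval ([:0, 1:] * gap_poly n) u)"
    by (metis norm_unitize unitize_npeval u_def)
  also have "peval ([:0, 1:] * gap_poly n) u =
      (\<Sum>k=1..n. (gap_fun (real k / real n) * real (n choose k)) *\<^sub>R (u ^ k * (1 - u) ^ (n - k)))"
    unfolding gap_poly_eq by (simp add: peval_sum peval_smult peval_mult peval_power)
  also have "norm \<dots> \<le> (\<Sum>k=1..n. real (n choose k) * (17 / 64) ^ n)"
    by (rule sum_norm_le) (rule summand)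
  also have "\<dots> \<le> (\<Sum>k\<le>n. real (n choose k) * (17 / 64) ^ n)"
    by (rule sum_mono2) auto
  also have "\<dots> = 2 ^ n * (17 / 64) ^ n"
    using choose_row_sum[of n] by (simp flip: sum_distrib_right of_nat_sum)
  also have "\<dots> = (17 / 32) ^ n"
    by (simp flip: power_mult_distrib)
  finally show ?thesis .
qed

lemma tendsto_npeval_gap_poly_0:
  fixes w :: "'a::cstar_algebra"
  assumes "norm w \<le> 1 / 16"
  shows "(\<lambda>n. npeval (gap_poly n) w) \<longlonglongrightarrow> 0"
proof (rule Lim_null_comparison)
  show "\<forall>\<^sub>F n in sequentially. norm (npeval (gap_poly n) w) \<le> (17 / 32) ^ n"
    using norm_npeval_gap_poly_le[OF assms] by simp
  show "(\<lambda>n. (17 / 32) ^ n :: real) \<longlonglongrightarrow> 0"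
    by (rule LIMSEQ_power_zero) simp
qed

text \<open>The limit \<open>g\<close> is the value of \<open>gap_fun\<close> at \<open>c\<close>,
  the inner square of \<open>d\<close>. On the unit interval \<open>gap_fun t\<close> differs from
  \<open>t\<close> by at most 1/2; with tolerance 1/4 the approximants stay within 3/4 of
  \<open>c\<close>, whose norm is 1.\<close>

lemma npeval_gap_poly_convergent:
  fixes d :: "'a::cstar_algebra"
  assumes "norm d = 1"
  obtains g where "(\<lambda>n. npeval (gap_poly n) (star d * d)) \<longlonglongrightarrow> g" "g \<noteq> 0"
proof -
  define c where "c = star d * d"
  have nc: "norm c = 1"
    using assms by (simp add: c_def norm_star_mult_self)
  have sb: "spectral_bound {0..1} (unitize c)"
    using positive_star_mult[of "unitize d"] nc
    by (intro spectral_bound_unit_interval) (simp_all add: c_def unitize_mult unitize_star norm_star_mult_self assms)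
  have "convergent (\<lambda>n. unitize (npeval (gap_poly n) c))"
    unfolding unitize_npeval by (rule convergent_peval[OF sb uniform_limit_gap_poly])
  then have "Cauchy (\<lambda>n. unitize (npeval (gap_poly n) c))"
    by (rule convergent_Cauchy)
  then have "Cauchy (\<lambda>n. npeval (gap_poly n) c)"
    by (simp only: Cauchy_def dist_norm norm_unitize flip: unitize_diff)
  then obtain g where g: "(\<lambda>n. npeval (gap_poly n) c) \<longlonglongrightarrow> g"
    using Cauchy_convergent by (auto simp: convergent_def)
  have "\<forall>\<^sub>F n in sequentially. \<forall>t\<in>{0..1}. dist (poly ([:0, 1:] * gap_poly n) t) (gap_fun t) < 1 / 4"
    by (rule uniform_limitD[OF uniform_limit_gap_poly]) simp
  then have "\<forall>\<^sub>F n in sequentially. norm (c - npeval (gap_poly n) c) \<le> 3 / 4"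
  proof eventually_elim
    case (elim n)
    have "norm (peval ([:0, 1:] - [:0, 1:] * gap_poly n) (unitize c)) \<le> 3 / 4"
    proof (rule spectral_boundD[OF sb])
      fix t :: real assume t: "t \<in> {0..1}"
      then have "\<bar>poly ([:0, 1:] * gap_poly n) t - gap_fun t\<bar> < 1 / 4"
        using elim by (simp add: dist_real_def)
      moreover have "\<bar>t - gap_fun t\<bar> \<le> 1 / 2"
        using t by (auto simp: gap_fun_def max_def)
      ultimately have "\<bar>t - poly ([:0, 1:] * gap_poly n) t\<bar> \<le> 3 / 4"
        by linarith
      moreover have "poly [:0, 1:] t = t" by simp
      ultimately show "\<bar>poly ([:0, 1:] - [:0, 1:] * gap_poly n) t\<bar> \<le> 3 / 4"
        by (simp only: poly_diff)
    qed simp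
    moreover have "peval ([:0, 1:] - [:0, 1:] * gap_poly n) (unitize c) = unitize (c - npeval (gap_poly n) c)"
      unfolding peval_diff unitize_diff unitize_npeval by simp
    ultimately show ?case by simp
  qed
  then have "norm (c - g) \<le> 3 / 4"
    by (rule tendsto_upperbound[OF tendsto_norm[OF tendsto_diff[OF tendsto_const g]]]) simp
  then have "g \<noteq> 0"
    using nc by auto
  with g show ?thesis
    using that by (simp add: c_def)
qed

lemma npeval_closed:
  assumes "x \<in> B" "0 \<in> B" "\<And>x y. x \<in> B \<Longrightarrow> y \<in> B \<Longrightarrow> x + y \<in> B" "\<And>r x. x \<in> B \<Longrightarrow> r *\<^sub>R x \<in> B"
    "\<And>x y. x \<in> B \<Longrightarrow> y \<in> B \<Longrightarrow> x * y \<in> B"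
  shows "npeval q x \<in> B"
  by (induction q) (auto intro!: assms)

text \<open>Polynomials without constant term respect congruence modulo \<open>J\<close>, by
  telescoping the product of \<open>j + w\<close> with the value of the remaining polynomial. This
  replaces the calculus in the quotient algebra.\<close>

lemma npeval_diff_in_ideal:
  assumes "j \<in> J" "w \<in> B" "J \<subseteq> B" "0 \<in> J"
    and B: "\<And>x y. x \<in> B \<Longrightarrow> y \<in> B \<Longrightarrow> x + y \<in> B" "\<And>r x. x \<in> B \<Longrightarrow> r *\<^sub>R x \<in> B"
      "\<And>x y. x \<in> B \<Longrightarrow> y \<in> B \<Longrightarrow> x * y \<in> B"
    and J: "\<And>x y. x \<in> J \<Longrightarrow> y \<in> J \<Longrightarrow> x + y \<in> J" "\<And>r x. x \<in> J \<Longrightarrow> r *\<^sub>R x \<in> J"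
      "\<And>x y. x \<in> B \<Longrightarrow> y \<in> J \<Longrightarrow> x * y \<in> J" "\<And>x y. x \<in> B \<Longrightarrow> y \<in> J \<Longrightarrow> y * x \<in> J"
  shows "npeval q (j + w) - npeval q w \<in> J"
proof (induction q)
  case (pCons c q)
  have "npeval q (j + w) \<in> B"
    using assms(3,4) by (intro npeval_closed B) (auto intro: B(1) assms(1,2))
  then have "c *\<^sub>R j + (j * npeval q (j + w) + w * (npeval q (j + w) - npeval q w)) \<in> J"
    by (intro J(1,2) J(3)[OF assms(2)] J(4)[OF _ assms(1)] pCons(2) assms(1))
  then show ?case
    by (simp add: algebra_simps)
qed (simp add: assms)

text \<open>If \<open>J\<close> met \<open>\<pi>(A)\<close> only in \<open>0\<close>, then \<open>A\<close> would embed isometrically into the quotient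
  by \<open>J\<close>. The element \<open>g\<close> is the value at \<open>d\<^sup>* d\<close> of \<open>gap_fun\<close>.\<close>

lemma ideal_meets_subalgebra:
  fixes \<pi> :: "'a::cstar_algebra \<Rightarrow> 'b::cstar_algebra" and d :: 'a
  assumes \<pi>: "bounded_linear \<pi>" "\<And>x y. \<pi> (x * y) = \<pi> x * \<pi> y" "\<And>x. \<pi> (star x) = star (\<pi> x)"
    and isometric: "\<And>x. norm (\<pi> x) = norm x"
    and in_B: "\<And>x. \<pi> x \<in> B"
    and J: "J \<subseteq> B" "0 \<in> J" "closed J" "\<And>x y. x \<in> J \<Longrightarrow> y \<in> J \<Longrightarrow> x + y \<in> J" "\<And>r x. x \<in> J \<Longrightarrow> r *\<^sub>R x \<in> J"
      "\<And>x y. x \<in> B \<Longrightarrow> y \<in> J \<Longrightarrow> x * y \<in> J" "\<And>x y. x \<in> B \<Longrightarrow> y \<in> J \<Longrightarrow> y * x \<in> J"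
    and B: "\<And>x y. x \<in> B \<Longrightarrow> y \<in> B \<Longrightarrow> x + y \<in> B" "\<And>r x. x \<in> B \<Longrightarrow> r *\<^sub>R x \<in> B"
      "\<And>x y. x \<in> B \<Longrightarrow> y \<in> B \<Longrightarrow> x * y \<in> B" "\<And>x. x \<in> B \<Longrightarrow> star x \<in> B"
    and d: "norm d = 1" and j: "j \<in> J" and close: "norm (\<pi> d - j) \<le> 1 / 48"
  obtains g where "g \<noteq> 0" "\<pi> g \<in> J"
proof -
  interpret \<pi>: bounded_linear \<pi> by (rule \<pi>(1))
  define c where "c = star d * d"
  define j0 where "j0 = star j * j"
  have j0: "j0 \<in> J"
    using j J(1) B(4) J(6) by (auto simp: j0_def)
  \<comment> \<open>Thus \<open>\<pi> c\<close> is \<open>j0\<close>, an element of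
    \<open>J\<close>, plus a remainder of norm at most 1/48 + 49/48^2, below the 1/16 that the
    Bernstein estimate tolerates.\<close>
  define w where "w = \<pi> c - j0"
  have nj: "norm j \<le> 49 / 48"
    using norm_triangle_ineq2[of j "\<pi> d"] close isometric[of d] d by (simp add: norm_minus_commute)
  have "w = star (\<pi> d) * (\<pi> d - j) + star (\<pi> d - j) * j"
    by (simp add: w_def c_def j0_def \<pi>(2,3) star_diff algebra_simps)
  also have "norm \<dots> \<le> norm (\<pi> d) * norm (\<pi> d - j) + norm (\<pi> d - j) * norm j"
    by (intro norm_triangle_le add_mono) (use norm_mult_ineq[of "star (\<pi> d)" "\<pi> d - j"]
      norm_mult_ineq[of "star (\<pi> d - j)" j] in simp_all)
  also have "\<dots> \<le> 1 * (1 / 48) + (1 / 48) * (49 / 48)"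
    using close nj isometric[of d] d by (intro add_mono mult_mono) auto
  finally have nw: "norm w \<le> 1 / 16" by simp
  have "w = \<pi> c + (- 1) *\<^sub>R j0"
    by (simp add: w_def)
  then have wB: "w \<in> B"
    using B(1)[OF in_B[of c] B(2)[OF subsetD[OF J(1) j0], of "- 1"]] by simp
  obtain g where g: "(\<lambda>n. npeval (gap_poly n) c) \<longlonglongrightarrow> g" "g \<noteq> 0"
    using npeval_gap_poly_convergent[OF d] by (auto simp: c_def)
  have "\<pi> (npeval q c) = npeval q (\<pi> c)" for q
    by (induction q) (simp_all add: \<pi>.add \<pi>.scaleR \<pi>(2))
  \<comment> \<open>This is the congruence for \<open>\<pi> c = j0 + w\<close>. Along
    \<open>gap_poly\<close> the second term tends to 0, so \<open>\<pi> g\<close> is left in the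
    closed set \<open>J\<close>.\<close>
  then have "\<pi> (npeval q c) - npeval q w \<in> J" for q
    using npeval_diff_in_ideal[of j0 J w B q] j0 wB J B by (simp add: w_def)
  moreover have "(\<lambda>n. \<pi> (npeval (gap_poly n) c) - npeval (gap_poly n) w) \<longlonglongrightarrow> \<pi> g - 0"
    by (intro tendsto_diff \<pi>.tendsto g tendsto_npeval_gap_poly_0 nw)
  ultimately have "\<pi> g \<in> J"
    using closed_sequentially[OF J(3), of "\<lambda>n. \<pi> (npeval (gap_poly n) c) - npeval (gap_poly n) w"] by simp
  with g(2) show ?thesis
    using that by blast
qed

section \<open>The concrete Toeplitz--Pimsner algebra\<close>

lemma approximate_unit_element:
  fixes F :: "'a::cstar_algebra filter" and a :: 'a
  assumes F: "approximate_unit F" and "e > 0"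
  obtains u where "norm u \<le> 1" "norm (u * a - a) < e" "norm (a * u - a) < e"
proof -
  have "F \<noteq> bot" and ev: "\<forall>\<^sub>F u in F. (\<exists>b. u = star b * b) \<and> norm u \<le> 1"
    and lim: "((\<lambda>u. u * a) \<longlongrightarrow> a) F" "((\<lambda>u. a * u) \<longlongrightarrow> a) F"
    using F by (auto simp: approximate_unit_def)
  have "\<forall>\<^sub>F u in F. norm u \<le> 1 \<and> dist (u * a) a < e \<and> dist (a * u) a < e"
    using ev tendstoD[OF lim(1) \<open>e > 0\<close>] tendstoD[OF lim(2) \<open>e > 0\<close>] by eventually_elim auto
  then show ?thesis
    using \<open>F \<noteq> bot\<close> that eventually_happens by (metis (no_types, lifting) dist_norm)
qed

text \<open>The first letter acts first. This is the order in which a coefficient meets the letters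
  when it is moved to the right through \<open>word_lop w\<close>.\<close>

fun word_endo :: "(nat \<Rightarrow> 'a \<Rightarrow> 'a) \<Rightarrow> nat list \<Rightarrow> 'a \<Rightarrow> 'a" where
  "word_endo \<rho> [] a = a"
| "word_endo \<rho> (n # w) a = word_endo \<rho> w (\<rho> n a)"

text \<open>The isometry \<open>V_n\<close>. Without a unit in the coefficient algebra it need not
  belong to the Toeplitz--Pimsner algebra, where it appears only multiplied by coefficients.\<close>

definition isometry_lop :: "nat \<Rightarrow> (nat list, 'a::cstar_algebra) lop" where
  "isometry_lop n = (SOME x. \<forall>f. (\<forall>w. l2_nth (x \<bullet>\<^sub>o f) (n # w) = l2_nth f w) \<and>
    (\<forall>v. v \<notin> range ((#) n) \<longrightarrow> l2_nth (x \<bullet>\<^sub>o f) v = 0) \<and> (\<forall>w. l2_nth (star x \<bullet>\<^sub>o f) w = l2_nth f (n # w)))"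

lemma isometry_lop_nth:
  "l2_nth (isometry_lop n \<bullet>\<^sub>o f) [] = 0"
  "l2_nth (isometry_lop n \<bullet>\<^sub>o f) (m # w) = (if m = n then l2_nth f w else 0)"
  "l2_nth (star (isometry_lop n) \<bullet>\<^sub>o f) w = l2_nth f (n # w)"
proof -
  have *: "\<forall>f. (\<forall>w. l2_nth (isometry_lop n \<bullet>\<^sub>o f) (n # w) = l2_nth f w) \<and>
      (\<forall>v. v \<notin> range ((#) n) \<longrightarrow> l2_nth (isometry_lop n \<bullet>\<^sub>o f) v = 0) \<and>
      (\<forall>w. l2_nth (star (isometry_lop n) \<bullet>\<^sub>o f) w = l2_nth f (n # w))"
    unfolding isometry_lop_def by (rule someI_ex[OF shift_lop_exists[of "(#) n"]]) simp
  then show "l2_nth (star (isometry_lop n) \<bullet>\<^sub>o f) w = l2_nth f (n # w)" by blast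
  have "[] \<notin> range ((#) n)" "m \<noteq> n \<Longrightarrow> m # w \<notin> range ((#) n)"
    by auto
  with * show "l2_nth (isometry_lop n \<bullet>\<^sub>o f) [] = 0"
    "l2_nth (isometry_lop n \<bullet>\<^sub>o f) (m # w) = (if m = n then l2_nth f w else 0)"
    by (blast, cases "m = n") auto
qed

lemma star_isometry_mult: "star (isometry_lop n) * isometry_lop m = (if n = m then 1 else 0)"
  by (auto intro!: lop_eqI l2_eqI simp: isometry_lop_nth zero_l2.rep_eq)

lemma star_isometry_mult_left:
  "star (isometry_lop n) * (isometry_lop m * x) = (if n = m then x else 0)"
  using arg_cong[OF star_isometry_mult[of n m], of "\<lambda>y. y * x"] by (simp add: mult.assoc split: if_splits)

lemma isometry_single: "isometry_lop n \<bullet>\<^sub>o l2_single w a = l2_single (n # w) a"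
proof (rule l2_eqI)
  show "l2_nth (isometry_lop n \<bullet>\<^sub>o l2_single w a) v = l2_nth (l2_single (n # w) a) v" for v
    by (cases v) (auto simp: isometry_lop_nth l2_single.rep_eq)
qed

fun word_lop :: "nat list \<Rightarrow> (nat list, 'a::cstar_algebra) lop" where
  "word_lop [] = 1"
| "word_lop (n # w) = isometry_lop n * word_lop w"

lemma word_lop_append: "word_lop (u @ v) = word_lop u * word_lop v"
  by (induction u) (auto simp: mult.assoc)

lemma word_lop_single: "word_lop u \<bullet>\<^sub>o l2_single w a = l2_single (u @ w) a"
  by (induction u) (auto simp: isometry_single)

text \<open>Letters cancel one by one. The cases are: neither word is a prefix of the other,
  \<open>v\<close> is a prefix of \<open>u\<close>, \<open>u\<close> is a prefix of
  \<open>v\<close>; \<open>z\<close> is what remains of the longer word.\<close>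

lemma star_word_lop_mult:
  "star (word_lop v) * word_lop u = (0 :: (nat list, 'a::cstar_algebra) lop) \<or>
   (\<exists>z. star (word_lop v) * word_lop u = (word_lop z :: (nat list, 'a) lop)) \<or>
   (\<exists>z. star (word_lop v) * word_lop u = star (word_lop z :: (nat list, 'a) lop))"
proof (induction v arbitrary: u)
  case Nil
  then show ?case by auto
next
  case (Cons n v)
  show ?case
  proof (cases u)
    case Nil
    then show ?thesis by (metis mult.right_neutral word_lop.simps(1))
  next
    case (Cons m u')
    then show ?thesis
      using Cons.IH[of u'] by (auto simp: star_mult mult.assoc star_isometry_mult_left)
  qed
qed

section \<open>Closures of linear spans\<close>

lemma closure_of_span_mult:
  fixes S :: "'b::real_normed_algebra set"
  assumes S: "\<And>x y. x \<in> S \<Longrightarrow> y \<in> S \<Longrightarrow> x * y \<in> span S"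
    and x: "x \<in> closure (span S)" and y: "y \<in> closure (span S)"
  shows "x * y \<in> closure (span S)"
proof -
  have *: "u * v \<in> span S" if "u \<in> span S" "v \<in> span S" for u v
    using that(1)
  proof (induction rule: span_induct_alt)
    case (step c s z)
    have "s * v \<in> span S"
      using that(2)
    proof (induction rule: span_induct_alt)
      case (step c t z)
      then show ?case
        using S[OF \<open>s \<in> S\<close>, of t] by (auto simp: distrib_left intro: span_add span_scale)
    qed (simp add: span_zero)
    with step show ?case
      by (auto simp: distrib_right intro: span_add span_scale)
  qed (simp add: span_zero)
  obtain X Y where "\<And>n. X n \<in> span S" "X \<longlonglongrightarrow> x" "\<And>n. Y n \<in> span S" "Y \<longlonglongrightarrow> y"
    using x y unfolding closure_sequential by blast
  then show ?thesis
    unfolding closure_sequential using * by (intro exI[of _ "\<lambda>n. X n * Y n"]) (auto intro: tendsto_mult)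
qed

lemma closure_of_span_map:
  fixes h :: "'b::real_normed_vector \<Rightarrow> 'b"
  assumes h: "bounded_linear h" and S: "\<And>x. x \<in> S \<Longrightarrow> h x \<in> span S"
    and x: "x \<in> closure (span S)"
  shows "h x \<in> closure (span S)"
proof -
  interpret bounded_linear h by fact
  have *: "h u \<in> span S" if "u \<in> span S" for u
    using that
  proof (induction rule: span_induct_alt)
    case (step c s z)
    then show ?case
      using S[of s] by (auto simp: add scaleR intro: span_add span_scale)
  qed (simp add: zero span_zero)
  obtain X where "\<And>n. X n \<in> span S" "X \<longlonglongrightarrow> x"
    using x unfolding closure_sequential by blast
  then show ?thesis
    unfolding closure_sequential using * tendsto by (intro exI[of _ "\<lambda>n. h (X n)"]) auto
qed

lemma closure_of_span_add:
  fixes S :: "'b::real_normed_vector set"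
  assumes "x \<in> closure (span S)" "y \<in> closure (span S)"
  shows "x + y \<in> closure (span S)"
proof -
  obtain X Y where "\<And>n. X n \<in> span S" "X \<longlonglongrightarrow> x" "\<And>n. Y n \<in> span S" "Y \<longlonglongrightarrow> y"
    using assms unfolding closure_sequential by blast
  then show ?thesis
    unfolding closure_sequential by (intro exI[of _ "\<lambda>n. X n + Y n"]) (auto intro: tendsto_add span_add)
qed

section \<open>The coefficient algebra acting on words\<close>

locale endomorphism_sequence =
  fixes \<rho> :: "nat \<Rightarrow> 'a::cstar_algebra \<Rightarrow> 'a"
  assumes endo: "\<And>n. star_endomorphism (\<rho> n)"
    and nondeg: "\<And>n. nondegenerate (\<rho> n)"
begin

lemma word_endo: "star_endomorphism (word_endo \<rho> w)"
proof (induction w)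
  case (Cons n w)
  then show ?case
    using endo[of n] by (simp add: star_endomorphism_def)
qed (simp add: star_endomorphism_def)

lemmas word_endo_simps = star_endomorphism_simps[OF word_endo]

lemma norm_word_endo_le: "norm (word_endo \<rho> w a) \<le> norm a"
  by (rule norm_star_endomorphism_le[OF word_endo])

lemma unit_element:
  assumes "e > 0"
  obtains u :: 'a where "norm u \<le> 1" "norm (u * a - a) < e" "norm (a * u - a) < e"
  using nondeg[of 0] approximate_unit_element[OF _ assms] unfolding nondegenerate_def by blast

lemma endo_unit_element:
  assumes "e > 0"
  obtains u where "norm u \<le> 1" "norm (\<rho> n u * a - a) < e"
proof -
  obtain F where F: "approximate_unit F" "approximate_unit (filtermap (\<rho> n) F)"
    using nondeg unfolding nondegenerate_def by blast
  then have "F \<noteq> bot" "\<forall>\<^sub>F u in F. norm u \<le> 1"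
    by (auto simp: approximate_unit_def elim: eventually_mono)
  moreover have "((\<lambda>u. \<rho> n u * a) \<longlongrightarrow> a) F"
    using F(2) by (simp add: approximate_unit_def filterlim_filtermap)
  then have "\<forall>\<^sub>F u in F. dist (\<rho> n u * a) a < e"
    using assms by (rule tendstoD)
  ultimately have "\<forall>\<^sub>F u in F. norm u \<le> 1 \<and> norm (\<rho> n u * a - a) < e"
    by (auto simp: dist_norm elim: eventually_elim2)
  then show ?thesis
    using \<open>F \<noteq> bot\<close> that eventually_happens by blast
qed

text \<open>Non-degeneracy survives composition: choose \<open>v\<close> for the tail of the word,
  then \<open>u\<close> such that \<open>\<rho> n u\<close> almost fixes \<open>v\<close>.\<close>

lemma word_endo_unit_element:
  assumes "e > 0"
  obtains u where "norm u \<le> 1" "norm (word_endo \<rho> w u * a - a) < e"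
  using assms
proof (induction w arbitrary: e thesis)
  case Nil
  then show ?case
    using unit_element[OF Nil(2)] by (metis word_endo.simps(1))
next
  case (Cons n w)
  have "e / 3 > 0" using Cons.prems by simp
  obtain v where v: "norm v \<le> 1" "norm (word_endo \<rho> w v * a - a) < e / 3"
    using Cons.IH[OF _ \<open>e / 3 > 0\<close>] by blast
  define K where "K = norm a + 1"
  have "0 < K" by (simp add: K_def add_nonneg_pos)
  then have "e / (3 * K) > 0" using Cons.prems by simp
  then obtain u where u: "norm u \<le> 1" "norm (\<rho> n u * v - v) < e / (3 * K)"
    using endo_unit_element by blast
  let ?p = "word_endo \<rho> w (\<rho> n u)" and ?q = "word_endo \<rho> w v"
  have np: "norm ?p \<le> 1"
    using norm_word_endo_le[of w "\<rho> n u"] norm_star_endomorphism_le[OF endo, of n u] u(1) by linarith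
  \<comment> \<open>Passing from \<open>?p\<close> to \<open>?p * ?q\<close> costs as much as the
    error of \<open>?q\<close> at \<open>a\<close>, because \<open>norm ?p \<le> 1\<close>; the last
    term is the error of \<open>\<rho> n u\<close> at \<open>v\<close>.\<close>
  have "?p * a - a = (?q * a - a) - ?p * (?q * a - a) + word_endo \<rho> w (\<rho> n u * v - v) * a"
    by (simp add: word_endo_simps algebra_simps)
  also have "norm \<dots> \<le> norm (?q * a - a) + norm (?p * (?q * a - a)) + norm (word_endo \<rho> w (\<rho> n u * v - v) * a)"
    by (rule norm_triangle_mono[OF norm_triangle_ineq4 order_refl])
  also have "norm (?p * (?q * a - a)) \<le> norm (?q * a - a)"
    using norm_mult_ineq[of ?p "?q * a - a"] mult_right_mono[OF np, of "norm (?q * a - a)"] by simp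
  also have "norm (word_endo \<rho> w (\<rho> n u * v - v) * a) \<le> e / (3 * K) * norm a"
    using norm_mult_ineq[of "word_endo \<rho> w (\<rho> n u * v - v)" a] norm_word_endo_le[of w "\<rho> n u * v - v"] u(2)
    by (smt (verit) mult_right_mono norm_ge_zero)
  also have "\<dots> \<le> e / 3"
    using \<open>0 < K\<close> Cons.prems(2) by (simp add: K_def field_simps)
  finally have "norm (?p * a - a) < e"
    using v(2) by linarith
  then show ?case
    using Cons.prems(1) u(1) by simp
qed

definition rep :: "'a \<Rightarrow> (nat list, 'a) lop" where
  "rep a = (SOME x. \<forall>f w. l2_nth (x \<bullet>\<^sub>o f) w = word_endo \<rho> w a * l2_nth f w)"

lemma rep_nth: "l2_nth (rep a \<bullet>\<^sub>o f) w = word_endo \<rho> w a * l2_nth f w"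
proof -
  have "\<exists>x. \<forall>f w. l2_nth (x \<bullet>\<^sub>o f) w = word_endo \<rho> w a * l2_nth f w"
    by (rule diagonal_lop_exists[OF norm_word_endo_le])
  from someI_ex[OF this] show ?thesis
    unfolding rep_def by blast
qed

lemma rep_eqI: "(\<And>f w. l2_nth (x \<bullet>\<^sub>o f) w = word_endo \<rho> w a * l2_nth f w) \<Longrightarrow> rep a = x"
  by (intro lop_eqI l2_eqI) (simp add: rep_nth)

lemma rep_add: "rep (a + b) = rep a + rep b"
  and rep_scaleR: "rep (r *\<^sub>R a) = r *\<^sub>R rep a"
  and rep_scaleC: "rep (c *\<^sub>C a) = c *\<^sub>C rep a"
  and rep_mult: "rep (a * b) = rep a * rep b"
  by (rule rep_eqI, simp add: rep_nth word_endo_simps plus_l2.rep_eq scaleR_l2.rep_eq l2_scaleC.rep_eq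
      mult_scaleC_left mult.assoc distrib_right)+

lemma rep_star: "rep (star a) = star (rep a)"
proof (rule sym, rule star_lop_eqI)
  show "l2_inner (rep a \<bullet>\<^sub>o f) g = l2_inner f (rep (star a) \<bullet>\<^sub>o g)" for f g
    by (simp add: l2_inner_def rep_nth word_endo_simps star_mult mult.assoc)
qed

lemma rep_single: "rep a \<bullet>\<^sub>o l2_single w b = l2_single w (word_endo \<rho> w a * b)"
  by (intro l2_eqI) (simp add: rep_nth l2_single.rep_eq)

text \<open>The lower bound comes from the empty word, where \<open>rep a\<close> is left
  multiplication by \<open>a\<close>, tested on \<open>star a\<close>.\<close>

lemma norm_rep [simp]: "norm (rep a) = norm a"
proof (rule antisym)
  show "norm (rep a) \<le> norm a"
  proof (rule norm_lop_le, simp, rule norm_l2_le)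
    fix f :: "(nat list, 'a) l2" and F :: "nat list set" assume "finite F"
    have "norm2 F (l2_nth (rep a \<bullet>\<^sub>o f)) = norm2 F (\<lambda>w. word_endo \<rho> w a * l2_nth f w)"
      by (simp add: rep_nth cong: norm2_cong)
    also have "\<dots> \<le> norm a * norm2 F (l2_nth f)"
      by (intro norm2_mult_left \<open>finite F\<close> norm_word_endo_le) simp
    also have "\<dots> \<le> norm a * norm f"
      by (intro mult_left_mono norm2_le_norm \<open>finite F\<close>) simp
    finally show "norm2 F (l2_nth (rep a \<bullet>\<^sub>o f)) \<le> norm a * norm f" .
  qed
  have "norm (a * star a) \<le> norm (rep a) * norm a"
    using norm_lop_apply_le[of "rep a" "l2_single [] (star a)"] by (simp add: rep_single)
  moreover have "norm (a * star a) = norm a * norm a"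
    using norm_star_mult_self[of "star a"] by (simp add: star_star power2_eq_square)
  ultimately show "norm a \<le> norm (rep a)"
    by (cases "norm a = 0") auto
qed

lemma bounded_linear_rep: "bounded_linear rep"
  by (rule bounded_linear_intro[where K = 1]) (auto simp: rep_add rep_scaleR)

interpretation rep: bounded_linear rep
  by (rule bounded_linear_rep)

lemma rep_isometry: "rep a * isometry_lop n = isometry_lop n * rep (\<rho> n a)"
proof (intro lop_eqI l2_eqI)
  show "l2_nth ((rep a * isometry_lop n) \<bullet>\<^sub>o f) w = l2_nth ((isometry_lop n * rep (\<rho> n a)) \<bullet>\<^sub>o f) w" for f w
    by (cases w) (auto simp: rep_nth isometry_lop_nth)
qed

lemma rep_word_lop: "rep a * word_lop w = word_lop w * rep (word_endo \<rho> w a)"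
proof (induction w arbitrary: a)
  case (Cons n w)
  have "rep a * word_lop (n # w) = isometry_lop n * (rep (\<rho> n a) * word_lop w)"
    by (simp add: rep_isometry flip: mult.assoc)
  with Cons show ?case
    by (simp add: mult.assoc)
qed simp

lemma star_word_lop_rep: "star (word_lop w) * rep a = rep (word_endo \<rho> w a) * star (word_lop w)"
  using arg_cong[OF rep_word_lop[of "star a" w], of star]
  by (simp add: star_mult rep_star word_endo_simps star_star)

section \<open>Monomials and their closed span\<close>

definition monomial :: "nat list \<Rightarrow> 'a \<Rightarrow> nat list \<Rightarrow> (nat list, 'a) lop" where
  "monomial u a v = word_lop u * rep a * star (word_lop v)"

definition monomials :: "(nat list, 'a) lop set" where
  "monomials = {monomial u a v | u a v. True}"

text \<open>The span is real; a complex scalar can be moved into the middle factor of a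
  monomial.\<close>

definition toeplitz :: "(nat list, 'a) lop set" where
  "toeplitz = closure (span monomials)"

lemma monomial_in_monomials: "monomial u a v \<in> monomials"
  by (auto simp: monomials_def)

lemma monomial_in_toeplitz: "monomial u a v \<in> toeplitz"
  unfolding toeplitz_def by (rule subsetD[OF closure_subset span_base[OF monomial_in_monomials]])

lemma rep_eq_monomial: "rep a = monomial [] a []"
  by (simp add: monomial_def)

lemma rep_in_toeplitz: "rep a \<in> toeplitz"
  by (simp add: rep_eq_monomial monomial_in_toeplitz)

text \<open>After the inner words cancel, the remaining word or its adjoint is moved past a
  coefficient, which picks up the endomorphism of that word.\<close>

lemma monomial_mult: "monomial u a v * monomial u' a' v' \<in> span monomials"
proof -
  have eq: "monomial u a v * monomial u' a' v' =
      word_lop u * (rep a * (star (word_lop v) * word_lop u') * rep a') * star (word_lop v')"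
    by (simp add: monomial_def mult.assoc)
  from star_word_lop_mult[of v u'] show ?thesis
  proof (elim disjE exE)
    assume "star (word_lop v) * word_lop u' = (0 :: (nat list, 'a) lop)"
    then show ?thesis
      by (simp add: eq span_zero)
  next
    fix z assume "star (word_lop v) * word_lop u' = (word_lop z :: (nat list, 'a) lop)"
    then have "monomial u a v * monomial u' a' v' = monomial (u @ z) (word_endo \<rho> z a * a') v'"
      unfolding eq by (simp add: rep_word_lop monomial_def word_lop_append rep_mult mult.assoc)
    then show ?thesis
      using span_base monomial_in_monomials by metis
  next
    fix z assume z: "star (word_lop v) * word_lop u' = star (word_lop z :: (nat list, 'a) lop)"
    have "rep a * star (word_lop z) * rep a' = rep (a * word_endo \<rho> z a') * star (word_lop z)"
      by (simp add: star_word_lop_rep rep_mult mult.assoc)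
    then have "monomial u a v * monomial u' a' v' = monomial u (a * word_endo \<rho> z a') (v' @ z)"
      unfolding eq z by (simp add: monomial_def word_lop_append star_mult mult.assoc)
    then show ?thesis
      using span_base monomial_in_monomials by metis
  qed
qed

lemma monomials_mult: "x \<in> monomials \<Longrightarrow> y \<in> monomials \<Longrightarrow> x * y \<in> span monomials"
  using monomial_mult unfolding monomials_def by blast

lemma toeplitz_closed: "closed toeplitz"
  and toeplitz_zero: "0 \<in> toeplitz"
  and toeplitz_add: "x \<in> toeplitz \<Longrightarrow> y \<in> toeplitz \<Longrightarrow> x + y \<in> toeplitz"
  and toeplitz_mult: "x \<in> toeplitz \<Longrightarrow> y \<in> toeplitz \<Longrightarrow> x * y \<in> toeplitz"
  and toeplitz_scaleC: "x \<in> toeplitz \<Longrightarrow> c *\<^sub>C x \<in> toeplitz"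
  and toeplitz_star: "x \<in> toeplitz \<Longrightarrow> star x \<in> toeplitz"
proof -
  show "closed toeplitz" "0 \<in> toeplitz"
    using closure_subset span_zero by (auto simp: toeplitz_def)
  show "x \<in> toeplitz \<Longrightarrow> y \<in> toeplitz \<Longrightarrow> x + y \<in> toeplitz"
    unfolding toeplitz_def by (rule closure_of_span_add)
  show "x \<in> toeplitz \<Longrightarrow> y \<in> toeplitz \<Longrightarrow> x * y \<in> toeplitz"
    unfolding toeplitz_def by (rule closure_of_span_mult[OF monomials_mult])
  have *: "c *\<^sub>C monomial u a v = monomial u (c *\<^sub>C a) v" "star (monomial u a v) = monomial v (star a) u" for u a v
    by (simp_all add: monomial_def rep_scaleC mult_scaleC_left mult_scaleC_right star_mult star_star rep_star mult.assoc)
  have "c *\<^sub>C x \<in> span monomials" "star x \<in> span monomials" if x: "x \<in> monomials" for x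
  proof -
    obtain u a v where "x = monomial u a v"
      using x unfolding monomials_def by blast
    with * show "c *\<^sub>C x \<in> span monomials" "star x \<in> span monomials"
      by (simp_all add: span_base monomial_in_monomials)
  qed
  then show "x \<in> toeplitz \<Longrightarrow> c *\<^sub>C x \<in> toeplitz" "x \<in> toeplitz \<Longrightarrow> star x \<in> toeplitz"
    unfolding toeplitz_def
    using closure_of_span_map[OF bounded_linear_scaleC] closure_of_span_map[OF bounded_linear_star] by blast+
qed

lemma toeplitz_scaleR: "x \<in> toeplitz \<Longrightarrow> r *\<^sub>R x \<in> toeplitz"
  by (simp add: scaleR_scaleC toeplitz_scaleC)

text \<open>Compressing a finite sum of monomials by an isometry with a new letter kills every term
  but those from \<open>\<pi>(A)\<close>; these are also the ones that the vacuum vector sees.\<close>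

lemma compress_span:
  assumes "z \<in> span monomials"
  shows "\<exists>a N. (\<forall>n\<ge>N. star (isometry_lop n) * z * isometry_lop n = rep (\<rho> n a)) \<and>
    (\<forall>c. l2_nth (z \<bullet>\<^sub>o l2_single [] c) [] = a * c)"
  using assms
proof (induction rule: span_induct_alt)
  case base
  show ?case
    by (intro exI[of _ 0]) (simp add: star_endomorphism_simps[OF endo] rep.zero zero_l2.rep_eq)
next
  case (step r x z)
  then obtain a N where a: "\<And>n. n \<ge> N \<Longrightarrow> star (isometry_lop n) * z * isometry_lop n = rep (\<rho> n a)"
    "\<And>c. l2_nth (z \<bullet>\<^sub>o l2_single [] c) [] = a * c"
    by blast
  obtain u b v where x: "x = monomial u b v"
    using step(1) by (auto simp: monomials_def)
  \<comment> \<open>The first letter \<open>m\<close> of the word decides: for n > m the ranges of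
    \<open>V_n\<close> and \<open>V_m\<close> are orthogonal. This is where the threshold for
    \<open>n\<close> comes from.\<close>
  have kill: "star (isometry_lop n) * word_lop u = (0 :: (nat list, 'a) lop)" if "u = m # u'" "m < n" for n m u u'
    using that by (simp add: star_isometry_mult_left)
  have kill': "star (word_lop u) * isometry_lop n = (0 :: (nat list, 'a) lop)" if "u = m # u'" "m < n" for n m u u'
    using arg_cong[OF kill[OF that], of star] by (simp add: star_mult star_star)
  have "\<exists>b0 M. (\<forall>n\<ge>M. star (isometry_lop n) * x * isometry_lop n = rep (\<rho> n b0)) \<and>
      (\<forall>c. l2_nth (x \<bullet>\<^sub>o l2_single [] c) [] = b0 * c)"
  proof (cases u)
    case (Cons m u')
    have "star (isometry_lop n) * x * isometry_lop n = 0" if "n \<ge> Suc m" for n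
      using kill[OF Cons, of n] that by (simp add: x monomial_def flip: mult.assoc)
    moreover have "l2_nth (x \<bullet>\<^sub>o f) [] = 0" for f
      by (simp add: x monomial_def Cons isometry_lop_nth)
    ultimately show ?thesis
      by (intro exI[of _ 0] exI[of _ "Suc m"]) (auto simp: star_endomorphism_simps[OF endo] rep.zero)
  next
    case u: Nil
    show ?thesis
    proof (cases v)
      case (Cons m v')
      have "star (isometry_lop n) * x * isometry_lop n = 0" if "n \<ge> Suc m" for n
        using kill'[OF Cons, of n] that by (simp add: x monomial_def mult.assoc)
      moreover have "star (word_lop v) \<bullet>\<^sub>o l2_single [] c = 0" for c :: 'a
      proof -
        have "star (isometry_lop m) \<bullet>\<^sub>o l2_single [] c = 0"
          by (intro l2_eqI) (simp add: isometry_lop_nth l2_single.rep_eq zero_l2.rep_eq)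
        then show ?thesis
          by (simp add: Cons star_mult)
      qed
      then have "l2_nth (x \<bullet>\<^sub>o l2_single [] c) [] = 0" for c
        by (simp add: x monomial_def zero_l2.rep_eq)
      ultimately show ?thesis
        by (intro exI[of _ 0] exI[of _ "Suc m"]) (auto simp: star_endomorphism_simps[OF endo] rep.zero)
    next
      case Nil
      have "star (isometry_lop n) * x * isometry_lop n = rep (\<rho> n b)" for n
        by (simp add: x u Nil monomial_def mult.assoc rep_isometry star_isometry_mult_left)
      moreover have "l2_nth (x \<bullet>\<^sub>o l2_single [] c) [] = b * c" for c
        by (simp add: x u Nil monomial_def rep_single l2_single.rep_eq)
      ultimately show ?thesis by blast
    qed
  qed
  then obtain b0 M where b: "\<And>n. n \<ge> M \<Longrightarrow> star (isometry_lop n) * x * isometry_lop n = rep (\<rho> n b0)"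
    "\<And>c. l2_nth (x \<bullet>\<^sub>o l2_single [] c) [] = b0 * c"
    by blast
  show ?case
  proof (intro exI[of _ "r *\<^sub>R b0 + a"] exI[of _ "max M N"] conjI allI impI)
    fix n assume "max M N \<le> n"
    then show "star (isometry_lop n) * (r *\<^sub>R x + z) * isometry_lop n = rep (\<rho> n (r *\<^sub>R b0 + a))"
      using a(1)[of n] b(1)[of n]
      by (simp add: distrib_left distrib_right star_endomorphism_simps[OF endo] rep.add rep.scaleR)
  next
    fix c
    show "l2_nth ((r *\<^sub>R x + z) \<bullet>\<^sub>o l2_single [] c) [] = (r *\<^sub>R b0 + a) * c"
      by (simp add: a b plus_l2.rep_eq scaleR_l2.rep_eq distrib_right)
  qed
qed

lemma norm_isometry_rep_le: "norm (isometry_lop n * rep a) \<le> norm a"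
proof -
  have "(norm (isometry_lop n * rep a))\<^sup>2 = norm (rep (star a * a))"
    by (simp add: star_mult star_isometry_mult_left mult.assoc rep_mult rep_star flip: norm_star_mult_self)
  also have "\<dots> = (norm a)\<^sup>2"
    by (simp add: norm_star_mult_self)
  finally show ?thesis
    by (simp add: power2_eq_iff_nonneg)
qed

lemma limsup_endo:
  assumes "limsup (\<lambda>n. ereal (norm (\<rho> n a))) = ereal (norm a)" "0 < e"
  obtains n where "N \<le> n" "norm a - e < norm (\<rho> n a)"
proof (rule ccontr)
  assume "\<not> thesis"
  with that have "\<forall>n\<ge>N. norm (\<rho> n a) \<le> norm a - e"
    by (metis linorder_not_less)
  then have "\<forall>\<^sub>F n in sequentially. ereal (norm (\<rho> n a)) \<le> ereal (norm a - e)"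
    unfolding eventually_sequentially by auto
  then have "limsup (\<lambda>n. ereal (norm (\<rho> n a))) \<le> ereal (norm a - e)"
    by (rule Limsup_bounded)
  with assms show False by simp
qed

section \<open>Nonzero ideals of the concrete algebra\<close>

context
  fixes J :: "(nat list, 'a) lop set"
  assumes limsup_norm: "\<And>a. limsup (\<lambda>n. ereal (norm (\<rho> n a))) = ereal (norm a)"
    and J: "J \<subseteq> toeplitz" "0 \<in> J" "closed J" "\<And>x y. x \<in> J \<Longrightarrow> y \<in> J \<Longrightarrow> x + y \<in> J"
      "\<And>c x. x \<in> J \<Longrightarrow> c *\<^sub>C x \<in> J"
      "\<And>x y. x \<in> toeplitz \<Longrightarrow> y \<in> J \<Longrightarrow> x * y \<in> J" "\<And>x y. x \<in> toeplitz \<Longrightarrow> y \<in> J \<Longrightarrow> y * x \<in> J"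
begin

lemma J_scaleR: "x \<in> J \<Longrightarrow> r *\<^sub>R x \<in> J"
  by (simp add: scaleR_scaleC J(5))

text \<open>If \<open>x\<close> in \<open>J\<close> does not vanish at a vector that
  \<open>m\<close> produces from the vacuum, then \<open>star m * (star x * x) * m\<close> lies in
  \<open>J\<close>, and its vacuum expectation is the inner square of the image of that vector under
  \<open>x\<close>.\<close>

lemma J_vacuum:
  assumes "J \<noteq> {0}"
  obtains y c where "y \<in> J" "l2_nth (y \<bullet>\<^sub>o l2_single [] c) [] \<noteq> 0"
proof -
  obtain x where x: "x \<in> J" "x \<noteq> 0"
    using assms J(2) by blast
  obtain w b where wb: "x \<bullet>\<^sub>o l2_single w b \<noteq> 0"
  proof (rule ccontr)
    assume "\<not> thesis"
    with that have zero: "x \<bullet>\<^sub>o l2_single w b = 0" for w b by blast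
    have "closed {f. x \<bullet>\<^sub>o f = 0}"
      by (rule closed_Collect_eq[OF bounded_linear.continuous_on[OF bounded_linear_lop_apply continuous_on_id] continuous_on_const])
    then have "f \<in> {f. x \<bullet>\<^sub>o f = 0}" for f
      by (induction rule: l2_induct) (auto simp: zero)
    then have "x = 0"
      by (intro lop_eqI) simp
    with x show False by simp
  qed
  \<comment> \<open>Vacuum vectors are \<delta>_[] \<otimes> c, and \<open>m\<close> sends them to
    \<delta>_w \<otimes> b c. Without a unit, the vector \<delta>_w \<otimes> b itself is only
    approximated in this way.\<close>
  have "\<exists>c. x \<bullet>\<^sub>o l2_single w (b * c) \<noteq> 0"
  proof (rule ccontr)
    assume "\<not> ?thesis"
    then have zero: "x \<bullet>\<^sub>o l2_single w (b * c) = 0" for c by blast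
    define e where "e = norm (x \<bullet>\<^sub>o l2_single w b)"
    have "0 < e" using wb by (simp add: e_def)
    then have "0 < e / (norm x + 1)"
      by (simp add: add_nonneg_pos)
    then obtain c where c: "norm c \<le> 1" "norm (b * c - b) < e / (norm x + 1)"
      using unit_element by blast
    have "l2_single w b = l2_single w (b - b * c) + l2_single w (b * c)"
      by (rule l2_eqI) (simp add: plus_l2.rep_eq l2_single.rep_eq)
    then have "x \<bullet>\<^sub>o l2_single w b = x \<bullet>\<^sub>o l2_single w (b - b * c)"
      by (simp add: zero)
    then have "e \<le> norm x * norm (b - b * c)"
      using norm_lop_apply_le[of x "l2_single w (b - b * c)"] by (simp add: e_def)
    also have "\<dots> \<le> (norm x + 1) * norm (b * c - b)"
      by (simp add: norm_minus_commute mult_right_mono)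
    also have "\<dots> < e"
      using c(2) by (simp add: pos_less_divide_eq add_nonneg_pos mult.commute)
    finally show False by simp
  qed
  then obtain c where c: "x \<bullet>\<^sub>o l2_single w (b * c) \<noteq> 0" by blast
  define m where "m = monomial w b []"
  have m: "m \<bullet>\<^sub>o l2_single [] c = l2_single w (b * c)"
    by (simp add: m_def monomial_def rep_single word_lop_single)
  define y where "y = star m * (star x * x) * m"
  have "star x \<in> toeplitz" "m \<in> toeplitz" "star m \<in> toeplitz"
    using x J(1) by (auto simp: m_def monomial_in_toeplitz toeplitz_star)
  then have "y \<in> J"
    unfolding y_def using x J(6,7) by blast
  moreover have "l2_inner (l2_single [] c) (y \<bullet>\<^sub>o l2_single [] c) =
      l2_inner (x \<bullet>\<^sub>o l2_single w (b * c)) (x \<bullet>\<^sub>o l2_single w (b * c))"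
    by (simp add: y_def m flip: star_lop)
  then have "l2_inner (l2_single [] c) (y \<bullet>\<^sub>o l2_single [] c) \<noteq> 0"
    using c by (metis norm_eq_zero norm_l2_power2 norm_zero power_eq_0_iff)
  then have "l2_nth (y \<bullet>\<^sub>o l2_single [] c) [] \<noteq> 0"
    by (auto simp: l2_inner_single_left)
  ultimately show ?thesis
    by (rule that)
qed

lemma J_close_to_rep:
  assumes "J \<noteq> {0}"
  obtains d j where "norm d = 1" "j \<in> J" "norm (rep d - j) \<le> 1 / 48"
proof -
  obtain y0 c where y0: "y0 \<in> J" "l2_nth (y0 \<bullet>\<^sub>o l2_single [] c) [] \<noteq> 0"
    using J_vacuum[OF assms] .
  \<comment> \<open>After this scaling the vacuum component of \<open>y\<close> at \<open>c\<close>
    has the norm of \<open>c\<close>, which forces the diagonal coefficient \<open>a\<close> of an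
    approximant to have norm at least \<open>1 - \<eta>\<close>.\<close>
  define \<kappa> where "\<kappa> = norm (l2_nth (y0 \<bullet>\<^sub>o l2_single [] c) []) / norm c"
  have "c \<noteq> 0"
  proof
    assume "c = 0"
    then have "(l2_single [] c :: (nat list, 'a) l2) = 0"
      by (intro l2_eqI) (simp add: l2_single.rep_eq zero_l2.rep_eq)
    with y0(2) show False by (simp add: zero_l2.rep_eq)
  qed
  with y0 have "0 < \<kappa>" by (simp add: \<kappa>_def)
  define y where "y = (1 / \<kappa>) *\<^sub>R y0"
  have y: "y \<in> J"
    unfolding y_def by (rule J_scaleR[OF y0(1)])
  have ny: "norm (l2_nth (y \<bullet>\<^sub>o l2_single [] c) []) = norm c"
    using \<open>0 < \<kappa>\<close> \<open>c \<noteq> 0\<close> y0(2) by (simp add: y_def scaleR_l2.rep_eq \<kappa>_def)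
  \<comment> \<open>The lower bound for \<open>norm d\<close> loses \<open>\<eta>\<close> three
    times: in the approximation of \<open>y\<close>, in the choice of \<open>n\<close> and in the
    cut-off by \<open>u\<close>. The distance to \<open>J\<close> is at most \<open>\<eta>\<close>,
    and after normalisation at most 1/97, below the required 1/48.\<close>
  define \<eta> :: real where "\<eta> = 1 / 100"
  have "\<eta> > 0" by (simp add: \<eta>_def)
  obtain z where z: "z \<in> span monomials" "norm (z - y) < \<eta>"
  proof -
    have "y \<in> closure (span monomials)"
      using subsetD[OF J(1) y] by (simp add: toeplitz_def)
    from closure_approachable[THEN iffD1, OF this, rule_format, OF \<open>\<eta> > 0\<close>] show ?thesis
      using that by (auto simp: dist_norm)
  qed
  obtain a N where a: "\<And>n. n \<ge> N \<Longrightarrow> star (isometry_lop n) * z * isometry_lop n = rep (\<rho> n a)"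
    "\<And>c. l2_nth (z \<bullet>\<^sub>o l2_single [] c) [] = a * c"
    using compress_span[OF z(1)] by blast
  have "norm c \<le> norm (l2_nth (z \<bullet>\<^sub>o l2_single [] c) []) + norm (l2_nth ((z - y) \<bullet>\<^sub>o l2_single [] c) [])"
    using norm_triangle_ineq4[of "l2_nth (z \<bullet>\<^sub>o l2_single [] c) []" "l2_nth ((z - y) \<bullet>\<^sub>o l2_single [] c) []"] ny
    by (simp add: minus_l2.rep_eq)
  also have "norm (l2_nth ((z - y) \<bullet>\<^sub>o l2_single [] c) []) \<le> norm (z - y) * norm c"
    using norm_l2_nth_le norm_lop_apply_le by (metis norm_l2_single order_trans)
  also have "\<dots> \<le> \<eta> * norm c"
    using z(2) by (intro mult_right_mono) auto
  also have "norm (l2_nth (z \<bullet>\<^sub>o l2_single [] c) []) \<le> norm a * norm c"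
    unfolding a(2) by (rule norm_mult_ineq)
  finally have "1 * norm c \<le> (norm a + \<eta>) * norm c"
    by (simp add: distrib_right)
  then have na: "1 - \<eta> \<le> norm a"
    using \<open>c \<noteq> 0\<close> by (simp only: mult_le_cancel_right) auto
  obtain n where n: "N \<le> n" "norm a - \<eta> < norm (\<rho> n a)"
    using limsup_endo[OF limsup_norm \<open>\<eta> > 0\<close>] .
  define b where "b = \<rho> n a"
  obtain u where u: "norm u \<le> 1" "norm (u * b - b) < \<eta> / 2" "norm (b * u - b) < \<eta> / 2"
    using unit_element[of "\<eta> / 2"] \<open>\<eta> > 0\<close> by auto
  \<comment> \<open>The compression is made with \<open>m\<close> and \<open>k\<close>, which lie in
    the algebra, in place of \<open>V_n\<close> and its adjoint. It produces
    \<open>u * b * u\<close> instead of \<open>b\<close>, which \<open>u\<close> almost fixes from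
    both sides.\<close>
  define m where "m = isometry_lop n * rep u"
  have nm: "norm m \<le> 1"
    using norm_isometry_rep_le[of n u] u(1) by (auto simp: m_def)
  have m_toeplitz: "m \<in> toeplitz"
    using monomial_in_toeplitz[of "[n]" u "[]"] by (simp add: monomial_def m_def)
  define k where "k = rep u * star (isometry_lop n)"
  have k_toeplitz: "k \<in> toeplitz"
    using monomial_in_toeplitz[of "[]" u "[n]"] by (simp add: monomial_def k_def)
  have "k = star (isometry_lop n * rep (star u))"
    by (simp add: k_def star_mult rep_star star_star)
  then have nk: "norm k \<le> 1"
    using norm_isometry_rep_le[of n "star u"] u(1) by simp
  define d where "d = u * b * u"
  have "k * z * m = rep u * (star (isometry_lop n) * z * isometry_lop n) * rep u"
    by (simp add: k_def m_def mult.assoc)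
  then have kzm: "k * z * m = rep d"
    using a(1)[OF n(1)] by (simp add: d_def b_def rep_mult)
  have j: "k * y * m \<in> J"
    using J(6)[OF k_toeplitz y] J(7)[OF m_toeplitz] by blast
  have "norm (k * (z - y) * m) \<le> norm k * norm (z - y) * norm m"
    by (rule order_trans[OF norm_mult_ineq mult_right_mono[OF norm_mult_ineq]]) simp
  also have "\<dots> \<le> 1 * \<eta> * 1"
    using nk nm z(2) \<open>\<eta> > 0\<close> by (intro mult_mono) auto
  finally have close: "norm (rep d - k * y * m) \<le> \<eta>"
    by (simp add: right_diff_distrib left_diff_distrib kzm)
  have "d - b = u * (b * u - b) + (u * b - b)"
    by (simp add: d_def algebra_simps)
  also have "norm \<dots> \<le> norm u * norm (b * u - b) + norm (u * b - b)"
    by (rule norm_triangle_mono[OF norm_mult_ineq order_refl])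
  also have "\<dots> \<le> 1 * (\<eta> / 2) + \<eta> / 2"
    using u by (intro add_mono mult_mono) auto
  finally have "norm (d - b) \<le> \<eta>" by simp
  then have nd: "97 / 100 \<le> norm d"
    using norm_triangle_ineq2[of b d] n(2) na by (simp add: b_def \<eta>_def norm_minus_commute)
  then have "0 < norm d" by linarith
  define d' j' where "d' = (1 / norm d) *\<^sub>R d" and "j' = (1 / norm d) *\<^sub>R (k * y * m)"
  have "norm d' = 1"
    using \<open>0 < norm d\<close> by (simp add: d'_def)
  moreover have "j' \<in> J"
    unfolding j'_def by (rule J_scaleR[OF j])
  moreover have "norm (rep d' - j') \<le> 1 / 48"
  proof -
    have "rep d' - j' = (1 / norm d) *\<^sub>R (rep d - k * y * m)"
      by (simp add: d'_def j'_def rep.scaleR scaleR_diff_right)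
    then have "norm (rep d' - j') = norm (rep d - k * y * m) / norm d"
      by simp
    also have "\<dots> \<le> (1 / 100) / (97 / 100)"
      using close nd by (intro frac_le) (auto simp: \<eta>_def)
    finally show ?thesis by simp
  qed
  ultimately show ?thesis
    by (rule that)
qed

lemma J_meets_rep:
  assumes "J \<noteq> {0}"
  obtains g where "g \<noteq> 0" "rep g \<in> J"
proof -
  obtain d j where "norm d = 1" "j \<in> J" "norm (rep d - j) \<le> 1 / 48"
    using J_close_to_rep[OF assms] .
  then show ?thesis
    using ideal_meets_subalgebra[OF bounded_linear_rep rep_mult rep_star norm_rep rep_in_toeplitz J(1-4) J_scaleR J(6,7)
        toeplitz_add toeplitz_scaleR toeplitz_mult toeplitz_star] that by blast
qed

lemma closed_ideal_rep_vimage: "closed_ideal {a. rep a \<in> J}"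
  unfolding closed_ideal_def
proof (intro conjI ballI allI)
  show "closed {a. rep a \<in> J}"
    using closed_vimage[OF J(3) bounded_linear.continuous_on[OF bounded_linear_rep continuous_on_id]]
    by (simp add: vimage_def)
qed (auto simp: rep.zero rep.add rep_mult rep_scaleC J rep_in_toeplitz)

text \<open>Compression of \<open>rep a\<close> by \<open>V_n\<close> gives
  \<open>rep (\<rho> n a)\<close>. As \<open>V_n\<close> is available only next to coefficients, the
  ideal property yields \<open>rep (v * \<rho> n a * u)\<close>; an approximate unit and closedness
  of \<open>J\<close> remove \<open>u\<close> and \<open>v\<close>.\<close>

lemma rep_vimage_invariant:
  assumes "rep a \<in> J"
  shows "rep (\<rho> n a) \<in> J"
proof -
  let ?b = "\<rho> n a"
  have in_J: "rep (v * ?b * u) \<in> J" for u v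
  proof -
    have "rep (v * ?b * u) = (rep v * star (isometry_lop n)) * rep a * (isometry_lop n * rep u)"
    proof -
      have "(rep v * star (isometry_lop n)) * rep a * (isometry_lop n * rep u) =
          rep v * (star (isometry_lop n) * (rep a * isometry_lop n)) * rep u"
        by (simp add: mult.assoc)
      also have "star (isometry_lop n) * (rep a * isometry_lop n) = rep ?b"
        by (simp add: rep_isometry star_isometry_mult_left)
      finally show ?thesis by (simp add: rep_mult)
    qed
    moreover have "rep v * star (isometry_lop n) \<in> toeplitz" "isometry_lop n * rep u \<in> toeplitz"
      using monomial_in_toeplitz[of "[]" v "[n]"] monomial_in_toeplitz[of "[n]" u "[]"]
      by (simp_all add: monomial_def)
    ultimately show ?thesis
      using assms J(6,7) by simp
  qed
  have "rep ?b \<in> closure J"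
    unfolding closure_approachable
  proof (intro allI impI)
    fix e :: real assume "e > 0"
    then obtain u where u: "norm u \<le> 1" "norm (u * ?b - ?b) < e / 2" "norm (?b * u - ?b) < e / 2"
      using unit_element[of "e / 2"] by auto
    have "u * ?b * u - ?b = u * (?b * u - ?b) + (u * ?b - ?b)"
      by (simp add: algebra_simps)
    also have "norm \<dots> \<le> norm u * norm (?b * u - ?b) + norm (u * ?b - ?b)"
      by (rule norm_triangle_mono[OF norm_mult_ineq order_refl])
    also have "\<dots> < 1 * (e / 2) + e / 2"
      using u by (intro add_le_less_mono mult_mono) auto
    finally have "norm (rep (u * ?b * u - ?b)) < e"
      by simp
    then show "\<exists>x\<in>J. dist x (rep ?b) < e"
      using in_J by (intro bexI[of _ "rep (u * ?b * u)"]) (auto simp: dist_norm simp flip: rep.diff)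
  qed
  then show ?thesis
    using J(3) by simp
qed

text \<open>A monomial with middle factor p a q contains \<open>rep a\<close> as a factor between
  two elements of the algebra, hence lies in \<open>J\<close>. Taking for \<open>p\<close> and
  \<open>q\<close> the same approximate unit element brings p a q arbitrarily close to
  \<open>a\<close>.\<close>

lemma toeplitz_subset_if_rep:
  assumes "\<And>a. rep a \<in> J"
  shows "toeplitz \<subseteq> J"
proof -
  have monomial_J: "monomial u a v \<in> J" for u a v
  proof -
    have "monomial u a v \<in> closure J"
      unfolding closure_approachable
    proof (intro allI impI)
      fix e :: real assume "e > 0"
      have in_J: "monomial u (p * a * q) v \<in> J" for p q
      proof -
        have "monomial u (p * a * q) v = monomial u p [] * rep a * monomial [] q v"
          by (simp add: monomial_def rep_mult mult.assoc)
        then show ?thesis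
          using assms J(6,7) monomial_in_toeplitz by simp
      qed
      define K where "K = norm (word_lop u :: (nat list, 'a) lop) * norm (word_lop v :: (nat list, 'a) lop) + 1"
      have "K > 0" by (simp add: K_def add_nonneg_pos)
      then have "e / (2 * K) > 0" using \<open>e > 0\<close> by simp
      then obtain p where p: "norm p \<le> 1" "norm (p * a - a) < e / (2 * K)" "norm (a * p - a) < e / (2 * K)"
        using unit_element by blast
      have "p * a * p - a = p * (a * p - a) + (p * a - a)"
        by (simp add: algebra_simps)
      also have "norm \<dots> \<le> norm p * norm (a * p - a) + norm (p * a - a)"
        by (rule norm_triangle_mono[OF norm_mult_ineq order_refl])
      also have "\<dots> < 1 * (e / (2 * K)) + e / (2 * K)"
        using p by (intro add_le_less_mono mult_mono) auto
      also have "\<dots> = e / K"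
        by simp
      finally have diff: "norm (p * a * p - a) < e / K" .
      have "monomial u (p * a * p) v - monomial u a v = word_lop u * rep (p * a * p - a) * star (word_lop v)"
        by (simp add: monomial_def rep.diff right_diff_distrib left_diff_distrib)
      also have "norm \<dots> \<le> norm (word_lop u :: (nat list, 'a) lop) * norm (rep (p * a * p - a)) * norm (star (word_lop v :: (nat list, 'a) lop))"
        by (rule order_trans[OF norm_mult_ineq mult_right_mono[OF norm_mult_ineq]]) simp
      also have "\<dots> \<le> K * norm (p * a * p - a)"
        by (simp add: K_def distrib_right)
      also have "\<dots> < e"
        using diff \<open>K > 0\<close> by (simp add: field_simps)
      finally show "\<exists>x\<in>J. dist x (monomial u a v) < e"
        using in_J by (intro bexI[of _ "monomial u (p * a * p) v"]) (auto simp: dist_norm)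
    qed
    then show ?thesis using J(3) by simp
  qed
  have "x \<in> J" if "x \<in> span monomials" for x
    using that
  proof (induction rule: span_induct_alt)
    case (step c x y)
    then show ?case by (auto simp: monomials_def intro: J(4) J_scaleR monomial_J)
  qed (rule J(2))
  then show ?thesis
    unfolding toeplitz_def using J(3) by (intro closure_minimal) auto
qed

lemma toeplitz_simple:
  assumes no_ideal: "\<not> (\<exists>I. closed_ideal I \<and> I \<noteq> {0} \<and> I \<noteq> UNIV \<and> (\<forall>n. \<rho> n ` I \<subseteq> I))"
    and "J \<noteq> {0}"
  shows "J = toeplitz"
proof -
  obtain g where "g \<noteq> 0" "rep g \<in> J"
    using J_meets_rep[OF \<open>J \<noteq> {0}\<close>] .
  then have "{a. rep a \<in> J} \<noteq> {0}" by auto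
  moreover have "\<rho> n ` {a. rep a \<in> J} \<subseteq> {a. rep a \<in> J}" for n
    using rep_vimage_invariant by auto
  ultimately have "{a. rep a \<in> J} = UNIV"
    using no_ideal closed_ideal_rep_vimage by blast
  then show ?thesis
    using toeplitz_subset_if_rep J(1) by blast
qed

end

end

section \<open>Embeddings of modules and their completions\<close>

text \<open>A realisation of a semi-inner product module in \<open>l2\<close>. Injectivity is not
  asked for, as formal sums of tensors may have length 0; the vectors of length 0 are exactly those
  sent to 0.\<close>

definition module_embedding :: "('a::cstar_algebra, 'e) hmodule \<Rightarrow> ('e \<Rightarrow> ('i, 'a) l2) \<Rightarrow> bool" where
  "module_embedding M \<phi> \<longleftrightarrow> hzero M \<in> hcarrier M \<and> \<phi> (hzero M) = 0 \<and>
     (\<forall>x\<in>hcarrier M. \<forall>y\<in>hcarrier M. hadd M x y \<in> hcarrier M \<and> \<phi> (hadd M x y) = \<phi> x + \<phi> y \<and>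
        hinner M x y = l2_inner (\<phi> x) (\<phi> y)) \<and>
     (\<forall>c. \<forall>x\<in>hcarrier M. hscale M c x \<in> hcarrier M \<and> \<phi> (hscale M c x) = l2_scaleC c (\<phi> x))"

lemma module_embeddingD:
  assumes "module_embedding M \<phi>"
  shows "hzero M \<in> hcarrier M" "\<phi> (hzero M) = 0"
    "x \<in> hcarrier M \<Longrightarrow> y \<in> hcarrier M \<Longrightarrow> hadd M x y \<in> hcarrier M"
    "x \<in> hcarrier M \<Longrightarrow> y \<in> hcarrier M \<Longrightarrow> \<phi> (hadd M x y) = \<phi> x + \<phi> y"
    "x \<in> hcarrier M \<Longrightarrow> y \<in> hcarrier M \<Longrightarrow> hinner M x y = l2_inner (\<phi> x) (\<phi> y)"
    "x \<in> hcarrier M \<Longrightarrow> hscale M c x \<in> hcarrier M"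
    "x \<in> hcarrier M \<Longrightarrow> \<phi> (hscale M c x) = l2_scaleC c (\<phi> x)"
  using assms by (auto simp: module_embedding_def)

lemma l2_scaleC_minus_one: "l2_scaleC (- 1) f = - f"
  using l2_scaleC_of_real[of "- 1" f] by simp

lemma hdiff_embedding:
  assumes "module_embedding M \<phi>" "x \<in> hcarrier M" "y \<in> hcarrier M"
  shows "hdiff M x y \<in> hcarrier M" "\<phi> (hdiff M x y) = \<phi> x - \<phi> y"
  using module_embeddingD[OF assms(1)] assms(2,3) by (auto simp: hdiff_def l2_scaleC_minus_one)

lemma hnorm_embedding:
  assumes "module_embedding M \<phi>" "x \<in> hcarrier M"
  shows "hnorm M x = norm (\<phi> x)"
  using module_embeddingD[OF assms(1)] assms(2) by (simp add: hnorm_def norm_l2_def)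

lemma hnorm_hdiff_embedding:
  assumes "module_embedding M \<phi>" "x \<in> hcarrier M" "y \<in> hcarrier M"
  shows "hnorm M (hdiff M x y) = norm (\<phi> x - \<phi> y)"
  using hdiff_embedding[OF assms] hnorm_embedding[OF assms(1)] by simp

lemma hcauchy_embedding:
  assumes "module_embedding M \<phi>"
  shows "hcauchy M u \<longleftrightarrow> (\<forall>n. u n \<in> hcarrier M) \<and> Cauchy (\<lambda>n. \<phi> (u n))"
proof (cases "\<forall>n. u n \<in> hcarrier M")
  case True
  then show ?thesis
    by (simp add: hcauchy_def Cauchy_def dist_norm hnorm_hdiff_embedding[OF assms])
qed (auto simp: hcauchy_def)

lemma hcauchy_if_tendsto:
  assumes "module_embedding M \<phi>" "\<And>n. u n \<in> hcarrier M" "(\<lambda>n. \<phi> (u n)) \<longlonglongrightarrow> f"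
  shows "hcauchy M u"
  using assms LIMSEQ_imp_Cauchy by (auto simp: hcauchy_embedding)

lemma hcauchy_tendsto:
  assumes "module_embedding M \<phi>" "hcauchy M u"
  shows "(\<lambda>n. \<phi> (u n)) \<longlonglongrightarrow> lim (\<lambda>n. \<phi> (u n))"
  using assms by (simp add: hcauchy_embedding Cauchy_convergent_iff convergent_LIMSEQ_iff)

text \<open>Cauchy sequences are identified exactly if their images have the same limit, so a class
  amounts to a point of the closure of the image.\<close>

lemma mem_hclass_iff:
  assumes M: "module_embedding M \<phi>" and u: "hcauchy M u"
  shows "v \<in> hclass M u \<longleftrightarrow> hcauchy M v \<and> lim (\<lambda>n. \<phi> (v n)) = lim (\<lambda>n. \<phi> (u n))"
proof (cases "hcauchy M v")
  case True
  let ?a = "lim (\<lambda>n. \<phi> (u n))" and ?b = "lim (\<lambda>n. \<phi> (v n))"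
  have "hnorm M (hdiff M (u n) (v n)) = norm (\<phi> (u n) - \<phi> (v n))" for n
    using u True by (intro hnorm_hdiff_embedding M) (auto simp: hcauchy_def)
  then have "v \<in> hclass M u \<longleftrightarrow> (\<lambda>n. norm (\<phi> (u n) - \<phi> (v n))) \<longlonglongrightarrow> 0"
    using True by (simp add: hclass_def)
  moreover have L: "(\<lambda>n. norm (\<phi> (u n) - \<phi> (v n))) \<longlonglongrightarrow> norm (?a - ?b)"
    by (intro tendsto_norm tendsto_diff hcauchy_tendsto[OF M u] hcauchy_tendsto[OF M True])
  have "(\<lambda>n. norm (\<phi> (u n) - \<phi> (v n))) \<longlonglongrightarrow> 0 \<longleftrightarrow> norm (?a - ?b) = 0"
  proof
    assume "norm (?a - ?b) = 0"
    with L show "(\<lambda>n. norm (\<phi> (u n) - \<phi> (v n))) \<longlonglongrightarrow> 0" by (simp only:)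
  qed (rule LIMSEQ_unique[OF L])
  ultimately show ?thesis
    using True by auto
qed (simp add: hclass_def)

definition completion_embedding :: "('e \<Rightarrow> ('i, 'a::cstar_algebra) l2) \<Rightarrow> (nat \<Rightarrow> 'e) set \<Rightarrow> ('i, 'a) l2" where
  "completion_embedding \<phi> X = lim (\<lambda>k. \<phi> (hrep X k))"

text \<open>The choice made by \<open>hrep\<close> is harmless: all members of a class have the same
  limit in \<open>l2\<close>.\<close>

lemma hrep_hclass:
  assumes M: "module_embedding M \<phi>" and u: "hcauchy M u"
  shows "hcauchy M (hrep (hclass M u))" "completion_embedding \<phi> (hclass M u) = lim (\<lambda>n. \<phi> (u n))"
proof -
  have "u \<in> hclass M u"
    using mem_hclass_iff[OF M u] u by simp
  then have "hrep (hclass M u) \<in> hclass M u"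
    unfolding hrep_def by (rule someI[where P = "\<lambda>v. v \<in> hclass M u"])
  then show "hcauchy M (hrep (hclass M u))" "completion_embedding \<phi> (hclass M u) = lim (\<lambda>n. \<phi> (u n))"
    using mem_hclass_iff[OF M u] by (auto simp: completion_embedding_def)
qed

lemma hclass_of_tendsto:
  assumes M: "module_embedding M \<phi>" and u: "\<And>n. u n \<in> hcarrier M" and f: "(\<lambda>n. \<phi> (u n)) \<longlonglongrightarrow> f"
  shows "hclass M u \<in> hcarrier (completion M)" "completion_embedding \<phi> (hclass M u) = f"
proof -
  have "hcauchy M u"
    using assms by (rule hcauchy_if_tendsto)
  then show "hclass M u \<in> hcarrier (completion M)" "completion_embedding \<phi> (hclass M u) = f"
    using hrep_hclass[OF M] f by (auto simp: completion_def limI)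
qed

lemma hrep_completion:
  assumes M: "module_embedding M \<phi>" and X: "X \<in> hcarrier (completion M)"
  shows "hrep X n \<in> hcarrier M" "(\<lambda>k. \<phi> (hrep X k)) \<longlonglongrightarrow> completion_embedding \<phi> X"
proof -
  obtain u where "X = hclass M u" "hcauchy M u"
    using X by (auto simp: completion_def)
  then have "hcauchy M (hrep X)"
    using hrep_hclass(1)[OF M] by blast
  then show "hrep X n \<in> hcarrier M" "(\<lambda>k. \<phi> (hrep X k)) \<longlonglongrightarrow> completion_embedding \<phi> X"
    unfolding completion_embedding_def using hcauchy_tendsto[OF M] by (auto simp: hcauchy_def)
qed

lemma module_embedding_completion:
  assumes M: "module_embedding M \<phi>"
  shows "module_embedding (completion M) (completion_embedding \<phi>)"
  unfolding module_embedding_def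
proof (intro conjI ballI allI)
  note MD = module_embeddingD[OF M] and rep = hrep_completion[OF M]
  have "(\<lambda>k. \<phi> (hzero M)) \<longlonglongrightarrow> 0"
    by (simp add: MD)
  note * = hclass_of_tendsto[OF M MD(1) this]
  show "hzero (completion M) \<in> hcarrier (completion M)" "completion_embedding \<phi> (hzero (completion M)) = 0"
    using * by (simp_all add: completion_def)
  fix X assume X: "X \<in> hcarrier (completion M)"
  {
    fix Y assume Y: "Y \<in> hcarrier (completion M)"
    have "(\<lambda>k. \<phi> (hadd M (hrep X k) (hrep Y k))) \<longlonglongrightarrow> completion_embedding \<phi> X + completion_embedding \<phi> Y"
      using rep[OF X] rep[OF Y] by (simp add: MD tendsto_add)
    note * = hclass_of_tendsto[OF M _ this]
    show "hadd (completion M) X Y \<in> hcarrier (completion M)"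
      "completion_embedding \<phi> (hadd (completion M) X Y) = completion_embedding \<phi> X + completion_embedding \<phi> Y"
      using * rep(1)[OF X] rep(1)[OF Y] MD(3) by (simp_all add: completion_def)
    have "(\<lambda>k. hinner M (hrep X k) (hrep Y k)) \<longlonglongrightarrow> l2_inner (completion_embedding \<phi> X) (completion_embedding \<phi> Y)"
      using rep[OF X] rep[OF Y] by (simp add: MD l2_inner.tendsto)
    then show "hinner (completion M) X Y = l2_inner (completion_embedding \<phi> X) (completion_embedding \<phi> Y)"
      by (simp add: completion_def limI)
  }
  fix c
  have "(\<lambda>k. \<phi> (hscale M c (hrep X k))) \<longlonglongrightarrow> l2_scaleC c (completion_embedding \<phi> X)"
    using rep[OF X] by (simp add: MD bounded_linear.tendsto[OF l2_scaleC_linear])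
  note * = hclass_of_tendsto[OF M _ this]
  show "hscale (completion M) c X \<in> hcarrier (completion M)"
    "completion_embedding \<phi> (hscale (completion M) c X) = l2_scaleC c (completion_embedding \<phi> X)"
    using * rep(1)[OF X] MD(6) by (simp_all add: completion_def)
qed

lemma completion_embedding_inj:
  assumes M: "module_embedding M \<phi>"
  shows "inj_on (completion_embedding \<phi>) (hcarrier (completion M))"
proof (rule inj_onI)
  fix X Y assume "X \<in> hcarrier (completion M)" "Y \<in> hcarrier (completion M)"
    and eq: "completion_embedding \<phi> X = completion_embedding \<phi> Y"
  then obtain u v where "X = hclass M u" "hcauchy M u" "Y = hclass M v" "hcauchy M v"
    by (auto simp: completion_def)
  moreover from this eq have "lim (\<lambda>n. \<phi> (u n)) = lim (\<lambda>n. \<phi> (v n))"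
    using hrep_hclass(2)[OF M] by metis
  ultimately show "X = Y"
    by (auto simp: mem_hclass_iff[OF M])
qed

lemma completion_embedding_image:
  assumes M: "module_embedding M \<phi>"
  shows "completion_embedding \<phi> ` hcarrier (completion M) = closure (\<phi> ` hcarrier M)"
proof (intro equalityI subsetI)
  fix f assume "f \<in> completion_embedding \<phi> ` hcarrier (completion M)"
  then obtain X where "X \<in> hcarrier (completion M)" "f = completion_embedding \<phi> X"
    by blast
  with hrep_completion[OF M, of X] show "f \<in> closure (\<phi> ` hcarrier M)"
    unfolding closure_sequential by (intro exI[of _ "\<lambda>k. \<phi> (hrep X k)"]) simp
next
  fix f assume "f \<in> closure (\<phi> ` hcarrier M)"
  then obtain v where "\<And>n. v n \<in> \<phi> ` hcarrier M" "v \<longlonglongrightarrow> f"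
    unfolding closure_sequential by blast
  then obtain u where u: "\<And>n. u n \<in> hcarrier M" "v = (\<lambda>n. \<phi> (u n))"
    unfolding image_iff by (metis (no_types, lifting))
  with hclass_of_tendsto[OF M, of u f] \<open>v \<longlonglongrightarrow> f\<close>
  show "f \<in> completion_embedding \<phi> ` hcarrier (completion M)"
    by (metis image_eqI)
qed

text \<open>A map that lifts a bounded operator acts on the completion as that operator. It will be
  used with \<open>rep a\<close> for the left action and \<open>create \<xi>\<close> for
  creation.\<close>

lemma completion_map_embedding:
  assumes M: "module_embedding M \<phi>" and N: "module_embedding N \<psi>"
    and T: "bounded_linear T" and f: "\<And>x. x \<in> hcarrier M \<Longrightarrow> f x \<in> hcarrier N \<and> \<psi> (f x) = T (\<phi> x)"
    and X: "X \<in> hcarrier (completion M)"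
  shows "completion_map N f X \<in> hcarrier (completion N)"
    "completion_embedding \<psi> (completion_map N f X) = T (completion_embedding \<phi> X)"
proof -
  have "(\<lambda>k. \<psi> (f (hrep X k))) \<longlonglongrightarrow> T (completion_embedding \<phi> X)"
    using f hrep_completion[OF M X] by (simp add: bounded_linear.tendsto[OF T])
  note * = hclass_of_tendsto[OF N _ this]
  show "completion_map N f X \<in> hcarrier (completion N)"
    "completion_embedding \<psi> (completion_map N f X) = T (completion_embedding \<phi> X)"
    unfolding completion_map_def by (rule *; use f hrep_completion(1)[OF M X] in blast)+
qed

section \<open>Direct sums graded by word length\<close>

definition graded :: "nat \<Rightarrow> (nat list, 'a::cstar_algebra) l2 set" where
  "graded n = {f. \<forall>w. length w \<noteq> n \<longrightarrow> l2_nth f w = 0}"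

lemma gradedD: "f \<in> graded n \<Longrightarrow> length w \<noteq> n \<Longrightarrow> l2_nth f w = 0"
  by (simp add: graded_def)

lemma closed_graded: "closed (graded n)"
  unfolding closed_sequential_limits
proof (intro allI impI, elim conjE)
  fix X f assume X: "\<forall>k. X k \<in> graded n" "X \<longlonglongrightarrow> f"
  have "l2_nth f w = 0" if "length w \<noteq> n" for w
  proof -
    have "l2_nth (X k) w = 0" for k
      using X(1) that gradedD by blast
    then show ?thesis
      using tendsto_l2_nth[OF X(2), of w] by (simp add: LIMSEQ_const_iff)
  qed
  then show "f \<in> graded n"
    by (simp add: graded_def)
qed

lift_definition l2_restrict :: "'i set \<Rightarrow> ('i, 'a::cstar_algebra) l2 \<Rightarrow> ('i, 'a) l2" is
  "\<lambda>S f i. if i \<in> S then f i else 0"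
proof -
  fix S :: "'i set" and f :: "'i \<Rightarrow> 'a" assume f: "square_summable f"
  have "norm2 F (\<lambda>i. if i \<in> S then f i else 0) \<le> 1 * norm2 F f" if "finite F" for F
  proof -
    have "norm2 F (\<lambda>i. if i \<in> S then f i else 0) = norm2 (F \<inter> S) f"
      unfolding norm2_def using that
      by (intro arg_cong[where f = "\<lambda>x. sqrt (norm x)"] sum.mono_neutral_cong_right) auto
    also have "\<dots> \<le> norm2 F f"
      using that by (intro norm2_mono) auto
    finally show ?thesis by simp
  qed
  then show "square_summable (\<lambda>i. if i \<in> S then f i else 0)"
    by (rule square_summable_comparison[OF f zero_less_one])
qed

lemma norm2_l2_restrict: "finite F \<Longrightarrow> norm2 F (l2_nth (l2_restrict S f)) = norm2 (F \<inter> S) (l2_nth f)"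
  unfolding norm2_def l2_restrict.rep_eq
  by (intro arg_cong[where f = "\<lambda>x. sqrt (norm x)"] sum.mono_neutral_cong_right) auto

lemma bounded_linear_l2_restrict: "bounded_linear (l2_restrict S :: ('i, 'a::cstar_algebra) l2 \<Rightarrow> _)"
proof (rule bounded_linear_intro[where K = 1])
  fix f g :: "('i, 'a) l2" and r
  show "l2_restrict S (f + g) = l2_restrict S f + l2_restrict S g" "l2_restrict S (r *\<^sub>R f) = r *\<^sub>R l2_restrict S f"
    by (transfer; auto)+
  show "norm (l2_restrict S f) \<le> norm f * 1"
    by (rule norm_l2_le) (simp add: norm2_l2_restrict norm2_le_norm)
qed

lemma l2_restrict_tail:
  assumes "0 < e"
  obtains N where "\<And>S. (\<And>w. w \<in> S \<Longrightarrow> N \<le> length w) \<Longrightarrow> norm (l2_restrict S f) \<le> e"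
proof -
  obtain F where F: "finite F" "\<And>G. finite G \<Longrightarrow> G \<inter> F = {} \<Longrightarrow> norm2 G (l2_nth f) < e"
    using square_summableD[of "l2_nth f", OF _ assms] by auto
  define N where "N = Suc (Max (insert 0 (length ` F)))"
  have N: "length w < N" if "w \<in> F" for w
    using that F(1) by (auto simp: N_def less_Suc_eq_le intro: Max_ge)
  have "norm (l2_restrict S f) \<le> e" if S: "\<And>w. w \<in> S \<Longrightarrow> N \<le> length w" for S
  proof (rule norm_l2_le)
    fix G :: "'a list set" assume "finite G"
    then show "norm2 G (l2_nth (l2_restrict S f)) \<le> e"
      unfolding norm2_l2_restrict[OF \<open>finite G\<close>] using N S
      by (intro less_imp_le F(2)) (auto simp: not_le[symmetric])
  qed
  then show ?thesis by (rule that)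
qed

lemma l2_inner_graded_neq:
  assumes "f \<in> graded m" "g \<in> graded n" "m \<noteq> n"
  shows "l2_inner f g = 0"
proof -
  have "star (l2_nth f w) * l2_nth g w = 0" for w
    using gradedD[OF assms(1), of w] gradedD[OF assms(2), of w] assms(3)
    by (cases "length w = m") auto
  then show ?thesis
    by (simp add: l2_inner_def)
qed

lemma norm_sum_graded:
  assumes "\<And>n. f n \<in> graded n" "finite F"
  shows "(norm (\<Sum>n\<in>F. f n))\<^sup>2 = norm (\<Sum>n\<in>F. l2_inner (f n) (f n))"
proof -
  have "l2_inner (\<Sum>n\<in>F. f n) (\<Sum>n\<in>F. f n) = (\<Sum>m\<in>F. \<Sum>n\<in>F. if n = m then l2_inner (f n) (f n) else 0)"
    unfolding l2_inner.sum_left l2_inner.sum_right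
    by (intro sum.cong refl) (auto simp: l2_inner_graded_neq[OF assms(1) assms(1)])
  also have "\<dots> = (\<Sum>n\<in>F. l2_inner (f n) (f n))"
    using assms(2) by (simp add: sum.delta')
  finally show ?thesis
    by (simp add: norm_l2_power2)
qed

lemma summable_graded:
  assumes f: "\<And>n. f n \<in> graded n" and "summable (\<lambda>n. l2_inner (f n) (f n))"
  shows "summable f"
  unfolding summable_Cauchy
proof (intro allI impI)
  fix e :: real assume "e > 0"
  then have "e\<^sup>2 > 0" by simp
  then obtain N where "\<And>m n. m \<ge> N \<Longrightarrow> norm (\<Sum>k\<in>{m..<n}. l2_inner (f k) (f k)) < e\<^sup>2"
    using assms(2) unfolding summable_Cauchy by blast
  then have "(norm (sum f {m..<n}))\<^sup>2 < e\<^sup>2" if "m \<ge> N" for m n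
    using norm_sum_graded[OF f, of "{m..<n}"] that by simp
  then show "\<exists>N. \<forall>m\<ge>N. \<forall>n. norm (sum f {m..<n}) < e"
    using \<open>e > 0\<close> by (meson less_imp_le power2_less_imp_less)
qed

lemma l2_nth_suminf_graded:
  assumes f: "\<And>n. f n \<in> graded n" and "summable f"
  shows "l2_nth (suminf f) w = l2_nth (f (length w)) w"
proof -
  have bl: "bounded_linear (\<lambda>f. l2_nth f w)"
    by (rule bounded_linear_intro[where K = 1]) (auto simp: plus_l2.rep_eq scaleR_l2.rep_eq norm_l2_nth_le)
  have "(\<lambda>n. l2_nth (f n) w) sums l2_nth (suminf f) w"
    using bounded_linear.sums[OF bl summable_sums[OF assms(2)]] .
  moreover have "(\<lambda>n. l2_nth (f n) w) sums (\<Sum>n\<in>{length w}. l2_nth (f n) w)"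
    by (rule sums_finite) (auto intro: gradedD[OF f])
  ultimately show ?thesis
    using sums_unique2 by force
qed

definition direct_sum_embedding ::
  "(nat \<Rightarrow> 'e \<Rightarrow> (nat list, 'a::cstar_algebra) l2) \<Rightarrow> (nat \<Rightarrow> 'e) \<Rightarrow> (nat list, 'a) l2" where
  "direct_sum_embedding \<Phi> x = (\<Sum>n. \<Phi> n (x n))"

text \<open>Each summand fills exactly the part of \<open>l2\<close> on words of one length. An
  element of the direct sum is then the same as an element of \<open>l2\<close> cut by word
  length.\<close>

context
  fixes M :: "nat \<Rightarrow> ('a::cstar_algebra, 'e) hmodule" and \<Phi> :: "nat \<Rightarrow> 'e \<Rightarrow> (nat list, 'a) l2"
  assumes M: "\<And>n. module_embedding (M n) (\<Phi> n)"
    and inj: "\<And>n. inj_on (\<Phi> n) (hcarrier (M n))"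
    and image: "\<And>n. \<Phi> n ` hcarrier (M n) = graded n"
begin

lemma graded_component: "x n \<in> hcarrier (M n) \<Longrightarrow> \<Phi> n (x n) \<in> graded n"
  using image by blast

lemma direct_sum_component: "x \<in> hcarrier (direct_sum M) \<Longrightarrow> x n \<in> hcarrier (M n)"
  by (simp add: direct_sum_def)

lemma summable_direct_sum:
  assumes "x \<in> hcarrier (direct_sum M)"
  shows "summable (\<lambda>n. \<Phi> n (x n))"
  using assms module_embeddingD(5)[OF M]
  by (intro summable_graded graded_component) (auto simp: direct_sum_def)

lemma direct_sum_nth:
  assumes "x \<in> hcarrier (direct_sum M)"
  shows "l2_nth (direct_sum_embedding \<Phi> x) w = l2_nth (\<Phi> (length w) (x (length w))) w"
  unfolding direct_sum_embedding_def
  by (intro l2_nth_suminf_graded graded_component summable_direct_sum direct_sum_component assms)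

lemma direct_sum_inner_sums:
  assumes x: "x \<in> hcarrier (direct_sum M)" and y: "y \<in> hcarrier (direct_sum M)"
  shows "(\<lambda>n. hinner (M n) (x n) (y n)) sums l2_inner (direct_sum_embedding \<Phi> x) (direct_sum_embedding \<Phi> y)"
proof -
  note gr = graded_component[OF direct_sum_component]
  have "l2_inner (direct_sum_embedding \<Phi> x) (\<Phi> n (y n)) = hinner (M n) (x n) (y n)" for n
  proof -
    have "(\<lambda>m. l2_inner (\<Phi> m (x m)) (\<Phi> n (y n))) sums l2_inner (direct_sum_embedding \<Phi> x) (\<Phi> n (y n))"
      unfolding direct_sum_embedding_def
      by (rule bounded_linear.sums[OF l2_inner.bounded_linear_left summable_sums[OF summable_direct_sum[OF x]]])
    moreover have "(\<lambda>m. l2_inner (\<Phi> m (x m)) (\<Phi> n (y n))) sums (\<Sum>m\<in>{n}. l2_inner (\<Phi> m (x m)) (\<Phi> n (y n)))"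
      by (rule sums_finite) (auto intro: l2_inner_graded_neq[OF gr gr] x y)
    ultimately have "l2_inner (direct_sum_embedding \<Phi> x) (\<Phi> n (y n)) = l2_inner (\<Phi> n (x n)) (\<Phi> n (y n))"
      using sums_unique2 by force
    then show ?thesis
      using module_embeddingD(5)[OF M] direct_sum_component x y by simp
  qed
  then show ?thesis
    using bounded_linear.sums[OF l2_inner.bounded_linear_right summable_sums[OF summable_direct_sum[OF y]],
        of "direct_sum_embedding \<Phi> x"]
    by (simp add: direct_sum_embedding_def)
qed

text \<open>The blocks of the series of inner squares are controlled by the tails of the one vector
  \<open>g\<close>, which gives summability. The operations on the direct sum are handled by
  exhibiting such a \<open>g\<close>.\<close>

lemma direct_sum_memI:
  assumes y: "\<And>n. y n \<in> hcarrier (M n)" and g: "\<And>w. l2_nth g w = l2_nth (\<Phi> (length w) (y (length w))) w"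
  shows "y \<in> hcarrier (direct_sum M)" "direct_sum_embedding \<Phi> y = g"
proof -
  have gr: "\<Phi> n (y n) \<in> graded n" for n
    using graded_component[of y n] y by simp
  have restr: "\<Phi> n (y n) = l2_restrict {w. length w = n} g" for n
    by (rule l2_eqI) (use gradedD[OF gr] in \<open>auto simp: l2_restrict.rep_eq g\<close>)
  have "summable (\<lambda>n. hinner (M n) (y n) (y n))"
    unfolding summable_Cauchy
  proof (intro allI impI)
    fix e :: real assume "e > 0"
    define d where "d = sqrt (e / 2)"
    have "d > 0" using \<open>e > 0\<close> by (simp add: d_def)
    then obtain N where N: "\<And>S. (\<And>w. w \<in> S \<Longrightarrow> N \<le> length w) \<Longrightarrow> norm (l2_restrict S g) \<le> d"
      using l2_restrict_tail by blast
    have "norm (\<Sum>k=m..<n. hinner (M k) (y k) (y k)) < e" if "m \<ge> N" for m n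
    proof -
      have "(\<Sum>k=m..<n. \<Phi> k (y k)) = l2_restrict {w. m \<le> length w \<and> length w < n} g"
      proof (rule l2_eqI)
        fix w
        have "l2_nth (\<Sum>k\<in>F. h k) w = (\<Sum>k\<in>F. l2_nth (h k) w)" for h :: "nat \<Rightarrow> (nat list, 'a) l2" and F
          by (induction F rule: infinite_finite_induct) (auto simp: zero_l2.rep_eq plus_l2.rep_eq)
        then show "l2_nth (\<Sum>k=m..<n. \<Phi> k (y k)) w = l2_nth (l2_restrict {w. m \<le> length w \<and> length w < n} g) w"
          by (simp add: restr l2_restrict.rep_eq)
      qed
      moreover have "norm (l2_restrict {w. m \<le> length w \<and> length w < n} g) \<le> d"
        by (rule N) (use that in auto)
      ultimately have "norm (\<Sum>k=m..<n. \<Phi> k (y k)) \<le> d"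
        by simp
      then have "(norm (\<Sum>k=m..<n. \<Phi> k (y k)))\<^sup>2 \<le> d\<^sup>2"
        by (rule power_mono) simp
      then have "norm (\<Sum>k=m..<n. l2_inner (\<Phi> k (y k)) (\<Phi> k (y k))) \<le> e / 2"
        using norm_sum_graded[of "\<lambda>n. \<Phi> n (y n)" "{m..<n}"] gr \<open>e > 0\<close> by (simp add: d_def)
      then show ?thesis
        using \<open>e > 0\<close> y by (simp add: module_embeddingD(5)[OF M])
    qed
    then show "\<exists>N. \<forall>m\<ge>N. \<forall>n. norm (\<Sum>k=m..<n. hinner (M k) (y k) (y k)) < e" by blast
  qed
  then show mem: "y \<in> hcarrier (direct_sum M)"
    using y by (simp add: direct_sum_def)
  show "direct_sum_embedding \<Phi> y = g"
    by (rule l2_eqI) (simp add: direct_sum_nth[OF mem] g)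
qed

lemma module_embedding_direct_sum: "module_embedding (direct_sum M) (direct_sum_embedding \<Phi>)"
  unfolding module_embedding_def
proof (intro conjI ballI allI)
  note MD = module_embeddingD[OF M]
  have sel: "hzero (direct_sum M) = (\<lambda>n. hzero (M n))" "hadd (direct_sum M) x y = (\<lambda>n. hadd (M n) (x n) (y n))"
    "hscale (direct_sum M) c x = (\<lambda>n. hscale (M n) c (x n))"
    "hinner (direct_sum M) x y = (\<Sum>n. hinner (M n) (x n) (y n))" for x y c
    by (simp_all add: direct_sum_def)
  have zero: "hzero (M n) \<in> hcarrier (M n)" "l2_nth (0 :: (nat list, 'a) l2) w = l2_nth (\<Phi> (length w) (hzero (M (length w)))) w" for n w
    by (simp_all add: MD)
  show "hzero (direct_sum M) \<in> hcarrier (direct_sum M)" "direct_sum_embedding \<Phi> (hzero (direct_sum M)) = 0"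
    unfolding sel by (rule direct_sum_memI[OF zero])+
  fix x assume x: "x \<in> hcarrier (direct_sum M)"
  {
    fix y assume y: "y \<in> hcarrier (direct_sum M)"
    have add: "hadd (M n) (x n) (y n) \<in> hcarrier (M n)"
      "l2_nth (direct_sum_embedding \<Phi> x + direct_sum_embedding \<Phi> y) w =
        l2_nth (\<Phi> (length w) (hadd (M (length w)) (x (length w)) (y (length w)))) w" for n w
      by (simp_all add: MD direct_sum_component x y direct_sum_nth plus_l2.rep_eq)
    show "hadd (direct_sum M) x y \<in> hcarrier (direct_sum M)"
      "direct_sum_embedding \<Phi> (hadd (direct_sum M) x y) = direct_sum_embedding \<Phi> x + direct_sum_embedding \<Phi> y"
      unfolding sel by (rule direct_sum_memI[OF add])+
    show "hinner (direct_sum M) x y = l2_inner (direct_sum_embedding \<Phi> x) (direct_sum_embedding \<Phi> y)"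
      unfolding sel using direct_sum_inner_sums[OF x y] sums_unique by metis
  }
  fix c
  have scale: "hscale (M n) c (x n) \<in> hcarrier (M n)"
    "l2_nth (l2_scaleC c (direct_sum_embedding \<Phi> x)) w =
      l2_nth (\<Phi> (length w) (hscale (M (length w)) c (x (length w)))) w" for n w
    by (simp_all add: MD direct_sum_component x direct_sum_nth l2_scaleC.rep_eq)
  show "hscale (direct_sum M) c x \<in> hcarrier (direct_sum M)"
    "direct_sum_embedding \<Phi> (hscale (direct_sum M) c x) = l2_scaleC c (direct_sum_embedding \<Phi> x)"
    unfolding sel by (rule direct_sum_memI[OF scale])+
qed

lemma bij_direct_sum: "bij_betw (direct_sum_embedding \<Phi>) (hcarrier (direct_sum M)) UNIV"
proof (rule bij_betw_imageI)
  show "inj_on (direct_sum_embedding \<Phi>) (hcarrier (direct_sum M))"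
  proof (rule inj_onI)
    fix x y assume x: "x \<in> hcarrier (direct_sum M)" and y: "y \<in> hcarrier (direct_sum M)"
      and eq: "direct_sum_embedding \<Phi> x = direct_sum_embedding \<Phi> y"
    have "\<Phi> n (x n) = \<Phi> n (y n)" for n
    proof (rule l2_eqI)
      fix w
      show "l2_nth (\<Phi> n (x n)) w = l2_nth (\<Phi> n (y n)) w"
      proof (cases "length w = n")
        case True
        then show ?thesis
          using direct_sum_nth[OF x, of w] direct_sum_nth[OF y, of w] eq by simp
      next
        case False
        then show ?thesis
          using gradedD graded_component direct_sum_component x y by metis
      qed
    qed
    then show "x = y"
      using inj_onD[OF inj] direct_sum_component x y by (intro ext) metis
  qed
  have "g \<in> direct_sum_embedding \<Phi> ` hcarrier (direct_sum M)" for g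
  proof -
    have "l2_restrict {w. length w = n} g \<in> \<Phi> n ` hcarrier (M n)" for n
      unfolding image by (simp add: graded_def l2_restrict.rep_eq)
    then have "\<exists>y. y \<in> hcarrier (M n) \<and> \<Phi> n y = l2_restrict {w. length w = n} g" for n
      unfolding image_iff by metis
    then obtain y where y: "\<And>n. y n \<in> hcarrier (M n)" "\<And>n. \<Phi> n (y n) = l2_restrict {w. length w = n} g"
      by metis
    then have "y \<in> hcarrier (direct_sum M)" "direct_sum_embedding \<Phi> y = g"
      by (auto intro!: direct_sum_memI simp: l2_restrict.rep_eq)
    then show ?thesis by blast
  qed
  then show "direct_sum_embedding \<Phi> ` hcarrier (direct_sum M) = UNIV" by blast
qed

end

section \<open>The Fock space as a Hilbert module over words\<close>

lemma endo_correspondence_simps: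
  "hcarrier (endo_correspondence \<rho>) = {x. summable (\<lambda>n. star (x n) * x n)}"
  "hinner (endo_correspondence \<rho>) x y = (\<Sum>n. star (x n) * y n)"
  "lact (endo_correspondence \<rho>) a x = (\<lambda>n. \<rho> n a * x n)"
  by (simp_all add: endo_correspondence_def hmodule.extend_def correspondence.fields_def
      direct_sum_def self_module_def)

context endomorphism_sequence
begin

interpretation rep: bounded_linear rep
  by (rule bounded_linear_rep)

abbreviation E where "E \<equiv> endo_correspondence \<rho>"

section \<open>Creation operators\<close>

definition create :: "(nat \<Rightarrow> 'a) \<Rightarrow> (nat list, 'a) lop" where
  "create \<xi> = (\<Sum>n. isometry_lop n * rep (\<xi> n))"

text \<open>The isometries have orthogonal ranges, so cross terms vanish. The summability that
  defines the carrier of \<open>E\<close> is thus what makes the series of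
  \<open>create \<xi>\<close> converge in norm.\<close>

lemma norm_sum_isometry_rep:
  assumes "finite F"
  shows "(norm (\<Sum>n\<in>F. isometry_lop n * rep (\<xi> n)))\<^sup>2 = norm (\<Sum>n\<in>F. star (\<xi> n) * \<xi> n)"
proof -
  have "star (\<Sum>n\<in>F. isometry_lop n * rep (\<xi> n)) * (\<Sum>n\<in>F. isometry_lop n * rep (\<xi> n)) =
      (\<Sum>m\<in>F. \<Sum>n\<in>F. star (isometry_lop m * rep (\<xi> m)) * (isometry_lop n * rep (\<xi> n)))"
    by (simp add: star_sum sum_product)
  also have "\<dots> = (\<Sum>m\<in>F. \<Sum>n\<in>F. if n = m then rep (star (\<xi> n) * \<xi> n) else 0)"
    by (intro sum.cong refl) (auto simp: star_mult mult.assoc star_isometry_mult_left rep_mult rep_star)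
  also have "\<dots> = rep (\<Sum>n\<in>F. star (\<xi> n) * \<xi> n)"
    using assms by (simp add: sum.delta' rep.sum)
  finally show ?thesis
    using norm_star_mult_self[of "\<Sum>n\<in>F. isometry_lop n * rep (\<xi> n)"] by simp
qed

lemma summable_create:
  assumes "\<xi> \<in> hcarrier E"
  shows "summable (\<lambda>n. isometry_lop n * rep (\<xi> n))"
  unfolding summable_Cauchy
proof (intro allI impI)
  fix e :: real assume "e > 0"
  then have "e\<^sup>2 > 0" by simp
  moreover have "summable (\<lambda>n. star (\<xi> n) * \<xi> n)"
    using assms by (simp add: endo_correspondence_simps)
  ultimately obtain N where "\<And>m n. m \<ge> N \<Longrightarrow> norm (\<Sum>k\<in>{m..<n}. star (\<xi> k) * \<xi> k) < e\<^sup>2"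
    unfolding summable_Cauchy by blast
  then have "(norm (\<Sum>k\<in>{m..<n}. isometry_lop k * rep (\<xi> k)))\<^sup>2 < e\<^sup>2" if "m \<ge> N" for m n
    using that by (simp add: norm_sum_isometry_rep)
  then show "\<exists>N. \<forall>m\<ge>N. \<forall>n. norm (\<Sum>k\<in>{m..<n}. isometry_lop k * rep (\<xi> k)) < e"
    using \<open>e > 0\<close> by (meson less_imp_le power2_less_imp_less)
qed

lemma create_sums: "\<xi> \<in> hcarrier E \<Longrightarrow> (\<lambda>n. isometry_lop n * rep (\<xi> n)) sums create \<xi>"
  unfolding create_def by (rule summable_sums[OF summable_create])

lemma create_in_toeplitz:
  assumes "\<xi> \<in> hcarrier E"
  shows "create \<xi> \<in> toeplitz"
proof -
  have "isometry_lop n * rep (\<xi> n) \<in> toeplitz" for n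
    using monomial_in_toeplitz[of "[n]" "\<xi> n" "[]"] by (simp add: monomial_def)
  then have "(\<Sum>k<n. isometry_lop k * rep (\<xi> k)) \<in> toeplitz" for n
    by (induction n) (auto intro: toeplitz_zero toeplitz_add)
  then show ?thesis
    using create_sums[OF assms] closed_sequentially[OF toeplitz_closed, of "\<lambda>n. \<Sum>k<n. isometry_lop k * rep (\<xi> k)"]
    by (simp add: sums_def)
qed

lemma star_isometry_create:
  assumes "\<xi> \<in> hcarrier E"
  shows "star (isometry_lop n) * create \<xi> = rep (\<xi> n)"
proof -
  have "(\<lambda>m. star (isometry_lop n) * (isometry_lop m * rep (\<xi> m))) sums (star (isometry_lop n) * create \<xi>)"
    by (rule bounded_linear.sums[OF bounded_linear_mult_right create_sums[OF assms]])
  moreover have "(\<lambda>m. star (isometry_lop n) * (isometry_lop m * rep (\<xi> m))) sums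
      (\<Sum>m\<in>{n}. star (isometry_lop n) * (isometry_lop m * rep (\<xi> m)))"
    by (rule sums_finite) (auto simp: star_isometry_mult_left)
  ultimately show ?thesis
    using sums_unique2 by (force simp: star_isometry_mult_left)
qed

lemma create_nth:
  assumes "\<xi> \<in> hcarrier E"
  shows "l2_nth (create \<xi> \<bullet>\<^sub>o f) (n # w) = word_endo \<rho> w (\<xi> n) * l2_nth f w"
    "l2_nth (create \<xi> \<bullet>\<^sub>o f) [] = 0"
proof -
  have "l2_nth (create \<xi> \<bullet>\<^sub>o f) (n # w) = l2_nth ((star (isometry_lop n) * create \<xi>) \<bullet>\<^sub>o f) w"
    by (simp add: isometry_lop_nth)
  then show "l2_nth (create \<xi> \<bullet>\<^sub>o f) (n # w) = word_endo \<rho> w (\<xi> n) * l2_nth f w"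
    by (simp add: star_isometry_create[OF assms] rep_nth)
  have "bounded_linear (\<lambda>x :: (nat list, 'a) lop. l2_nth (x \<bullet>\<^sub>o f) [])"
    by (rule bounded_linear_intro[where K = "norm f"])
      (auto simp: plus_l2.rep_eq scaleR_l2.rep_eq intro: order_trans[OF norm_l2_nth_le norm_lop_apply_le])
  from bounded_linear.sums[OF this create_sums[OF assms]]
  have "(\<lambda>n. 0) sums l2_nth (create \<xi> \<bullet>\<^sub>o f) []"
    by (simp add: isometry_lop_nth)
  then show "l2_nth (create \<xi> \<bullet>\<^sub>o f) [] = 0"
    using sums_unique2 sums_zero by blast
qed

lemma star_create_mult_create:
  assumes \<xi>: "\<xi> \<in> hcarrier E" and \<eta>: "\<eta> \<in> hcarrier E"
  shows "star (create \<xi>) * create \<eta> = rep (hinner E \<xi> \<eta>)"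
proof -
  have "star (create \<xi>) * (isometry_lop n * rep (\<eta> n)) = rep (star (\<xi> n) * \<eta> n)" for n
  proof -
    have "star (create \<xi>) * isometry_lop n = rep (star (\<xi> n))"
      using arg_cong[OF star_isometry_create[OF \<xi>, of n], of star] by (simp add: star_mult star_star rep_star)
    then show ?thesis
      by (simp add: rep_mult flip: mult.assoc)
  qed
  then have sums: "(\<lambda>n. rep (star (\<xi> n) * \<eta> n)) sums (star (create \<xi>) * create \<eta>)"
    using bounded_linear.sums[OF bounded_linear_mult_right create_sums[OF \<eta>], of "star (create \<xi>)"] by simp
  then have "summable (\<lambda>n. rep (star (\<xi> n) * \<eta> n))"
    by (rule sums_summable)
  \<comment> \<open>Convergence of the inner product series is read off from the operators, because
    \<open>rep\<close> is isometric.\<close>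
  then have "summable (\<lambda>n. star (\<xi> n) * \<eta> n)"
    unfolding summable_Cauchy by (simp flip: rep.sum)
  then have "(\<lambda>n. rep (star (\<xi> n) * \<eta> n)) sums rep (hinner E \<xi> \<eta>)"
    unfolding endo_correspondence_simps by (intro rep.sums summable_sums)
  with sums show ?thesis
    by (rule sums_unique2)
qed

lemma lact_in_carrier:
  assumes "\<xi> \<in> hcarrier E"
  shows "lact E a \<xi> \<in> hcarrier E"
proof -
  have sm: "summable (\<lambda>n. star (\<xi> n) * \<xi> n)"
    using assms by (simp add: endo_correspondence_simps)
  have le: "norm (\<Sum>k=m..<n. star (\<rho> k a * \<xi> k) * (\<rho> k a * \<xi> k)) \<le>
      (norm a)\<^sup>2 * norm (\<Sum>k=m..<n. star (\<xi> k) * \<xi> k)" for m n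
    by (intro norm_sum_mult_left_le norm_star_endomorphism_le endo) simp
  have "summable (\<lambda>n. star (\<rho> n a * \<xi> n) * (\<rho> n a * \<xi> n))"
    unfolding summable_Cauchy
  proof (intro allI impI)
    fix e :: real assume "e > 0"
    define K where "K = (norm a)\<^sup>2 + 1"
    have "K > 0" by (simp add: K_def add_nonneg_pos)
    then have "e / K > 0" using \<open>e > 0\<close> by simp
    then obtain N where N: "\<And>m n. m \<ge> N \<Longrightarrow> norm (\<Sum>k\<in>{m..<n}. star (\<xi> k) * \<xi> k) < e / K"
      using sm unfolding summable_Cauchy by blast
    have "norm (\<Sum>k=m..<n. star (\<rho> k a * \<xi> k) * (\<rho> k a * \<xi> k)) < e" if "m \<ge> N" for m n
    proof -
      have "norm (\<Sum>k=m..<n. star (\<rho> k a * \<xi> k) * (\<rho> k a * \<xi> k)) \<le> K * norm (\<Sum>k=m..<n. star (\<xi> k) * \<xi> k)"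
        by (rule order_trans[OF le mult_right_mono]) (auto simp: K_def)
      also have "\<dots> < e"
        using N[OF that, of n] \<open>K > 0\<close> by (simp add: field_simps)
      finally show ?thesis .
    qed
    then show "\<exists>N. \<forall>m\<ge>N. \<forall>n. norm (\<Sum>k=m..<n. star (\<rho> k a * \<xi> k) * (\<rho> k a * \<xi> k)) < e" by blast
  qed
  then show ?thesis
    by (simp add: endo_correspondence_simps)
qed

lemma rep_create:
  assumes "\<xi> \<in> hcarrier E"
  shows "rep a * create \<xi> = create (lact E a \<xi>)"
proof -
  have "rep a * (isometry_lop n * rep (\<xi> n)) = isometry_lop n * rep (lact E a \<xi> n)" for n
  proof -
    have "rep a * (isometry_lop n * rep (\<xi> n)) = (rep a * isometry_lop n) * rep (\<xi> n)"
      by (simp add: mult.assoc)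
    then show ?thesis
      by (simp add: rep_isometry rep_mult mult.assoc endo_correspondence_simps)
  qed
  then have "(\<lambda>n. isometry_lop n * rep (lact E a \<xi> n)) sums (rep a * create \<xi>)"
    using bounded_linear.sums[OF bounded_linear_mult_right create_sums[OF assms], of "rep a"] by simp
  then show ?thesis
    using create_sums[OF lact_in_carrier[OF assms]] by (rule sums_unique2)
qed

definition single_vector :: "nat \<Rightarrow> 'a \<Rightarrow> nat \<Rightarrow> 'a" where
  "single_vector n b = (\<lambda>k. if k = n then b else 0)"

lemma single_vector_in_carrier: "single_vector n b \<in> hcarrier E"
proof -
  have "summable (\<lambda>k. star (single_vector n b k) * single_vector n b k)"
    by (rule summable_finite[of "{n}"]) (auto simp: single_vector_def)
  then show ?thesis
    by (simp add: endo_correspondence_simps)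
qed

lemma create_single_vector: "create (single_vector n b) = isometry_lop n * rep b"
proof -
  have "(\<lambda>k. isometry_lop k * rep (single_vector n b k)) sums (\<Sum>k\<in>{n}. isometry_lop k * rep (single_vector n b k))"
    by (rule sums_finite) (auto simp: single_vector_def rep.zero)
  with create_sums[OF single_vector_in_carrier] have "create (single_vector n b) = (\<Sum>k\<in>{n}. isometry_lop k * rep (single_vector n b k))"
    by (rule sums_unique2)
  then show ?thesis
    by (simp add: single_vector_def)
qed

section \<open>Elementary tensors as vectors over words\<close>

text \<open>The concrete form of x_1 \<otimes> ... \<otimes> x_n \<otimes> a as a vector of the Fock
  space: successive creation starting from the vacuum vector \<delta>_[] \<otimes> a.\<close>

definition tensor_vector :: "('a, nat \<Rightarrow> 'a) tensor \<Rightarrow> (nat list, 'a) l2" where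
  "tensor_vector t = foldr (\<lambda>x f. create x \<bullet>\<^sub>o f) (fst t) (l2_single [] (snd t))"

lemma tensor_vector_simps [simp]:
  "tensor_vector ([], a) = l2_single [] a"
  "tensor_vector (x # xs, a) = create x \<bullet>\<^sub>o tensor_vector (xs, a)"
  by (simp_all add: tensor_vector_def)

lemma tensor_lact_vector:
  assumes "set (fst t) \<subseteq> hcarrier E"
  shows "tensor_vector (tensor_lact E c t) = rep c \<bullet>\<^sub>o tensor_vector t"
    "set (fst (tensor_lact E c t)) \<subseteq> hcarrier E" "length (fst (tensor_lact E c t)) = length (fst t)"
proof -
  obtain xs a where t: "t = (xs, a)" by (cases t)
  have "tensor_vector (tensor_lact E c t) = rep c \<bullet>\<^sub>o tensor_vector t \<and>
      set (fst (tensor_lact E c t)) \<subseteq> hcarrier E \<and> length (fst (tensor_lact E c t)) = length (fst t)"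
  proof (cases xs)
    case Nil
    then show ?thesis by (simp add: t rep_single)
  next
    case (Cons x ys)
    then have "x \<in> hcarrier E" using assms t by simp
    then have "rep c \<bullet>\<^sub>o create x \<bullet>\<^sub>o f = create (lact E c x) \<bullet>\<^sub>o f" for f
      by (simp flip: lop_apply_simps rep_create)
    then show ?thesis
      using assms lact_in_carrier by (simp add: t Cons)
  qed
  then show "tensor_vector (tensor_lact E c t) = rep c \<bullet>\<^sub>o tensor_vector t"
    "set (fst (tensor_lact E c t)) \<subseteq> hcarrier E" "length (fst (tensor_lact E c t)) = length (fst t)"
    by blast+
qed

text \<open>The recursion of \<open>tensor_inner\<close> is the relation between two creation
  operators and \<open>hinner E\<close>, read inside an inner product. Tensors of different lengths
  are orthogonal because a created vector has no component at the empty word.\<close>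

lemma tensor_inner_vector:
  assumes "set (fst s) \<subseteq> hcarrier E" "set (fst t) \<subseteq> hcarrier E"
  shows "tensor_inner E s t = l2_inner (tensor_vector s) (tensor_vector t)"
proof -
  have "tensor_inner E (xs, a) t = l2_inner (tensor_vector (xs, a)) (tensor_vector t)"
    if "set xs \<subseteq> hcarrier E" "set (fst t) \<subseteq> hcarrier E" for xs a t
    using that
  proof (induction xs arbitrary: t)
    case Nil
    obtain ys b where t: "t = (ys, b)" by (cases t)
    show ?case
      using Nil by (cases ys) (auto simp: t l2_inner_single_left l2_single.rep_eq create_nth)
  next
    case (Cons x xs)
    obtain ys b where t: "t = (ys, b)" by (cases t)
    show ?case
    proof (cases ys)
      case Nil
      have "l2_inner (create x \<bullet>\<^sub>o f) (l2_single [] b) = 0" for f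
        using star_l2_inner[of "l2_single [] b" "create x \<bullet>\<^sub>o f"] Cons.prems
        by (simp add: l2_inner_single_left create_nth)
      then show ?thesis by (simp add: t Nil)
    next
      case (Cons y zs)
      have x: "x \<in> hcarrier E" "set xs \<subseteq> hcarrier E" and y: "y \<in> hcarrier E" "set zs \<subseteq> hcarrier E"
        using Cons.prems by (auto simp: t Cons)
      have "tensor_inner E (x # xs, a) t = tensor_inner E (xs, a) (tensor_lact E (hinner E x y) (zs, b))"
        by (simp add: t Cons)
      also have "\<dots> = l2_inner (tensor_vector (xs, a)) (tensor_vector (tensor_lact E (hinner E x y) (zs, b)))"
        by (rule Cons.IH) (use x y tensor_lact_vector in auto)
      also have "\<dots> = l2_inner (tensor_vector (xs, a)) (rep (hinner E x y) \<bullet>\<^sub>o tensor_vector (zs, b))"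
        using y by (simp add: tensor_lact_vector)
      also have "\<dots> = l2_inner (tensor_vector (x # xs, a)) (tensor_vector t)"
        by (simp add: t Cons star_lop flip: star_create_mult_create[OF x(1) y(1)])
      finally show ?thesis .
    qed
  qed
  from this[of "fst s" t "snd s"] assms show ?thesis by simp
qed

definition sum_vector :: "('a, nat \<Rightarrow> 'a) tensor list \<Rightarrow> (nat list, 'a) l2" where
  "sum_vector u = sum_list (map tensor_vector u)"

lemma sum_vector_simps [simp]:
  "sum_vector [] = 0" "sum_vector (s # u) = tensor_vector s + sum_vector u"
  by (simp_all add: sum_vector_def)

lemma sum_vector_append: "sum_vector (u @ v) = sum_vector u + sum_vector v"
  by (simp add: sum_vector_def)

lemma sum_vector_map:
  assumes "\<And>s. s \<in> set u \<Longrightarrow> tensor_vector (f s) = T (tensor_vector s)" "bounded_linear T"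
  shows "sum_vector (map f u) = T (sum_vector u)"
  using assms(1)
proof (induction u)
  case Nil
  show ?case
    using linear_0[OF bounded_linear.linear[OF assms(2)]] by simp
next
  case (Cons s u)
  then show ?case
    using linear_add[OF bounded_linear.linear[OF assms(2)]] by simp
qed

lemma carrier_algebraic_iff:
  "u \<in> hcarrier (algebraic_tensor_power E n) \<longleftrightarrow> (\<forall>s\<in>set u. length (fst s) = n \<and> set (fst s) \<subseteq> hcarrier E)"
  by (simp add: algebraic_tensor_power_def case_prod_beta)

lemma tensor_vector_scaleC: "tensor_vector (xs, c *\<^sub>C a) = l2_scaleC c (tensor_vector (xs, a))"
proof (induction xs)
  case Nil
  show ?case
    by (auto intro!: l2_eqI simp: l2_single.rep_eq l2_scaleC.rep_eq)
qed (simp add: lop_apply_l2_scaleC)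

lemma module_embedding_algebraic: "module_embedding (algebraic_tensor_power E n) sum_vector"
  unfolding module_embedding_def
proof (intro conjI ballI allI)
  show "hzero (algebraic_tensor_power E n) \<in> hcarrier (algebraic_tensor_power E n)"
    "sum_vector (hzero (algebraic_tensor_power E n)) = 0"
    by (simp_all add: algebraic_tensor_power_def)
  fix u assume u: "u \<in> hcarrier (algebraic_tensor_power E n)"
  {
    fix v assume v: "v \<in> hcarrier (algebraic_tensor_power E n)"
    show "hadd (algebraic_tensor_power E n) u v \<in> hcarrier (algebraic_tensor_power E n)"
      "sum_vector (hadd (algebraic_tensor_power E n) u v) = sum_vector u + sum_vector v"
      using u v by (auto simp: algebraic_tensor_power_def sum_vector_append)
    have 1: "(\<Sum>t\<leftarrow>v. tensor_inner E s t) = l2_inner (tensor_vector s) (sum_vector v)" if "set (fst s) \<subseteq> hcarrier E" for s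
      using v[unfolded carrier_algebraic_iff] that
      by (induction v) (auto simp: l2_inner.bilinear_simps tensor_inner_vector)
    have "(\<Sum>s\<leftarrow>u. \<Sum>t\<leftarrow>v. tensor_inner E s t) = l2_inner (sum_vector u) (sum_vector v)"
      using u[unfolded carrier_algebraic_iff]
      by (induction u) (auto simp: l2_inner.bilinear_simps 1)
    then show "hinner (algebraic_tensor_power E n) u v = l2_inner (sum_vector u) (sum_vector v)"
      by (simp add: algebraic_tensor_power_def)
  }
  fix c
  show "hscale (algebraic_tensor_power E n) c u \<in> hcarrier (algebraic_tensor_power E n)"
    using u unfolding carrier_algebraic_iff by (fastforce simp: algebraic_tensor_power_def)
  show "sum_vector (hscale (algebraic_tensor_power E n) c u) = l2_scaleC c (sum_vector u)"
    unfolding algebraic_tensor_power_def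
    by (simp, rule sum_vector_map) (auto simp: tensor_vector_scaleC l2_scaleC_linear)
qed

lemma create_graded:
  assumes "\<xi> \<in> hcarrier E" "f \<in> graded n"
  shows "create \<xi> \<bullet>\<^sub>o f \<in> graded (Suc n)"
  unfolding graded_def
proof (intro CollectI allI impI)
  fix w :: "nat list" assume "length w \<noteq> Suc n"
  then show "l2_nth (create \<xi> \<bullet>\<^sub>o f) w = 0"
    using assms by (cases w) (auto simp: create_nth gradedD)
qed

lemma sum_vector_graded:
  assumes "u \<in> hcarrier (algebraic_tensor_power E n)"
  shows "sum_vector u \<in> graded n"
proof -
  have "tensor_vector (xs, a) \<in> graded (length xs)" if "set xs \<subseteq> hcarrier E" for xs a
    using that by (induction xs) (auto simp: create_graded, simp add: graded_def l2_single.rep_eq)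
  then have "tensor_vector s \<in> graded n" if "s \<in> set u" for s
    using assms that unfolding carrier_algebraic_iff by (metis prod.collapse)
  then show ?thesis
    by (induction u) (auto simp: graded_def zero_l2.rep_eq plus_l2.rep_eq)
qed

lemma create_closure:
  assumes \<xi>: "\<xi> \<in> hcarrier E" and f: "f \<in> closure (sum_vector ` hcarrier (algebraic_tensor_power E n))"
  shows "create \<xi> \<bullet>\<^sub>o f \<in> closure (sum_vector ` hcarrier (algebraic_tensor_power E (Suc n)))"
proof -
  obtain v where v: "\<And>k. v k \<in> sum_vector ` hcarrier (algebraic_tensor_power E n)" "v \<longlonglongrightarrow> f"
    using f unfolding closure_sequential by blast
  have *: "create \<xi> \<bullet>\<^sub>o sum_vector u \<in> sum_vector ` hcarrier (algebraic_tensor_power E (Suc n))"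
    if "u \<in> hcarrier (algebraic_tensor_power E n)" for u
  proof (rule image_eqI)
    show "create \<xi> \<bullet>\<^sub>o sum_vector u = sum_vector (map (\<lambda>(xs, a). (\<xi> # xs, a)) u)"
      by (rule sum_vector_map[symmetric]) (auto simp: bounded_linear_lop_apply)
    show "map (\<lambda>(xs, a). (\<xi> # xs, a)) u \<in> hcarrier (algebraic_tensor_power E (Suc n))"
      using that \<xi> by (fastforce simp: carrier_algebraic_iff)
  qed
  have "create \<xi> \<bullet>\<^sub>o v k \<in> sum_vector ` hcarrier (algebraic_tensor_power E (Suc n))" for k
    using v(1)[of k] by (auto simp: *)
  then show ?thesis
    unfolding closure_sequential using bounded_linear.tendsto[OF bounded_linear_lop_apply v(2)]
    by (intro exI[of _ "\<lambda>k. create \<xi> \<bullet>\<^sub>o v k"]) simp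
qed

text \<open>Creation by \<delta>_n \<otimes> u turns \<delta>_w \<otimes> a into a vector at
  \<open>n # w\<close> with value \<open>word_endo \<rho> w u * a\<close>. Non-degeneracy lets
  \<open>u\<close> be chosen so that this is close to \<open>a\<close>.\<close>

lemma single_in_closure:
  "l2_single w a \<in> closure (sum_vector ` hcarrier (algebraic_tensor_power E (length w)))"
proof (induction w arbitrary: a)
  case Nil
  have "l2_single [] a = sum_vector [([], a)]" by simp
  moreover have "[([], a)] \<in> hcarrier (algebraic_tensor_power E 0)"
    by (simp add: carrier_algebraic_iff)
  ultimately show ?case
    using closure_subset by (metis (no_types, lifting) image_eqI list.size(3) subsetD)
next
  case (Cons n w)
  let ?C = "closure (sum_vector ` hcarrier (algebraic_tensor_power E (Suc (length w))))"
  have mem: "l2_single (n # w) (word_endo \<rho> w u * a) \<in> ?C" for u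
    using create_closure[OF single_vector_in_carrier[of n u] Cons.IH[of a]]
    by (simp add: create_single_vector rep_single isometry_single)
  have "l2_single (n # w) a \<in> closure ?C"
    unfolding closure_approachable
  proof (intro allI impI)
    fix e :: real assume "e > 0"
    then obtain u where u: "norm (word_endo \<rho> w u * a - a) < e"
      using word_endo_unit_element by blast
    have "l2_single (n # w) (word_endo \<rho> w u * a) - l2_single (n # w) a = l2_single (n # w) (word_endo \<rho> w u * a - a)"
      by (rule l2_eqI) (simp add: minus_l2.rep_eq l2_single.rep_eq)
    then have "dist (l2_single (n # w) (word_endo \<rho> w u * a)) (l2_single (n # w) a) < e"
      using u by (simp add: dist_norm)
    then show "\<exists>f\<in>?C. dist f (l2_single (n # w) a) < e"
      using mem by blast
  qed
  then show ?case by simp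
qed

lemma closure_sum_vector: "closure (sum_vector ` hcarrier (algebraic_tensor_power E n)) = graded n"
proof
  show "closure (sum_vector ` hcarrier (algebraic_tensor_power E n)) \<subseteq> graded n"
    using sum_vector_graded by (intro closure_minimal closed_graded) auto
  let ?C = "closure (sum_vector ` hcarrier (algebraic_tensor_power E n))"
  let ?S = "{w :: nat list. length w = n}"
  note MD = module_embeddingD[OF module_embedding_algebraic[of n]]
  have zero: "0 \<in> ?C"
    using closure_subset MD(1,2) by (metis (no_types, lifting) image_eqI subsetD)
  have add: "f + g \<in> ?C" if f: "f \<in> ?C" and g: "g \<in> ?C" for f g
  proof -
    obtain X Y where XY: "\<And>k. X k \<in> sum_vector ` hcarrier (algebraic_tensor_power E n)" "X \<longlonglongrightarrow> f"
      "\<And>k. Y k \<in> sum_vector ` hcarrier (algebraic_tensor_power E n)" "Y \<longlonglongrightarrow> g"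
      using f g unfolding closure_sequential by blast
    have "X k + Y k \<in> sum_vector ` hcarrier (algebraic_tensor_power E n)" for k
      using XY(1)[of k] XY(3)[of k] MD(3,4) by (smt (verit) image_iff)
    then show ?thesis
      unfolding closure_sequential using tendsto_add[OF XY(2,4)] by (intro exI[of _ "\<lambda>k. X k + Y k"]) simp
  qed
  \<comment> \<open>The induction principle concerns all of \<open>l2\<close>; restriction to words
    of length \<open>n\<close> reduces the claim on \<open>graded n\<close> to it.\<close>
  have "f \<in> l2_restrict ?S -` ?C" for f
  proof (rule l2_induct)
    show "closed (l2_restrict ?S -` ?C)"
      by (rule closed_vimage[OF closed_closure bounded_linear.continuous_on[OF bounded_linear_l2_restrict continuous_on_id]])
    show "0 \<in> l2_restrict ?S -` ?C"
      using zero by (simp add: linear_0[OF bounded_linear.linear[OF bounded_linear_l2_restrict]])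
    show "f + g \<in> l2_restrict ?S -` ?C" if "f \<in> l2_restrict ?S -` ?C" "g \<in> l2_restrict ?S -` ?C" for f g
      using that add by (simp add: linear_add[OF bounded_linear.linear[OF bounded_linear_l2_restrict]])
    fix w and a :: 'a
    have "l2_restrict ?S (l2_single w a) = (if w \<in> ?S then l2_single w a else 0)"
      by (rule l2_eqI) (auto simp: l2_restrict.rep_eq l2_single.rep_eq zero_l2.rep_eq)
    then show "l2_single w a \<in> l2_restrict ?S -` ?C"
      using zero single_in_closure[of w a] by auto
  qed
  moreover have "l2_restrict ?S f = f" if "f \<in> graded n" for f
    by (rule l2_eqI) (use gradedD[OF that] in \<open>auto simp: l2_restrict.rep_eq\<close>)
  ultimately show "graded n \<subseteq> ?C"
    by (metis subsetI vimageD)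
qed

section \<open>Tensor powers and Fock space inside \<open>l2\<close>\<close>

definition power_vector :: "nat \<Rightarrow> (nat \<Rightarrow> ('a, nat \<Rightarrow> 'a) tensor list) set \<Rightarrow> (nat list, 'a) l2" where
  "power_vector n = completion_embedding sum_vector"

lemma power_vector:
  "module_embedding (tensor_power E n) (power_vector n)"
  "inj_on (power_vector n) (hcarrier (tensor_power E n))"
  "power_vector n ` hcarrier (tensor_power E n) = graded n"
  unfolding power_vector_def tensor_power_def
  by (rule module_embedding_completion[OF module_embedding_algebraic]
      completion_embedding_inj[OF module_embedding_algebraic])+
    (simp add: completion_embedding_image[OF module_embedding_algebraic] closure_sum_vector)

definition fock_vector :: "('a, nat \<Rightarrow> 'a) fock_vector \<Rightarrow> (nat list, 'a) l2" where
  "fock_vector = direct_sum_embedding power_vector"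

lemma module_embedding_fock: "module_embedding (fock_space E) fock_vector"
  unfolding fock_space_def fock_vector_def
  by (rule module_embedding_direct_sum[OF power_vector])

lemma bij_fock_vector: "bij_betw fock_vector (hcarrier (fock_space E)) UNIV"
  unfolding fock_space_def fock_vector_def
  by (rule bij_direct_sum[OF power_vector])

lemma fock_vector_nth:
  "f \<in> hcarrier (fock_space E) \<Longrightarrow> l2_nth (fock_vector f) w = l2_nth (power_vector (length w) (f (length w))) w"
  unfolding fock_space_def fock_vector_def
  by (rule direct_sum_nth[OF power_vector])

lemma fock_component: "f \<in> hcarrier (fock_space E) \<Longrightarrow> f n \<in> hcarrier (tensor_power E n)"
  by (simp add: fock_space_def direct_sum_def)

lemma fock_memI:
  assumes "\<And>n. y n \<in> hcarrier (tensor_power E n)"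
    and "\<And>w. l2_nth g w = l2_nth (power_vector (length w) (y (length w))) w"
  shows "y \<in> hcarrier (fock_space E)" "fock_vector y = g"
  unfolding fock_space_def fock_vector_def
  by (rule direct_sum_memI[OF power_vector assms])+

lemma fock_lact_vector:
  assumes f: "f \<in> hcarrier (fock_space E)"
  shows "fock_lact E a f \<in> hcarrier (fock_space E)" "fock_vector (fock_lact E a f) = rep a \<bullet>\<^sub>o fock_vector f"
proof -
  define y where "y n = completion_map (algebraic_tensor_power E n) (map (tensor_lact E a)) (f n)" for n
  have map: "map (tensor_lact E a) u \<in> hcarrier (algebraic_tensor_power E n) \<and>
      sum_vector (map (tensor_lact E a) u) = rep a \<bullet>\<^sub>o sum_vector u"
    if "u \<in> hcarrier (algebraic_tensor_power E n)" for u n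
    using that tensor_lact_vector unfolding carrier_algebraic_iff
    by (auto intro!: sum_vector_map bounded_linear_lop_apply)
  have y: "y n \<in> hcarrier (tensor_power E n)" "power_vector n (y n) = rep a \<bullet>\<^sub>o power_vector n (f n)" for n
    using completion_map_embedding[OF module_embedding_algebraic module_embedding_algebraic
        bounded_linear_lop_apply map] fock_component[OF f, of n]
    unfolding y_def power_vector_def tensor_power_def by blast+
  have "fock_lact E a f = y"
    using f by (auto simp: fock_lact_def y_def)
  moreover have "l2_nth (rep a \<bullet>\<^sub>o fock_vector f) w = l2_nth (power_vector (length w) (y (length w))) w" for w
    by (simp add: y rep_nth fock_vector_nth[OF f])
  ultimately show "fock_lact E a f \<in> hcarrier (fock_space E)" "fock_vector (fock_lact E a f) = rep a \<bullet>\<^sub>o fock_vector f"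
    using fock_memI[of y "rep a \<bullet>\<^sub>o fock_vector f"] y(1) by simp_all
qed

lemma creation_vector:
  assumes f: "f \<in> hcarrier (fock_space E)" and \<xi>: "\<xi> \<in> hcarrier E"
  shows "creation E \<xi> f \<in> hcarrier (fock_space E)" "fock_vector (creation E \<xi> f) = create \<xi> \<bullet>\<^sub>o fock_vector f"
proof -
  define y where "y n = (case n of 0 \<Rightarrow> hzero (tensor_power E 0)
     | Suc m \<Rightarrow> completion_map (algebraic_tensor_power E (Suc m)) (map (\<lambda>(xs, a). (\<xi> # xs, a))) (f m))" for n
  have map: "map (\<lambda>(xs, a). (\<xi> # xs, a)) u \<in> hcarrier (algebraic_tensor_power E (Suc n)) \<and>
      sum_vector (map (\<lambda>(xs, a). (\<xi> # xs, a)) u) = create \<xi> \<bullet>\<^sub>o sum_vector u"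
    if "u \<in> hcarrier (algebraic_tensor_power E n)" for u n
    using that \<xi> unfolding carrier_algebraic_iff
    by (intro conjI sum_vector_map bounded_linear_lop_apply) fastforce+
  have y0: "y 0 \<in> hcarrier (tensor_power E 0)" "power_vector 0 (y 0) = 0"
    using module_embeddingD[OF power_vector(1)[of 0]] by (simp_all add: y_def)
  have ySuc: "y (Suc n) \<in> hcarrier (tensor_power E (Suc n))"
    "power_vector (Suc n) (y (Suc n)) = create \<xi> \<bullet>\<^sub>o power_vector n (f n)" for n
    using completion_map_embedding[OF module_embedding_algebraic module_embedding_algebraic
        bounded_linear_lop_apply map] fock_component[OF f, of n]
    unfolding y_def power_vector_def tensor_power_def by (simp_all del: map_eq_conv)
  have "creation E \<xi> f = y"
    using f by (auto simp: creation_def y_def)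
  moreover have "l2_nth (create \<xi> \<bullet>\<^sub>o fock_vector f) w = l2_nth (power_vector (length w) (y (length w))) w" for w
    using \<xi> by (cases w) (simp_all add: y0 ySuc create_nth zero_l2.rep_eq fock_vector_nth[OF f])
  moreover have "y n \<in> hcarrier (tensor_power E n)" for n
    using y0 ySuc by (cases n) auto
  ultimately show "creation E \<xi> f \<in> hcarrier (fock_space E)" "fock_vector (creation E \<xi> f) = create \<xi> \<bullet>\<^sub>o fock_vector f"
    using fock_memI[of y "create \<xi> \<bullet>\<^sub>o fock_vector f"] by simp_all
qed

end

section \<open>Transport to the Fock space\<close>

context endomorphism_sequence
begin

abbreviation F where "F \<equiv> fock_space E"

definition fock_op :: "(nat list, 'a) lop \<Rightarrow> ('a, nat \<Rightarrow> 'a) fock_vector \<Rightarrow> ('a, nat \<Rightarrow> 'a) fock_vector" where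
  "fock_op x = (\<lambda>f\<in>hcarrier F. inv_into (hcarrier F) fock_vector (x \<bullet>\<^sub>o fock_vector f))"

lemma fock_vector_eqI: "f \<in> hcarrier F \<Longrightarrow> g \<in> hcarrier F \<Longrightarrow> fock_vector f = fock_vector g \<Longrightarrow> f = g"
  using bij_fock_vector by (meson bij_betw_imp_inj_on inj_onD)

lemma fock_vector_surj: obtains f where "f \<in> hcarrier F" "fock_vector f = g"
  using bij_fock_vector by (metis UNIV_I bij_betw_imp_surj_on image_iff)

lemma fock_op_vector:
  assumes "f \<in> hcarrier F"
  shows "fock_op x f \<in> hcarrier F" "fock_vector (fock_op x f) = x \<bullet>\<^sub>o fock_vector f"
proof -
  have "x \<bullet>\<^sub>o fock_vector f \<in> fock_vector ` hcarrier F"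
    using bij_fock_vector by (simp add: bij_betw_def)
  then show "fock_op x f \<in> hcarrier F" "fock_vector (fock_op x f) = x \<bullet>\<^sub>o fock_vector f"
    using assms by (auto simp: fock_op_def inv_into_into f_inv_into_f)
qed

lemma fock_op_PiE: "fock_op x \<in> hcarrier F \<rightarrow>\<^sub>E hcarrier F"
  using fock_op_vector(1) by (auto simp: fock_op_def)

lemma fock_op_eqI:
  assumes "T \<in> hcarrier F \<rightarrow>\<^sub>E hcarrier F" "\<And>f. f \<in> hcarrier F \<Longrightarrow> fock_vector (T f) = x \<bullet>\<^sub>o fock_vector f"
  shows "T = fock_op x"
proof (rule PiE_ext[OF assms(1) fock_op_PiE])
  fix f assume f: "f \<in> hcarrier F"
  then have "T f \<in> hcarrier F"
    using assms(1) by blast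
  with f show "T f = fock_op x f"
    using assms(2) fock_op_vector by (intro fock_vector_eqI) auto
qed

lemma fock_op_inject: "fock_op x = fock_op y \<longleftrightarrow> x = y"
proof
  assume eq: "fock_op x = fock_op y"
  show "x = y"
  proof (rule lop_eqI)
    fix g
    obtain f where "f \<in> hcarrier F" "fock_vector f = g"
      by (rule fock_vector_surj)
    then show "x \<bullet>\<^sub>o g = y \<bullet>\<^sub>o g"
      using fock_op_vector(2) eq by metis
  qed
qed simp

lemmas fock_moduleD = module_embeddingD[OF module_embedding_fock]

lemma fock_op_algebra:
  "op_zero F = fock_op 0" "op_add F (fock_op x) (fock_op y) = fock_op (x + y)"
  "op_scale F c (fock_op x) = fock_op (c *\<^sub>C x)" "op_mult F (fock_op x) (fock_op y) = fock_op (x * y)"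
proof -
  show "op_zero F = fock_op 0"
    by (rule fock_op_eqI) (auto simp: op_zero_def fock_moduleD)
  show "op_add F (fock_op x) (fock_op y) = fock_op (x + y)"
    by (rule fock_op_eqI) (auto simp: op_add_def fock_moduleD fock_op_vector)
  show "op_scale F c (fock_op x) = fock_op (c *\<^sub>C x)"
    by (rule fock_op_eqI) (auto simp: op_scale_def fock_moduleD fock_op_vector)
  show "op_mult F (fock_op x) (fock_op y) = fock_op (x * y)"
    by (rule fock_op_eqI) (auto simp: op_mult_def compose_def fock_op_vector)
qed

lemma is_adjoint_fock_op: "is_adjoint F (fock_op x) (fock_op (star x))"
  by (simp add: is_adjoint_def fock_moduleD fock_op_vector star_lop)

lemma fock_op_adjointable: "fock_op x \<in> adjointable F"
  unfolding adjointable_def using fock_op_PiE is_adjoint_fock_op by blast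

lemma adjoint_fock_op_unique:
  assumes "S \<in> adjointable F" "is_adjoint F (fock_op x) S"
  shows "S = fock_op (star x)"
proof (rule fock_op_eqI)
  show S: "S \<in> hcarrier F \<rightarrow>\<^sub>E hcarrier F"
    using assms(1) by (simp add: adjointable_def)
  fix f assume f: "f \<in> hcarrier F"
  then have Sf: "S f \<in> hcarrier F"
    using S by blast
  have "l2_inner g (fock_vector (S f) - star x \<bullet>\<^sub>o fock_vector f) = 0" for g
  proof -
    obtain h where h: "h \<in> hcarrier F" "fock_vector h = g"
      by (rule fock_vector_surj)
    have "hinner F (fock_op x h) f = hinner F h (S f)"
      using assms(2) h f by (simp add: is_adjoint_def)
    then show ?thesis
      using h f Sf by (simp add: fock_moduleD fock_op_vector l2_inner.diff_right star_lop)
  qed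
  then show "fock_vector (S f) = star x \<bullet>\<^sub>o fock_vector f"
    using l2_zero_if_inner_zero by force
qed

lemma op_tendsto_fock_op:
  assumes "X \<longlonglongrightarrow> x"
  shows "op_tendsto F (\<lambda>n. fock_op (X n)) (fock_op x)"
  unfolding op_tendsto_def
proof (intro allI impI)
  fix e :: real assume "e > 0"
  then obtain N where N: "\<And>n. n \<ge> N \<Longrightarrow> norm (X n - x) < e"
    using assms by (auto simp: lim_sequentially dist_norm)
  have "hnorm F (hdiff F (fock_op (X n) f) (fock_op x f)) \<le> e * hnorm F f"
    if "n \<ge> N" "f \<in> hcarrier F" for n f
  proof -
    have "hnorm F (hdiff F (fock_op (X n) f) (fock_op x f)) = norm ((X n - x) \<bullet>\<^sub>o fock_vector f)"
      using that(2) by (simp add: hnorm_hdiff_embedding[OF module_embedding_fock] fock_op_vector)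
    also have "\<dots> \<le> norm (X n - x) * norm (fock_vector f)"
      by (rule norm_lop_apply_le)
    also have "\<dots> \<le> e * norm (fock_vector f)"
      using N[OF that(1)] by (intro mult_right_mono) auto
    finally show ?thesis
      using that(2) by (simp add: hnorm_embedding[OF module_embedding_fock])
  qed
  then show "\<exists>N. \<forall>n\<ge>N. \<forall>f\<in>hcarrier F. hnorm F (hdiff F (fock_op (X n) f) (fock_op x f)) \<le> e * hnorm F f"
    by blast
qed

text \<open>Boundedness is not recorded in \<open>adjointable\<close>. The limit \<open>T\<close> is
  identified through \<open>X\<close>, which is Cauchy since all its late members are uniformly
  close to \<open>T\<close>.\<close>

lemma op_tendsto_imp_fock_op:
  assumes lim: "op_tendsto F (\<lambda>n. fock_op (X n)) T" and T: "T \<in> adjointable F"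
  obtains x where "X \<longlonglongrightarrow> x" "T = fock_op x"
proof -
  have T_PiE: "T \<in> hcarrier F \<rightarrow>\<^sub>E hcarrier F"
    using T by (simp add: adjointable_def)
  have near: "\<exists>N. \<forall>n\<ge>N. \<forall>f\<in>hcarrier F. norm (X n \<bullet>\<^sub>o fock_vector f - fock_vector (T f)) \<le> e * norm (fock_vector f)"
    if "e > 0" for e
  proof -
    obtain N where N: "\<And>n f. n \<ge> N \<Longrightarrow> f \<in> hcarrier F \<Longrightarrow> hnorm F (hdiff F (fock_op (X n) f) (T f)) \<le> e * hnorm F f"
      using lim \<open>e > 0\<close> unfolding op_tendsto_def by blast
    have "norm (X n \<bullet>\<^sub>o fock_vector f - fock_vector (T f)) \<le> e * norm (fock_vector f)"
      if "n \<ge> N" "f \<in> hcarrier F" for n f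
    proof -
      have "T f \<in> hcarrier F"
        using T_PiE that(2) by blast
      then show ?thesis
        using N[OF that] that(2)
        by (simp add: hnorm_hdiff_embedding[OF module_embedding_fock] hnorm_embedding[OF module_embedding_fock] fock_op_vector)
    qed
    then show ?thesis by blast
  qed
  have "Cauchy X"
  proof (rule CauchyI)
    fix e :: real assume "e > 0"
    then have "e / 3 > 0" by simp
    then obtain N where N: "\<And>n f. n \<ge> N \<Longrightarrow> f \<in> hcarrier F \<Longrightarrow>
        norm (X n \<bullet>\<^sub>o fock_vector f - fock_vector (T f)) \<le> e / 3 * norm (fock_vector f)"
      using near by blast
    have "norm (X m - X n) < e" if "m \<ge> N" "n \<ge> N" for m n
    proof -
      have "norm (X m - X n) \<le> 2 * (e / 3)"
      proof (rule norm_lop_le)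
        fix g
        obtain f where f: "f \<in> hcarrier F" "fock_vector f = g"
          by (rule fock_vector_surj)
        have "norm ((X m - X n) \<bullet>\<^sub>o g) \<le> norm (X m \<bullet>\<^sub>o g - fock_vector (T f)) + norm (X n \<bullet>\<^sub>o g - fock_vector (T f))"
          using norm_triangle_ineq4[of "X m \<bullet>\<^sub>o g - fock_vector (T f)" "X n \<bullet>\<^sub>o g - fock_vector (T f)"] by simp
        then show "norm ((X m - X n) \<bullet>\<^sub>o g) \<le> 2 * (e / 3) * norm g"
          using N[OF that(1) f(1)] N[OF that(2) f(1)] f(2) by simp
      qed (use \<open>e > 0\<close> in simp)
      then show ?thesis
        using \<open>e > 0\<close> by simp
    qed
    then show "\<exists>N. \<forall>m\<ge>N. \<forall>n\<ge>N. norm (X m - X n) < e" by blast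
  qed
  then obtain x where x: "X \<longlonglongrightarrow> x"
    by (auto simp: Cauchy_convergent_iff convergent_def)
  have "T = fock_op x"
  proof (rule fock_op_eqI[OF T_PiE])
    fix f assume f: "f \<in> hcarrier F"
    have 1: "(\<lambda>n. X n \<bullet>\<^sub>o fock_vector f) \<longlonglongrightarrow> x \<bullet>\<^sub>o fock_vector f"
      by (rule bounded_linear.tendsto[OF bounded_linear_lop_apply_left x])
    have 2: "(\<lambda>n. X n \<bullet>\<^sub>o fock_vector f) \<longlonglongrightarrow> fock_vector (T f)"
      unfolding lim_sequentially dist_norm
    proof (intro allI impI)
      fix e :: real assume "e > 0"
      define d where "d = e / (norm (fock_vector f) + 1)"
      have pos: "norm (fock_vector f) + 1 > 0" by (simp add: add_nonneg_pos)
      then have "d > 0" using \<open>e > 0\<close> by (simp add: d_def)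
      then obtain N where N: "\<And>n. n \<ge> N \<Longrightarrow> norm (X n \<bullet>\<^sub>o fock_vector f - fock_vector (T f)) \<le> d * norm (fock_vector f)"
        using near f by blast
      have "d * norm (fock_vector f) < d * (norm (fock_vector f) + 1)"
        using \<open>d > 0\<close> by simp
      also have "\<dots> = e"
        using pos by (simp add: d_def)
      finally show "\<exists>N. \<forall>n\<ge>N. norm (X n \<bullet>\<^sub>o fock_vector f - fock_vector (T f)) < e"
        using N le_less_trans by blast
    qed
    from LIMSEQ_unique[OF 2 1] show "fock_vector (T f) = x \<bullet>\<^sub>o fock_vector f" .
  qed
  with x show ?thesis by (rule that)
qed

text \<open>Convergence in the sense of \<open>op_tendsto\<close> between transported operators is
  norm convergence in \<open>lop\<close>, and limits of transported operators are again
  transported.\<close>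

lemma fock_op_closed_subspace_iff:
  "op_closed_subspace F (fock_op ` S) \<longleftrightarrow>
    closed S \<and> 0 \<in> S \<and> (\<forall>x\<in>S. \<forall>y\<in>S. x + y \<in> S) \<and> (\<forall>c. \<forall>x\<in>S. c *\<^sub>C x \<in> S)"
proof -
  have mem: "fock_op x \<in> fock_op ` S \<longleftrightarrow> x \<in> S" for x
    by (auto simp: fock_op_inject)
  have "(\<forall>Y T. (\<forall>n. Y n \<in> fock_op ` S) \<and> T \<in> adjointable F \<and> op_tendsto F Y T \<longrightarrow> T \<in> fock_op ` S) \<longleftrightarrow> closed S"
  proof
    assume *: "\<forall>Y T. (\<forall>n. Y n \<in> fock_op ` S) \<and> T \<in> adjointable F \<and> op_tendsto F Y T \<longrightarrow> T \<in> fock_op ` S"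
    show "closed S"
      unfolding closed_sequential_limits
    proof (intro allI impI, elim conjE)
      fix X x assume "\<forall>n. X n \<in> S" "X \<longlonglongrightarrow> x"
      then have "fock_op x \<in> fock_op ` S"
        using *[rule_format, of "\<lambda>n. fock_op (X n)" "fock_op x"] op_tendsto_fock_op fock_op_adjointable by blast
      then show "x \<in> S" by (simp add: mem)
    qed
  next
    assume S: "closed S"
    show "\<forall>Y T. (\<forall>n. Y n \<in> fock_op ` S) \<and> T \<in> adjointable F \<and> op_tendsto F Y T \<longrightarrow> T \<in> fock_op ` S"
    proof (intro allI impI, elim conjE)
      fix Y T assume Y: "\<forall>n. Y n \<in> fock_op ` S" and T: "T \<in> adjointable F" "op_tendsto F Y T"
      then have "\<forall>n. \<exists>x. x \<in> S \<and> Y n = fock_op x" by blast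
      then obtain X where X: "\<And>n. X n \<in> S" "\<And>n. Y n = fock_op (X n)" by metis
      then have "Y = (\<lambda>n. fock_op (X n))" by auto
      then obtain x where "X \<longlonglongrightarrow> x" "T = fock_op x"
        using op_tendsto_imp_fock_op T by blast
      then show "T \<in> fock_op ` S"
        using S X(1) closed_sequentially by blast
    qed
  qed
  then show ?thesis
    unfolding op_closed_subspace_def
    by (auto simp: fock_op_algebra mem fock_op_adjointable)
qed

lemma op_cstar_subalgebra_toeplitz: "op_cstar_subalgebra F (fock_op ` toeplitz)"
  unfolding op_cstar_subalgebra_def fock_op_closed_subspace_iff
proof (intro conjI ballI allI impI)
  fix T S assume "T \<in> fock_op ` toeplitz" "S \<in> adjointable F" "is_adjoint F T S"
  then show "S \<in> fock_op ` toeplitz"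
    using adjoint_fock_op_unique toeplitz_star by blast
next
  fix S T assume "S \<in> fock_op ` toeplitz" "T \<in> fock_op ` toeplitz"
  then show "op_mult F S T \<in> fock_op ` toeplitz"
    by (auto simp: fock_op_algebra toeplitz_mult)
qed (auto simp: toeplitz_closed toeplitz_zero toeplitz_add toeplitz_scaleC)

lemma fock_lact_eq: "fock_lact E a = fock_op (rep a)"
  using fock_lact_vector by (intro fock_op_eqI) (auto simp: fock_lact_def)

lemma creation_eq: "\<xi> \<in> hcarrier E \<Longrightarrow> creation E \<xi> = fock_op (create \<xi>)"
  using creation_vector by (intro fock_op_eqI) (auto simp: creation_def)

text \<open>As the \<open>\<rho>\<^sub>n\<close> are non-degenerate, the monomials are limits of products of generators.\<close>

lemma toeplitz_subset_subalgebra: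
  assumes B: "closed B" "0 \<in> B" "\<And>x y. x \<in> B \<Longrightarrow> y \<in> B \<Longrightarrow> x + y \<in> B" "\<And>c x. x \<in> B \<Longrightarrow> c *\<^sub>C x \<in> B"
    "\<And>x y. x \<in> B \<Longrightarrow> y \<in> B \<Longrightarrow> x * y \<in> B" "\<And>x. x \<in> B \<Longrightarrow> star x \<in> B"
    and gen: "\<And>a. rep a \<in> B" "\<And>\<xi>. \<xi> \<in> hcarrier E \<Longrightarrow> create \<xi> \<in> B"
  shows "toeplitz \<subseteq> B"
proof -
  interpret rep: bounded_linear rep
    by (rule bounded_linear_rep)
  have isom: "isometry_lop n * rep b \<in> B" for n b
    using gen(2)[OF single_vector_in_carrier[of n b]] by (simp add: create_single_vector)
  have approx: "x \<in> B" if "\<And>e. e > 0 \<Longrightarrow> \<exists>y\<in>B. norm (y - x) < e" for x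
    using closed_approachable[OF B(1), of x] that by (simp add: dist_norm)
  have word: "word_lop u * rep a \<in> B" for u a
  proof (induction u arbitrary: a)
    case Nil
    then show ?case by (simp add: gen)
  next
    case (Cons n u)
    let ?w = "isometry_lop n * word_lop u :: (nat list, 'a) lop"
    show ?case
    proof (rule approx)
      fix e :: real assume "e > 0"
      define K where "K = norm ?w + 1"
      have "K > 0" by (simp add: K_def add_nonneg_pos)
      then have "e / K > 0" using \<open>e > 0\<close> by simp
      then obtain v where v: "norm (word_endo \<rho> u v * a - a) < e / K"
        using word_endo_unit_element by blast
      \<comment> \<open>The coefficient \<open>v\<close> is moved through the word \<open>u\<close>;
        choosing it so that its image almost fixes \<open>a\<close> removes it in the limit.\<close>
      have "(isometry_lop n * rep v) * (word_lop u * rep a) = ?w * rep (word_endo \<rho> u v * a)"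
      proof -
        have "(isometry_lop n * rep v) * (word_lop u * rep a) = isometry_lop n * (rep v * word_lop u) * rep a"
          by (simp add: mult.assoc)
        then show ?thesis
          by (simp add: rep_word_lop rep_mult mult.assoc)
      qed
      then have "?w * rep (word_endo \<rho> u v * a) \<in> B"
        using B(5)[OF isom Cons.IH] by metis
      moreover have "norm (?w * rep (word_endo \<rho> u v * a) - word_lop (n # u) * rep a) < e"
      proof -
        have "?w * rep (word_endo \<rho> u v * a) - word_lop (n # u) * rep a = ?w * rep (word_endo \<rho> u v * a - a)"
          by (simp add: rep.diff right_diff_distrib)
        also have "norm \<dots> \<le> norm ?w * norm (word_endo \<rho> u v * a - a)"
          using norm_mult_ineq[of ?w "rep (word_endo \<rho> u v * a - a)"] by simp
        also have "\<dots> \<le> K * norm (word_endo \<rho> u v * a - a)"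
          by (intro mult_right_mono) (auto simp: K_def)
        also have "\<dots> < e"
          using v \<open>K > 0\<close> by (simp add: field_simps)
        finally show ?thesis .
      qed
      ultimately show "\<exists>y\<in>B. norm (y - word_lop (n # u) * rep a) < e" by blast
    qed
  qed
  have "monomial u a v \<in> B" for u a v
  proof (rule approx)
    fix e :: real assume "e > 0"
    let ?u = "word_lop u :: (nat list, 'a) lop" and ?v = "star (word_lop v) :: (nat list, 'a) lop"
    define K where "K = norm ?u * norm ?v + 1"
    have "K > 0" by (simp add: K_def add_nonneg_pos)
    then have "e / K > 0" using \<open>e > 0\<close> by simp
    then obtain c where c: "norm (a * c - a) < e / K"
      using unit_element by blast
    \<comment> \<open>A coefficient inserted on the right splits the monomial into a word with
      coefficient and the adjoint of another one, both already known to lie in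
      \<open>B\<close>.\<close>
    have "monomial u (a * c) v = (word_lop u * rep a) * star (word_lop v * rep (star c))"
      by (simp add: monomial_def star_mult rep_mult rep_star star_star mult.assoc)
    then have "monomial u (a * c) v \<in> B"
      using B(5)[OF word B(6)[OF word]] by simp
    moreover have "norm (monomial u (a * c) v - monomial u a v) < e"
    proof -
      have "monomial u (a * c) v - monomial u a v = ?u * rep (a * c - a) * ?v"
        by (simp add: monomial_def rep.diff right_diff_distrib left_diff_distrib)
      also have "norm \<dots> \<le> norm ?u * norm (rep (a * c - a)) * norm ?v"
        by (rule order_trans[OF norm_mult_ineq mult_right_mono[OF norm_mult_ineq]]) simp
      also have "\<dots> \<le> K * norm (a * c - a)"
        by (simp add: K_def distrib_right)
      also have "\<dots> < e"
        using c \<open>K > 0\<close> by (simp add: field_simps)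
      finally show ?thesis .
    qed
    ultimately show "\<exists>y\<in>B. norm (y - monomial u a v) < e" by blast
  qed
  then have in_B: "x \<in> B" if "x \<in> monomials" for x
    using that by (auto simp: monomials_def)
  have "x \<in> B" if "x \<in> span monomials" for x
    using that by (induction rule: span_induct_alt) (auto intro: B(2,3,4) in_B simp: scaleR_scaleC)
  then show ?thesis
    unfolding toeplitz_def using B(1) by (intro closure_minimal) auto
qed

lemma toeplitz_pimsner_eq: "toeplitz_pimsner E = fock_op ` toeplitz"
proof
  show "toeplitz_pimsner E \<subseteq> fock_op ` toeplitz"
    unfolding toeplitz_pimsner_def op_cstar_generated_def
  proof (rule Inter_lower, intro CollectI conjI op_cstar_subalgebra_toeplitz)
    show "range (fock_lact E) \<union> creation E ` hcarrier E \<subseteq> fock_op ` toeplitz"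
      by (auto simp: fock_lact_eq creation_eq rep_in_toeplitz create_in_toeplitz)
  qed
  show "fock_op ` toeplitz \<subseteq> toeplitz_pimsner E"
    unfolding toeplitz_pimsner_def op_cstar_generated_def
  proof (rule Inter_greatest, elim CollectE conjE)
    fix C assume C: "op_cstar_subalgebra F C" and gen: "range (fock_lact E) \<union> creation E ` hcarrier E \<subseteq> C"
    \<comment> \<open>Pulling \<open>C\<close> back avoids the question whether every adjointable
      operator on the Fock space has the form \<open>fock_op x\<close>.\<close>
    define B where "B = {x. fock_op x \<in> C}"
    have C_closed: "\<forall>S T. (\<forall>n. S n \<in> C) \<and> T \<in> adjointable F \<and> op_tendsto F S T \<longrightarrow> T \<in> C"
      and C_zero: "op_zero F \<in> C" and C_add: "\<forall>S\<in>C. \<forall>T\<in>C. op_add F S T \<in> C"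
      and C_scale: "\<forall>c. \<forall>T\<in>C. op_scale F c T \<in> C" and C_mult: "\<forall>S\<in>C. \<forall>T\<in>C. op_mult F S T \<in> C"
      and C_star: "\<forall>T\<in>C. \<forall>S\<in>adjointable F. is_adjoint F T S \<longrightarrow> S \<in> C"
      using C unfolding op_cstar_subalgebra_def op_closed_subspace_def by - (elim conjE, assumption)+
    have "closed B"
      unfolding closed_sequential_limits B_def
    proof (intro allI impI, elim conjE)
      fix X x assume "\<forall>n. X n \<in> {x. fock_op x \<in> C}" "X \<longlonglongrightarrow> x"
      then show "x \<in> {x. fock_op x \<in> C}"
        using C_closed[THEN spec[of _ "\<lambda>n. fock_op (X n)"], THEN spec[of _ "fock_op x"], THEN mp]
          op_tendsto_fock_op[OF \<open>X \<longlonglongrightarrow> x\<close>] fock_op_adjointable[of x] by simp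
    qed
    moreover have "0 \<in> B"
      using C_zero by (simp add: B_def fock_op_algebra)
    moreover have "x + y \<in> B" if "x \<in> B" "y \<in> B" for x y
      using C_add that by (simp add: B_def flip: fock_op_algebra)
    moreover have "c *\<^sub>C x \<in> B" if "x \<in> B" for c x
      using C_scale that by (simp add: B_def flip: fock_op_algebra)
    moreover have "x * y \<in> B" if "x \<in> B" "y \<in> B" for x y
      using C_mult that by (simp add: B_def flip: fock_op_algebra)
    moreover have "star x \<in> B" if "x \<in> B" for x
      using C_star that is_adjoint_fock_op[of x] fock_op_adjointable by (simp add: B_def)
    moreover have "rep a \<in> B" for a
      using gen by (auto simp: B_def simp flip: fock_lact_eq)
    moreover have "create \<xi> \<in> B" if "\<xi> \<in> hcarrier E" for \<xi>
      using gen that by (auto simp: B_def simp flip: creation_eq)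
    ultimately have "toeplitz \<subseteq> B"
      by (rule toeplitz_subset_subalgebra)
    then show "fock_op ` toeplitz \<subseteq> C"
      by (auto simp: B_def)
  qed
qed

lemma toeplitz_pimsner_simple:
  assumes nonzero: "\<exists>a::'a. a \<noteq> 0"
    and limsup_norm: "\<And>a. limsup (\<lambda>n. ereal (norm (\<rho> n a))) = ereal (norm a)"
    and no_ideal: "\<not> (\<exists>I. closed_ideal I \<and> I \<noteq> {0} \<and> I \<noteq> UNIV \<and> (\<forall>n. \<rho> n ` I \<subseteq> I))"
  shows "op_simple F (toeplitz_pimsner E)"
  unfolding op_simple_def toeplitz_pimsner_eq
proof (intro conjI allI impI op_cstar_subalgebra_toeplitz)
  obtain a :: 'a where "a \<noteq> 0" using nonzero by blast
  then have "rep a \<noteq> 0"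
    using norm_rep[of a] by (metis norm_eq_zero)
  then have "fock_op (rep a) \<noteq> op_zero F"
    by (simp add: fock_op_algebra fock_op_inject)
  then show "fock_op ` toeplitz \<noteq> {op_zero F}"
    using rep_in_toeplitz by blast
  fix I assume I: "op_ideal F (fock_op ` toeplitz) I"
  define J where "J = {x. fock_op x \<in> I}"
  have IJ: "I = fock_op ` J"
    using I by (auto simp: op_ideal_def J_def)
  have mem: "fock_op x \<in> I \<longleftrightarrow> x \<in> J" for x
    by (simp add: J_def)
  have sub: "closed J" "0 \<in> J" "\<And>x y. x \<in> J \<Longrightarrow> y \<in> J \<Longrightarrow> x + y \<in> J" "\<And>c x. x \<in> J \<Longrightarrow> c *\<^sub>C x \<in> J"
    using I fock_op_closed_subspace_iff[of J] by (auto simp: op_ideal_def IJ)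
  have subset: "J \<subseteq> toeplitz"
    using I by (auto simp: op_ideal_def J_def fock_op_inject)
  have mult: "x * y \<in> J" "y * x \<in> J" if "x \<in> toeplitz" "y \<in> J" for x y
  proof -
    have "op_mult F (fock_op x) (fock_op y) \<in> I \<and> op_mult F (fock_op y) (fock_op x) \<in> I"
      using I that by (simp add: op_ideal_def mem)
    then show "x * y \<in> J" "y * x \<in> J"
      by (simp_all add: fock_op_algebra mem)
  qed
  have "J = {0} \<or> J = toeplitz"
    using toeplitz_simple[OF limsup_norm subset sub(2,1,3,4) mult no_ideal] by blast
  then show "I = {op_zero F} \<or> I = fock_op ` toeplitz"
    by (auto simp: IJ fock_op_algebra)
qed

end

theorem theorem4p3:
  fixes \<rho> :: "nat \<Rightarrow> 'a::cstar_algebra \<Rightarrow> 'a"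
  assumes nonzero: "\<exists>a::'a. a \<noteq> 0"
    and separable: "separable_space (euclidean :: 'a topology)"
    and endo: "\<And>n. star_endomorphism (\<rho> n)"
    and nondeg: "\<And>n. nondegenerate (\<rho> n)"
    and limsup_norm: "\<And>a. limsup (\<lambda>n. ereal (norm (\<rho> n a))) = ereal (norm a)"
    and no_invariant_ideal:
      "\<not> (\<exists>I. closed_ideal I \<and> I \<noteq> {0} \<and> I \<noteq> UNIV \<and> (\<forall>n. \<rho> n ` I \<subseteq> I))"
  shows "op_simple (fock_space (endo_correspondence \<rho>))
           (toeplitz_pimsner (endo_correspondence \<rho>))"
proof -
  interpret endomorphism_sequence \<rho>
    by unfold_locales (rule endo nondeg)+
  show ?thesis
    by (rule toeplitz_pimsner_simple[OF nonzero limsup_norm no_invariant_ideal])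
qed

end
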